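(* Let $(\omega_n)_n$ be a sequence of positive real numbers which tends to $\infty$ as $n\to\infty$. Let $\xi$ be a real number such that there exists an infinite sequence of rational numbers $(p_n/q_n)_n$ (taking infinitely many distinct values) satisfying $$\left|\xi-\frac{p_n}{q_n}\right|<H\left(\frac{p_n}{q_n}\right)^{-\omega_n},$$ where $H(p_{n+1}/q_{n+1})\le H(p_n/q_n)^{O(\omega_n)}$, for all $n\ge 1$. Then, for any non-constant irreducible rational function $F(x)\in K(x)$, where $K$ is a number field with $[K:\mathbb{Q}]=m$, the number $F(\xi)$ is a $U_m$-number.
   Context: For an algebraic number $\alpha$, the height $H(\alpha)$ is the maximum of the absolute values of the coefficients of the minimal polynomial of $\alpha$ over $\mathbb{Z}$. The condition $H(p_{n+1}/q_{n+1})\le H(p_n/q_n)^{O(\omega_n)}$ means that there is a constant $C>0$, independent of $n$, with $H(p_{n+1}/q_{n+1})\le H(p_n/q_n)^{C\omega_n}$. A rational function is irreducible when it is written as a quotient of polynomials without common factor. For a number $\xi$ and an integer $n\ge 1$, $\omega_n^*(\xi)$ is the supremum of the positive real numbers $\omega^*$ for which there exist infinitely many real algebraic numbers $\alpha$ of degree $n$ satisfying $0<|\xi-\alpha|<H(\alpha)^{-\omega^*-1}$. The number $\xi$ is a $U_m$-number (equivalently, a $U_m^*$-number) if $\omega_m^*(\xi)=\infty$ and $\omega_n^*(\xi)<\infty$ for all $1\le n<m$.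
   Formalization: K is assumed to be the exact field of definition of F (F lies in L(x) for no proper subfield L of K), since F(x)=x in Q(√2)(x) would give a U_1-number; and F(ξ) is assumed real, since U_m-numbers are defined here through real algebraic approximations. *)

theory Defs
  imports Complex_Main
    "HOL-Computational_Algebra.Polynomial"
    "HOL-Library.Extended_Nonnegative_Real"
begin

text \<open>
  The minimal polynomial over \<open>\<int>\<close> is normalised to be primitive with positive leading coefficient;
  the predicate determines it uniquely for algebraic \<open>\<alpha>\<close>.
\<close>

definition is_min_int_poly :: "'a::field_char_0 \<Rightarrow> int poly \<Rightarrow> bool" where
  "is_min_int_poly \<alpha> p \<longleftrightarrow>
     p \<noteq> 0 \<and> poly (map_poly of_int p) \<alpha> = 0 \<and>
     (\<forall>q. q \<noteq> 0 \<and> poly (map_poly of_int q) \<alpha> = 0 \<longrightarrow> degree p \<le> degree q) \<and>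
     content p = 1 \<and> lead_coeff p > 0"

definition min_int_poly :: "'a::field_char_0 \<Rightarrow> int poly" where
  "min_int_poly \<alpha> = (THE p. is_min_int_poly \<alpha> p)"

definition alg_degree :: "'a::field_char_0 \<Rightarrow> nat" where
  "alg_degree \<alpha> = degree (min_int_poly \<alpha>)"

definition height :: "'a::field_char_0 \<Rightarrow> int" where
  "height \<alpha> = Max ((\<lambda>i. \<bar>coeff (min_int_poly \<alpha>) i\<bar>) ` {..degree (min_int_poly \<alpha>)})"

text \<open>
  The supremum is taken in \<open>[0, \<infinity>]\<close>, so that it is \<open>0\<close> if there is no admissible exponent.
  The approximating numbers are real, as in the classical definition.
\<close>

definition omega_star :: "nat \<Rightarrow> complex \<Rightarrow> ennreal" where
  "omega_star n z = Sup (ennreal ` {w :: real. w > 0 \<and>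
     infinite {\<alpha> :: real. algebraic \<alpha> \<and> alg_degree \<alpha> = n \<and>
       0 < cmod (z - of_real \<alpha>) \<and>
       cmod (z - of_real \<alpha>) < real_of_int (height \<alpha>) powr (- w - 1)}})"

definition U_number :: "nat \<Rightarrow> complex \<Rightarrow> bool" where
  "U_number m z \<longleftrightarrow> omega_star m z = \<infinity> \<and> (\<forall>n. 1 \<le> n \<and> n < m \<longrightarrow> omega_star n z < \<infinity>)"

definition is_subfield :: "'a::field set \<Rightarrow> bool" where
  "is_subfield K \<longleftrightarrow> 0 \<in> K \<and> 1 \<in> K \<and>
     (\<forall>x\<in>K. \<forall>y\<in>K. x - y \<in> K \<and> x * y \<in> K) \<and> (\<forall>x\<in>K. inverse x \<in> K)"

definition rat_scale :: "rat \<Rightarrow> complex \<Rightarrow> complex" where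
  "rat_scale q z = of_rat q * z"

interpretation rat_vs: vector_space rat_scale
  by unfold_locales (simp_all add: rat_scale_def algebra_simps of_rat_add of_rat_mult)

definition number_field :: "complex set \<Rightarrow> bool" where
  "number_field K \<longleftrightarrow> is_subfield K \<and> (\<exists>B. finite B \<and> rat_vs.span B = K)"

definition field_degree :: "complex set \<Rightarrow> nat" where
  "field_degree K = rat_vs.dim K"

definition poly_over :: "'a::zero set \<Rightarrow> 'a poly \<Rightarrow> bool" where
  "poly_over K P \<longleftrightarrow> (\<forall>i. coeff P i \<in> K)"

text \<open>The rational function \<open>P / Q\<close> (with \<open>Q \<noteq> 0\<close>) belongs to \<open>K(x)\<close>.\<close>

definition ratfun_over :: "'a::field set \<Rightarrow> 'a poly \<Rightarrow> 'a poly \<Rightarrow> bool" where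
  "ratfun_over K P Q \<longleftrightarrow> (\<exists>A B. poly_over K A \<and> poly_over K B \<and> B \<noteq> 0 \<and> P * B = A * Q)"

end

theory Submission
  imports Defs "HOL-Computational_Algebra.Fundamental_Theorem_Algebra"
    "HOL-Computational_Algebra.Polynomial_Factorial" "HOL-Computational_Algebra.Field_as_Ring"
    "HOL-Library.FuncSet"
begin

text \<open>
  Write \<open>F = P / Q\<close>, \<open>\<alpha>\<^sub>n = F (r\<^sub>n)\<close> and \<open>H\<^sub>n\<close> for the height of \<open>r\<^sub>n\<close>. By Lipschitz continuity
  \<open>\<bar>F \<xi> - \<alpha>\<^sub>n\<bar>\<close> is at most a constant times \<open>H\<^sub>n\<close> to the power \<open>-\<omega>\<^sub>n\<close>, and the height of \<open>\<alpha>\<^sub>n\<close>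
  is polynomially bounded in \<open>H\<^sub>n\<close>, so everything rests on two facts.

  First, \<open>\<alpha>\<^sub>n\<close> has degree exactly \<open>m\<close> for large \<open>n\<close>. An element of \<open>K = \<rat>(\<theta>)\<close> of lower degree
  takes the same value under two embeddings of \<open>K\<close>, hence lies in one of finitely many proper
  subfields \<open>L\<close>. If \<open>F\<close> mapped infinitely many rationals into the same \<open>L\<close>, then \<open>F\<close> would have
  coefficients in \<open>L\<close> by rational interpolation.

  Second, a nonzero element of \<open>\<int>[\<theta>]\<close> with coordinates of size \<open>X\<close> has absolute value at least
  a constant times a negative power of \<open>X\<close>: by Siegel's lemma its powers satisfy an integral
  relation with coefficients polynomially bounded in \<open>X\<close>. This bounds \<open>\<bar>\<alpha>\<^sub>n - \<beta>\<bar>\<close> from below for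
  \<open>\<beta>\<close> of degree less than \<open>m\<close>. Taking the least \<open>n\<close> for which \<open>\<alpha>\<^sub>n\<close> is much closer to \<open>F \<xi>\<close> than
  to \<open>\<beta>\<close>, the growth condition bounds \<open>H\<^sub>n\<close> by a power of the height of \<open>\<beta>\<close>, so \<open>\<bar>F \<xi> - \<beta>\<bar>\<close> is
  bounded below by a fixed negative power of that height.

  That \<open>F\<close> is real on the rationals follows from the same bound in \<open>\<int>[\<theta>, cnj \<theta>]\<close>, which shows
  that no nonzero polynomial with coefficients there vanishes at \<open>\<xi>\<close>.
\<close>

section \<open>Subfields and primitive elements\<close>

lemma subfield_closed:
  assumes "is_subfield L"
  shows "0 \<in> L" "1 \<in> L" "x \<in> L \<Longrightarrow> y \<in> L \<Longrightarrow> x - y \<in> L" "x \<in> L \<Longrightarrow> y \<in> L \<Longrightarrow> x * y \<in> L"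
    "x \<in> L \<Longrightarrow> inverse x \<in> L" "x \<in> L \<Longrightarrow> - x \<in> L" "x \<in> L \<Longrightarrow> y \<in> L \<Longrightarrow> x + y \<in> L"
    "x \<in> L \<Longrightarrow> y \<in> L \<Longrightarrow> x / y \<in> L" "x \<in> L \<Longrightarrow> x ^ n \<in> L"
proof -
  show zero: "0 \<in> L" and one: "1 \<in> L" using assms by (auto simp: is_subfield_def)
  show diff: "x - y \<in> L" if "x \<in> L" "y \<in> L" for x y using assms that by (auto simp: is_subfield_def)
  show mult: "x * y \<in> L" if "x \<in> L" "y \<in> L" for x y using assms that by (auto simp: is_subfield_def)
  show inv: "inverse x \<in> L" if "x \<in> L" for x using assms that by (auto simp: is_subfield_def)
  show neg: "- x \<in> L" if "x \<in> L" for x using diff[OF zero that] by simp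
  show "x + y \<in> L" if "x \<in> L" "y \<in> L" for x y using diff[OF that(1) neg[OF that(2)]] by simp
  show "x / y \<in> L" if "x \<in> L" "y \<in> L" for x y
    using mult[OF that(1) inv[OF that(2)]] by (simp add: field_simps)
  show "x ^ n \<in> L" if "x \<in> L" for x by (induction n) (auto simp: one mult that)
qed

lemma subfield_sum:
  assumes "is_subfield L" "\<And>i. i \<in> I \<Longrightarrow> f i \<in> L"
  shows "sum f I \<in> L"
  using assms(2) by (induction I rule: infinite_finite_induct) (auto intro: subfield_closed[OF assms(1)])

lemma subfield_of_rat:
  fixes L :: "'a::field_char_0 set"
  assumes "is_subfield L"
  shows "of_rat q \<in> L"
proof -
  have nat: "of_nat n \<in> L" for n
    by (induction n) (auto intro: subfield_closed[OF assms])
  have int: "of_int i \<in> L" for i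
    by (cases i) (auto intro!: subfield_closed[OF assms] nat simp del: of_nat_Suc)
  show ?thesis
    by (cases q) (auto simp: of_rat_rat intro!: subfield_closed[OF assms] int)
qed

text \<open>Gaussian elimination, by induction on the number of equations. The solution is kept
  inside the subfield \<open>L\<close>, so that this serves both for relations over the rationals
  and for interpolation over a subfield of the complex numbers.\<close>

lemma underdetermined_system:
  fixes L :: "'a::field set" and A :: "nat \<Rightarrow> 'i \<Rightarrow> 'a"
  assumes "is_subfield L" and "finite I" and "n < card I" and "\<And>j i. A j i \<in> L"
  shows "\<exists>x. (\<forall>i. x i \<in> L) \<and> (\<exists>i\<in>I. x i \<noteq> 0) \<and> (\<forall>j<n. (\<Sum>i\<in>I. A j i * x i) = 0)"
  using assms(2-)
proof (induction n arbitrary: I A)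
  case 0
  then obtain i where "i \<in> I" by fastforce
  then show ?case by (intro exI[of _ "\<lambda>_. 1"]) (auto intro: subfield_closed[OF assms(1)])
next
  case (Suc n)
  note cl = subfield_closed[OF assms(1)]
  show ?case
  proof (cases "\<forall>i\<in>I. A n i = 0")
    case True
    obtain x where "\<forall>i. x i \<in> L" "\<exists>i\<in>I. x i \<noteq> 0" "\<forall>j<n. (\<Sum>i\<in>I. A j i * x i) = 0"
      using Suc.IH[of I A] Suc.prems by auto
    then show ?thesis using True by (intro exI[of _ x]) (auto simp: less_Suc_eq)
  next
    case False
    then obtain i0 where i0: "i0 \<in> I" "A n i0 \<noteq> 0" by auto
    \<comment> \<open>Solving equation \<open>n\<close> for the unknown \<open>i0\<close> and
      substituting into the other equations leaves this system.\<close>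
    define A' where "A' j i = A j i - A j i0 * A n i / A n i0" for j i
    have "n < card (I - {i0})" using Suc.prems i0 by simp
    moreover have "A' j i \<in> L" for j i
      unfolding A'_def by (intro cl Suc.prems)
    ultimately obtain x where x: "\<forall>i. x i \<in> L" "\<exists>i\<in>I - {i0}. x i \<noteq> 0"
        "\<forall>j<n. (\<Sum>i\<in>I - {i0}. A' j i * x i) = 0"
      using Suc.IH[of "I - {i0}" A'] Suc.prems(1) by auto
    \<comment> \<open>The value that equation \<open>n\<close> forces on the unknown
      \<open>i0\<close>.\<close>
    define s where "s = - (\<Sum>i\<in>I - {i0}. A n i * x i) / A n i0"
    define y where "y = x(i0 := s)"
    have "s \<in> L" unfolding s_def by (intro cl subfield_sum[OF assms(1)] Suc.prems) (use x in auto)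
    have yL: "\<forall>i. y i \<in> L" using x \<open>s \<in> L\<close> by (auto simp: y_def)
    have y0: "\<exists>i\<in>I. y i \<noteq> 0" using x(2) by (auto simp: y_def)
    have split: "(\<Sum>i\<in>I. A j i * y i) = A j i0 * s + (\<Sum>i\<in>I - {i0}. A j i * x i)" for j
      by (subst sum.remove[OF Suc.prems(1) i0(1)]) (auto simp: y_def intro!: sum.cong)
    have "(\<Sum>i\<in>I. A j i * y i) = 0" if "j < n" for j
    proof -
      have "0 = (\<Sum>i\<in>I - {i0}. A' j i * x i)" using x(3) that by simp
      also have "\<dots> = (\<Sum>i\<in>I - {i0}. A j i * x i) - A j i0 / A n i0 * (\<Sum>i\<in>I - {i0}. A n i * x i)"
        by (simp add: A'_def algebra_simps sum_subtractf sum_distrib_left)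
      finally show ?thesis unfolding split by (simp add: s_def)
    qed
    moreover have "(\<Sum>i\<in>I. A n i * y i) = 0"
      unfolding split using i0 by (simp add: s_def)
    ultimately show ?thesis using yL y0 by (intro exI[of _ y]) (auto simp: less_Suc_eq)
  qed
qed

lemma map_poly_hom_add:
  assumes "h 0 = 0" "\<And>a b. h (a + b) = h a + h b"
  shows "map_poly h (p + q) = map_poly h p + map_poly h q"
  by (rule poly_eqI) (simp add: coeff_map_poly assms)

lemma map_poly_hom_mult:
  assumes "h 0 = 0" "\<And>a b. h (a + b) = h a + h b" "\<And>a b. h (a * b) = h a * h b"
  shows "map_poly h (p * q) = map_poly h p * map_poly h q"
proof (rule poly_eqI)
  fix n
  have *: "h (sum f A) = (\<Sum>i\<in>A. h (f i))" if "finite A" for f and A :: "nat set"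
    using that by (induction A rule: finite_induct) (auto simp: assms)
  show "coeff (map_poly h (p * q)) n = coeff (map_poly h p * map_poly h q) n"
    by (simp add: coeff_map_poly assms coeff_mult *)
qed

section \<open>Minimal polynomials over \<rat> and conjugates\<close>

lemma degree_map_poly_of_rat [simp]: "degree (map_poly of_rat f :: complex poly) = degree f"
  by (rule degree_map_poly) auto

lemma map_poly_of_rat_eq_0 [simp]: "(map_poly of_rat f :: complex poly) = 0 \<longleftrightarrow> f = 0"
  by (rule map_poly_eq_0_iff) auto

text \<open>Embeddings of \<open>\<rat>(\<theta>)\<close> into the complex numbers are never formed
  as maps: the embedding that sends \<theta> to a conjugate \<open>w\<close> takes
  \<open>rat_eval g \<theta>\<close> to \<open>rat_eval g w\<close>.\<close>

definition rat_eval :: "rat poly \<Rightarrow> complex \<Rightarrow> complex" where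
  "rat_eval g z = poly (map_poly of_rat g) z"

lemma rat_eval_simps [simp]:
  "rat_eval 0 z = 0" "rat_eval 1 z = 1"
  "rat_eval (pCons a g) z = of_rat a + z * rat_eval g z"
  "rat_eval (f + g) z = rat_eval f z + rat_eval g z"
  "rat_eval (f * g) z = rat_eval f z * rat_eval g z"
proof -
  show "rat_eval 1 z = 1" by (simp add: rat_eval_def map_poly_1')
  show "rat_eval (pCons a g) z = of_rat a + z * rat_eval g z"
    by (simp add: rat_eval_def map_poly_pCons)
  show "rat_eval (f + g) z = rat_eval f z + rat_eval g z"
    by (simp add: rat_eval_def map_poly_hom_add of_rat_add)
  show "rat_eval (f * g) z = rat_eval f z * rat_eval g z"
    by (simp add: rat_eval_def map_poly_hom_mult of_rat_add of_rat_mult)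
qed (simp add: rat_eval_def)

lemma rat_eval_more [simp]:
  "rat_eval (- f) z = - rat_eval f z"
  "rat_eval (f - g) z = rat_eval f z - rat_eval g z"
proof -
  show *: "rat_eval (- f) z = - rat_eval f z" for f
    using rat_eval_simps(4)[of "- f" f z] by (simp add: eq_neg_iff_add_eq_0)
  show "rat_eval (f - g) z = rat_eval f z - rat_eval g z"
    using rat_eval_simps(4)[of f "- g" z] by (simp add: *)
qed

lemma rat_eval_smult [simp]: "rat_eval (smult a g) z = of_rat a * rat_eval g z"
  using rat_eval_simps(5)[of "[:a:]" g z] by simp

lemma rat_eval_altdef: "rat_eval g z = (\<Sum>i\<le>degree g. of_rat (coeff g i) * z ^ i)"
  by (simp add: rat_eval_def poly_altdef coeff_map_poly)

text \<open>A generator of the ideal of annihilators, fixed only up to a constant factor; the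
  leading coefficient is left free because only degrees and divisibility matter.\<close>

definition minimal_rat_poly :: "complex \<Rightarrow> rat poly \<Rightarrow> bool" where
  "minimal_rat_poly z f \<longleftrightarrow> f \<noteq> 0 \<and> rat_eval f z = 0 \<and> (\<forall>g. rat_eval g z = 0 \<longrightarrow> f dvd g)"

lemma minimal_rat_poly_exists:
  assumes "g \<noteq> 0" "rat_eval g z = 0"
  shows "\<exists>f. minimal_rat_poly z f"
proof -
  define f where "f = arg_min degree (\<lambda>g. g \<noteq> 0 \<and> rat_eval g z = 0)"
  have f: "f \<noteq> 0 \<and> rat_eval f z = 0"
    unfolding f_def by (rule arg_min_natI[of _ g]) (use assms in auto)
  have min: "degree f \<le> degree h" if "h \<noteq> 0" "rat_eval h z = 0" for h
    unfolding f_def by (rule arg_min_nat_le) (use that in auto)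
  have "f dvd h" if "rat_eval h z = 0" for h
  proof -
    have "rat_eval h z = rat_eval (h div f * f) z + rat_eval (h mod f) z"
      by (metis div_mult_mod_eq rat_eval_simps(4))
    then have "rat_eval (h mod f) z = 0" using f that by simp
    then have "h mod f = 0" using min[of "h mod f"] f degree_mod_less'[of f h] by force
    then show ?thesis by auto
  qed
  then show ?thesis using f by (auto simp: minimal_rat_poly_def)
qed

lemma minimal_rat_poly_degree_pos:
  assumes "minimal_rat_poly z f" shows "degree f > 0"
proof (rule ccontr)
  assume "\<not> degree f > 0"
  then obtain a where "f = [:a:]" by (auto elim: degree_eq_zeroE)
  then show False using assms by (auto simp: minimal_rat_poly_def)
qed

text \<open>This is irreducibility: the minimal polynomial \<open>h\<close> of \<open>w\<close>
  divides \<open>f\<close>, and the cofactor cannot vanish at \<open>z\<close> without making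
  \<open>h\<close> constant. So \<open>h\<close> vanishes at \<open>z\<close> and is a multiple of
  \<open>f\<close>.\<close>

lemma minimal_rat_poly_conjugate:
  assumes "minimal_rat_poly z f" "rat_eval f w = 0"
  shows "minimal_rat_poly w f"
proof -
  have f: "f \<noteq> 0" "rat_eval f z = 0" "\<And>g. rat_eval g z = 0 \<Longrightarrow> f dvd g"
    using assms by (auto simp: minimal_rat_poly_def)
  obtain h where h: "minimal_rat_poly w h"
    using minimal_rat_poly_exists[of f w] f assms by auto
  then have hf: "h dvd f" using assms by (auto simp: minimal_rat_poly_def)
  then obtain e where e: "f = h * e" by auto
  have "rat_eval h z * rat_eval e z = 0" using f(2) e by simp
  moreover have "rat_eval e z \<noteq> 0"
  proof
    assume "rat_eval e z = 0"
    then have "f dvd e" by (rule f)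
    then have "degree f \<le> degree e" using e f(1) by (intro dvd_imp_degree_le) auto
    then have "degree h = 0" using e f(1) by (auto simp: degree_mult_eq)
    then show False using minimal_rat_poly_degree_pos[OF h] by simp
  qed
  ultimately have "f dvd h" by (intro f(3)) auto
  then show ?thesis using h f(1) assms(2) dvd_trans[of f h] unfolding minimal_rat_poly_def by blast
qed

lemma pderiv_map_poly_of_rat: "pderiv (map_poly of_rat f :: complex poly) = map_poly of_rat (pderiv f)"
  by (rule poly_eqI)
    (simp add: coeff_pderiv coeff_map_poly of_rat_mult del: of_nat_Suc)

text \<open>In characteristic zero the derivative is nonzero and of smaller degree, so
  \<open>f\<close> cannot divide it.\<close>

lemma minimal_rat_poly_simple_root:
  assumes "minimal_rat_poly z f"
  shows "poly (pderiv (map_poly of_rat f)) z \<noteq> 0"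
proof
  assume "poly (pderiv (map_poly of_rat f)) z = 0"
  then have "rat_eval (pderiv f) z = 0" by (simp add: rat_eval_def pderiv_map_poly_of_rat)
  then have "f dvd pderiv f" using assms by (auto simp: minimal_rat_poly_def)
  moreover have "pderiv f \<noteq> 0"
    using minimal_rat_poly_degree_pos[OF assms] by (simp add: pderiv_eq_0_iff)
  ultimately have "degree f \<le> degree (pderiv f)" by (rule dvd_imp_degree_le)
  then show False using minimal_rat_poly_degree_pos[OF assms] by (simp add: degree_pderiv)
qed

text \<open>\<open>f\<close> is minimal for each of its roots, so all of them are simple, and over
  the complex numbers it splits.\<close>

lemma card_conjugates:
  assumes "minimal_rat_poly z f"
  shows "finite {w. rat_eval f w = 0}" "card {w. rat_eval f w = 0} = degree f"
proof -
  let ?p = "map_poly of_rat f :: complex poly"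
  have f: "f \<noteq> 0" using assms by (auto simp: minimal_rat_poly_def)
  show fin: "finite {w. rat_eval f w = 0}"
    using f poly_roots_finite[of ?p] by (simp add: rat_eval_def)
  have "rsquarefree ?p"
    unfolding rsquarefree_roots
    using minimal_rat_poly_simple_root[OF minimal_rat_poly_conjugate[OF assms]]
    by (auto simp: rat_eval_def)
  then have "smult (lead_coeff ?p) (\<Prod>w|poly ?p w = 0. [:-w, 1:]) = ?p"
    by (rule complex_poly_decompose_rsquarefree)
  then have "degree ?p = degree (smult (lead_coeff ?p) (\<Prod>w|poly ?p w = 0. [:-w, 1:]))" by simp
  also have "\<dots> = card {w. poly ?p w = 0}"
    using f by (simp add: degree_prod_eq_sum_degree coeff_map_poly)
  finally show "card {w. rat_eval f w = 0} = degree f" by (simp add: rat_eval_def)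
qed

section \<open>Simple extensions of \<rat>\<close>

definition adjoin :: "complex \<Rightarrow> complex set" where
  "adjoin z = range (\<lambda>g. rat_eval g z)"

lemma adjoinI: "rat_eval g z \<in> adjoin z"
  by (auto simp: adjoin_def)

lemma self_in_adjoin: "z \<in> adjoin z"
  using adjoinI[of "[:0, 1:]" z] by simp

text \<open>Polynomial values already contain their inverses: if \<open>g\<close> does not vanish at
  \<open>z\<close>, neither does \<open>gcd f g\<close>, so the cofactor of the gcd in
  \<open>f\<close> vanishes there and is a multiple of \<open>f\<close>. Hence the gcd is constant,
  and Bezout's identity gives an inverse.\<close>

lemma is_subfield_adjoin:
  assumes "minimal_rat_poly z f"
  shows "is_subfield (adjoin z)"
proof -
  have f: "f \<noteq> 0" "rat_eval f z = 0" "\<And>g. rat_eval g z = 0 \<Longrightarrow> f dvd g"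
    using assms by (auto simp: minimal_rat_poly_def)
  have "inverse (rat_eval g z) \<in> adjoin z" for g
  proof (cases "rat_eval g z = 0")
    case True
    then show ?thesis using adjoinI[of 0 z] by simp
  next
    case False
    define d where "d = gcd f g"
    obtain e where e: "f = d * e" unfolding d_def by (metis dvdE gcd_dvd1)
    obtain e' where e': "g = d * e'" unfolding d_def by (metis dvdE gcd_dvd2)
    have "rat_eval d z \<noteq> 0" using False e' by auto
    then have "rat_eval e z = 0" using e f(2) by simp
    then have "f dvd e" by (rule f)
    then have "degree f \<le> degree e" using e f(1) by (intro dvd_imp_degree_le) auto
    then have "degree d = 0" using e f(1) by (auto simp: degree_mult_eq)
    then obtain c where c: "d = [:c:]" by (auto elim: degree_eq_zeroE)
    then have "c \<noteq> 0" using e f(1) by auto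
    obtain u v where "u * f + v * g = d"
      unfolding d_def by (metis bezout_coefficients_fst_snd)
    then have "rat_eval (u * f + v * g) z = of_rat c" using c by simp
    then have "rat_eval v z * rat_eval g z = of_rat c" using f(2) by simp
    then have "inverse (rat_eval g z) = rat_eval ([:inverse c:] * v) z"
      using False \<open>c \<noteq> 0\<close> by (simp add: of_rat_divide field_simps)
    then show ?thesis by (metis adjoinI)
  qed
  moreover have "rat_eval g z - rat_eval h z \<in> adjoin z" for g h using adjoinI[of "g - h" z] by simp
  moreover have "rat_eval g z * rat_eval h z \<in> adjoin z" for g h using adjoinI[of "g * h" z] by simp
  ultimately show ?thesis
    using adjoinI[of 0 z] adjoinI[of 1 z] unfolding is_subfield_def by (auto simp: adjoin_def)
qed

lemma adjoin_subset:
  assumes "is_subfield L" "z \<in> L"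
  shows "adjoin z \<subseteq> L"
  unfolding adjoin_def rat_eval_altdef
  by (auto intro!: subfield_sum subfield_closed subfield_of_rat assms)

section \<open>Polynomials over a subfield and the primitive element theorem\<close>

lemma poly_over_pCons [simp]:
  "poly_over K (pCons a p) \<longleftrightarrow> a \<in> K \<and> poly_over K p"
  by (auto simp: poly_over_def coeff_pCons split: nat.splits)

lemma poly_over_closed:
  assumes "is_subfield L"
  shows "poly_over L 0" "poly_over L p \<Longrightarrow> poly_over L q \<Longrightarrow> poly_over L (p + q)"
    "poly_over L p \<Longrightarrow> poly_over L q \<Longrightarrow> poly_over L (p - q)"
    "poly_over L p \<Longrightarrow> poly_over L q \<Longrightarrow> poly_over L (p * q)"
    "a \<in> L \<Longrightarrow> poly_over L p \<Longrightarrow> poly_over L (smult a p)"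
  by (auto simp: poly_over_def coeff_mult intro!: subfield_closed[OF assms] subfield_sum[OF assms])

lemma poly_over_pcompose:
  assumes "is_subfield L" "poly_over L p" "poly_over L q"
  shows "poly_over L (pcompose p q)"
  using assms(2)
  by (induction p) (auto simp: pcompose_pCons intro!: poly_over_closed[OF assms(1)] assms(3))

lemma poly_over_mod:
  assumes "is_subfield L" "poly_over L p" "poly_over L q" "q \<noteq> 0"
  shows "poly_over L (p mod q)"
  using assms(2)
proof (induction p)
  case (pCons a p)
  then have "poly_over L (pCons a (p mod q))" by auto
  moreover have "coeff (pCons a (p mod q)) (degree q) / lead_coeff q \<in> L"
    using calculation assms(3) by (intro subfield_closed[OF assms(1)]) (auto simp: poly_over_def)
  ultimately show ?case
    unfolding mod_pCons[OF assms(4)]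
    by (intro poly_over_closed(3,5)[OF assms(1)] assms(3))
qed (simp add: poly_over_closed[OF assms(1)])

lemma poly_over_of_rat:
  assumes "is_subfield L" shows "poly_over L (map_poly of_rat f)"
  using subfield_of_rat[OF assms] by (auto simp: poly_over_def coeff_map_poly)

lemma poly_over_eval:
  assumes "is_subfield L" "poly_over L p" "x \<in> L" shows "poly p x \<in> L"
  using assms(2) by (induction p) (auto intro!: subfield_closed[OF assms(1)] assms(3))

lemma rat_eval_sum: "rat_eval (sum g I) z = (\<Sum>i\<in>I. rat_eval (g i) z)"
  by (induction I rule: infinite_finite_induct) auto

lemma rat_eval_monom [simp]: "rat_eval (monom a n) z = of_rat a * z ^ n"
  by (simp add: rat_eval_def map_poly_monom poly_monom)

lemma coeff_sum_monom:
  assumes "finite I"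
  shows "coeff (\<Sum>i\<in>I. monom (x i) i) k = (if k \<in> I then x k else 0)"
  using assms by (simp add: coeff_sum)

text \<open>With \<open>n\<close> spanning elements, the coordinates of the \<open>n + 1\<close>
  powers \<open>a ^ 0\<close> to \<open>a ^ n\<close> satisfy a linear relation. The spanning set
  need not be a basis, so the coordinates are merely chosen.\<close>

lemma number_field_algebraic:
  assumes "number_field K" "a \<in> K"
  shows "\<exists>f. minimal_rat_poly a f"
proof -
  from assms obtain B where B: "finite B" "rat_vs.span B = K" and K: "is_subfield K"
    by (auto simp: number_field_def)
  define n where "n = card B"
  obtain e where e: "bij_betw e {0..<n} B"
    using ex_bij_betw_nat_finite[OF B(1)] n_def by auto
  have "\<exists>u. a ^ i = (\<Sum>b\<in>B. rat_scale (u b) b)" for i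
  proof -
    have "a ^ i \<in> rat_vs.span B" unfolding B(2) by (rule subfield_closed(9)[OF K assms(2)])
    then show ?thesis unfolding rat_vs.span_finite[OF B(1)] by auto
  qed
  then obtain u where u: "\<And>i. a ^ i = (\<Sum>b\<in>B. rat_scale (u i b) b)" by metis
  have "is_subfield (UNIV :: rat set)" by (simp add: is_subfield_def)
  from underdetermined_system[OF this, of "{..n}" n "\<lambda>j i. u i (e j)"]
  obtain x where x: "\<exists>i\<in>{..n}. x i \<noteq> 0" "\<And>j. j < n \<Longrightarrow> (\<Sum>i\<le>n. u i (e j) * x i) = 0"
    by auto
  define g where "g = (\<Sum>i\<le>n. monom (x i) i)"
  have "g \<noteq> 0" using x(1) coeff_sum_monom[of "{..n}" x] by (metis coeff_0 finite_atMost g_def)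
  have "rat_eval g a = (\<Sum>i\<le>n. of_rat (x i) * (\<Sum>b\<in>B. of_rat (u i b) * b))"
    unfolding g_def rat_eval_sum by (simp add: u rat_scale_def)
  also have "\<dots> = (\<Sum>b\<in>B. \<Sum>i\<le>n. of_rat (u i b * x i) * b)"
    unfolding sum_distrib_left by (subst sum.swap) (simp add: of_rat_mult mult_ac)
  also have "\<dots> = (\<Sum>b\<in>B. of_rat (\<Sum>i\<le>n. u i b * x i) * b)"
    by (simp add: of_rat_sum sum_distrib_right)
  also have "\<dots> = (\<Sum>j\<in>{0..<n}. of_rat (\<Sum>i\<le>n. u i (e j) * x i) * e j)"
    by (rule sum.reindex_bij_betw[OF e, symmetric])
  also have "\<dots> = 0" using x(2) by simp
  finally show ?thesis using minimal_rat_poly_exists[OF \<open>g \<noteq> 0\<close>] by auto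
qed

text \<open>The classical choice of \<gamma> as \<theta> plus \<open>c\<close> times \<eta>: for all
  but finitely many \<open>c\<close> the polynomials \<open>f (\<gamma> - c x)\<close> and
  \<open>g\<close> share only the root \<eta>, so \<eta> has degree one over
  \<open>\<rat>(\<gamma>)\<close>.\<close>

lemma primitive_element_pair:
  assumes K: "number_field K" and mem: "\<theta> \<in> K" "\<eta> \<in> K"
  shows "\<exists>\<gamma>\<in>K. \<theta> \<in> adjoin \<gamma> \<and> \<eta> \<in> adjoin \<gamma>"
proof -
  have sK: "is_subfield K" using K by (simp add: number_field_def)
  obtain f where f: "minimal_rat_poly \<theta> f" using number_field_algebraic K mem by blast
  obtain g where g: "minimal_rat_poly \<eta> g" using number_field_algebraic K mem by blast
  \<comment> \<open>The excluded values of \<open>c\<close>. Pairs with \<open>w = \<eta>\<close>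
    divide by zero and contribute the value 0, so \<open>c\<close> is also nonzero.\<close>
  define S where "S = (\<lambda>(u,w). (u - \<theta>) / (\<eta> - w)) ` ({w. rat_eval f w = 0} \<times> {w. rat_eval g w = 0})"
  have "finite S" unfolding S_def using card_conjugates(1)[OF f] card_conjugates(1)[OF g] by auto
  then have "finite ((of_nat :: nat \<Rightarrow> complex) -` S)" by (rule finite_vimageI) simp
  then obtain c :: nat where c: "of_nat c \<notin> S"
    by (metis ex_new_if_finite infinite_UNIV_nat vimageI)
  define \<gamma> where "\<gamma> = \<theta> + of_nat c * \<eta>"
  have "of_nat c \<in> K" using subfield_of_rat[OF sK, of "of_nat c"] by simp
  then have "\<gamma> \<in> K" unfolding \<gamma>_def using mem by (intro subfield_closed[OF sK])
  obtain h0 where "minimal_rat_poly \<gamma> h0" using number_field_algebraic K \<open>\<gamma> \<in> K\<close> by blast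
  then have E: "is_subfield (adjoin \<gamma>)" by (rule is_subfield_adjoin)
  have cE: "of_nat c \<in> adjoin \<gamma>" using subfield_of_rat[OF E, of "of_nat c"] by simp
  define F where "F = pcompose (map_poly of_rat f) [:\<gamma>, - of_nat c:]"
  define G :: "complex poly" where "G = map_poly of_rat g"
  have F: "poly_over (adjoin \<gamma>) F" unfolding F_def
    by (intro poly_over_pcompose[OF E] poly_over_of_rat[OF E])
      (simp add: poly_over_closed[OF E] subfield_closed[OF E] cE self_in_adjoin)
  have G: "poly_over (adjoin \<gamma>) G" unfolding G_def by (rule poly_over_of_rat[OF E])
  have polyF: "poly F z = rat_eval f (\<gamma> - of_nat c * z)" for z
    by (simp add: F_def poly_pcompose rat_eval_def mult.commute)
  have polyG: "poly G z = rat_eval g z" for z by (simp add: G_def rat_eval_def)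
  have roots: "poly F \<eta> = 0" "poly G \<eta> = 0" using f g
    by (auto simp: polyF polyG \<gamma>_def minimal_rat_poly_def)
  have "G \<noteq> 0" using g by (simp add: G_def minimal_rat_poly_def)
  \<comment> \<open>\<open>h\<close> is a minimal polynomial of \<eta> over
    \<open>\<rat>(\<gamma>)\<close>, so it divides both \<open>F\<close> and
    \<open>G\<close>.\<close>
  define h where "h = arg_min degree (\<lambda>p. p \<noteq> 0 \<and> poly_over (adjoin \<gamma>) p \<and> poly p \<eta> = 0)"
  have h: "h \<noteq> 0 \<and> poly_over (adjoin \<gamma>) h \<and> poly h \<eta> = 0"
    unfolding h_def by (rule arg_min_natI[of _ G]) (use \<open>G \<noteq> 0\<close> G roots in auto)
  have min: "degree h \<le> degree p" if "p \<noteq> 0" "poly_over (adjoin \<gamma>) p" "poly p \<eta> = 0" for p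
    unfolding h_def by (rule arg_min_nat_le) (use that in auto)
  have dvd: "h dvd p" if "poly_over (adjoin \<gamma>) p" "poly p \<eta> = 0" for p
  proof -
    have "poly p \<eta> = poly (p div h * h) \<eta> + poly (p mod h) \<eta>"
      by (metis div_mult_mod_eq poly_add)
    then have "poly (p mod h) \<eta> = 0" using h that by simp
    moreover have "poly_over (adjoin \<gamma>) (p mod h)" using poly_over_mod[OF E that(1)] h by blast
    ultimately have "p mod h = 0" using min[of "p mod h"] h degree_mod_less'[of h p] by force
    then show ?thesis by auto
  qed
  have only: "z = \<eta>" if "poly h z = 0" for z
  proof (rule ccontr)
    assume "z \<noteq> \<eta>"
    have z: "rat_eval f (\<gamma> - of_nat c * z) = 0" "rat_eval g z = 0"
      using dvd[OF F roots(1)] dvd[OF G roots(2)] that by (auto simp flip: polyF polyG)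
    \<comment> \<open>A second common root would express \<open>c\<close> as one of the excluded
      quotients.\<close>
    have "of_nat c = (\<gamma> - of_nat c * z - \<theta>) / (\<eta> - z)"
      using \<open>z \<noteq> \<eta>\<close> by (simp add: \<gamma>_def field_simps)
    then have "of_nat c \<in> S" unfolding S_def using z by (intro image_eqI[of _ _ "(\<gamma> - of_nat c * z, z)"]) auto
    then show False using c by simp
  qed
  obtain h' where h': "h = [:-\<eta>, 1:] * h'" using h by (auto simp: poly_eq_0_iff_dvd elim!: dvdE)
  \<comment> \<open>A nonconstant cofactor would again have the root \<eta>, making \<eta> a double
    root of the separable polynomial \<open>G\<close>.\<close>
  have "degree h' = 0"
  proof (rule ccontr)
    assume "degree h' \<noteq> 0"
    then obtain z where z: "poly h' z = 0" by (metis alg_closed_imp_poly_has_root not_gr_zero)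
    then have "z = \<eta>" by (intro only) (simp add: h')
    then obtain h'' where "h' = [:-\<eta>, 1:] * h''" using z by (auto simp: poly_eq_0_iff_dvd elim!: dvdE)
    then obtain k where "G = [:-\<eta>, 1:] * ([:-\<eta>, 1:] * k)"
      using dvd[OF G roots(2)] h' by (metis dvdE mult.assoc)
    then have "poly (pderiv G) \<eta> = 0" by (simp only: pderiv_mult) simp
    then show False using minimal_rat_poly_simple_root[OF g] by (simp add: G_def)
  qed
  then obtain a where a: "h' = [:a:]" by (auto elim: degree_eq_zeroE)
  \<comment> \<open>Now \<open>h\<close> is a constant multiple of \<open>x - \<eta>\<close>, so its
    two coefficients, which lie in \<open>\<rat>(\<gamma>)\<close>, recover \<eta>.\<close>
  have "coeff h 0 \<in> adjoin \<gamma>" "coeff h 1 \<in> adjoin \<gamma>" using h by (auto simp: poly_over_def)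
  moreover have "\<eta> = - coeff h 0 / coeff h 1" using h unfolding h' a by auto
  ultimately have \<eta>: "\<eta> \<in> adjoin \<gamma>" using subfield_closed[OF E] by metis
  have "\<gamma> - of_nat c * \<eta> \<in> adjoin \<gamma>" by (intro subfield_closed[OF E] \<eta> cE self_in_adjoin)
  then have "\<theta> \<in> adjoin \<gamma>" by (simp add: \<gamma>_def)
  then show ?thesis using \<eta> \<open>\<gamma> \<in> K\<close> by blast
qed

lemma primitive_element:
  assumes "number_field K"
  shows "\<exists>\<theta>. adjoin \<theta> = K"
proof -
  from assms obtain B where B: "finite B" "rat_vs.span B = K" and K: "is_subfield K"
    by (auto simp: number_field_def)
  have "B \<subseteq> K" using B rat_vs.span_superset by blast
  with B(1) have "\<exists>\<theta>\<in>K. B \<subseteq> adjoin \<theta>"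
  proof (induction rule: finite_subset_induct')
    case empty
    then show ?case using subfield_closed[OF K] by auto
  next
    case (insert b B)
    then obtain \<theta> where \<theta>: "\<theta> \<in> K" "B \<subseteq> adjoin \<theta>" by auto
    then obtain \<gamma> where \<gamma>: "\<gamma> \<in> K" "\<theta> \<in> adjoin \<gamma>" "b \<in> adjoin \<gamma>"
      using primitive_element_pair[OF assms] insert by blast
    have "is_subfield (adjoin \<gamma>)"
      using number_field_algebraic[OF assms \<gamma>(1)] is_subfield_adjoin by blast
    then have "adjoin \<theta> \<subseteq> adjoin \<gamma>" using \<gamma> by (intro adjoin_subset)
    then show ?case using \<gamma> \<theta> by blast
  qed
  then obtain \<theta> where \<theta>: "\<theta> \<in> K" "B \<subseteq> adjoin \<theta>" by auto
  have E: "is_subfield (adjoin \<theta>)"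
    using number_field_algebraic[OF assms \<theta>(1)] is_subfield_adjoin by blast
  have "K \<subseteq> adjoin \<theta>"
    unfolding B(2)[symmetric] rat_vs.span_finite[OF B(1)] rat_scale_def using \<theta>(2)
    by (auto intro!: subfield_sum[OF E] subfield_closed[OF E] subfield_of_rat[OF E])
  then show ?thesis using adjoin_subset[OF K \<theta>(1)] by blast
qed

lemma minimal_rat_poly_le_degree:
  assumes "minimal_rat_poly z f" "rat_eval g z = 0" "degree g < degree f"
  shows "g = 0"
  using assms dvd_imp_degree_le[of f g] by (force simp: minimal_rat_poly_def)

lemma rat_eval_mod:
  assumes "minimal_rat_poly z f"
  shows "rat_eval (g mod f) z = rat_eval g z"
proof -
  have "rat_eval g z = rat_eval (g div f * f) z + rat_eval (g mod f) z"
    by (metis div_mult_mod_eq rat_eval_simps(4))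
  then show ?thesis using assms by (simp add: minimal_rat_poly_def)
qed

lemma degree_sum_monom_less:
  assumes "J \<subseteq> {..<n}" "0 < n"
  shows "degree (\<Sum>i\<in>J. monom (x i) i) < n"
  using assms finite_subset[OF assms(1)] by (intro degree_lessI) (auto simp: coeff_sum_monom)

lemma adjoin_eq_sums:
  assumes "minimal_rat_poly z f"
  shows "adjoin z = {\<Sum>i<degree f. of_rat (x i) * z ^ i |x. True}"
proof (intro equalityI subsetI)
  fix a assume "a \<in> adjoin z"
  then obtain g where "a = rat_eval g z" by (auto simp: adjoin_def)
  then have "a = rat_eval (g mod f) z" using rat_eval_mod[OF assms] by simp
  also have "\<dots> = (\<Sum>i\<le>degree (g mod f). of_rat (coeff (g mod f) i) * z ^ i)"
    by (rule rat_eval_altdef)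
  also have "\<dots> = (\<Sum>i<degree f. of_rat (coeff (g mod f) i) * z ^ i)"
  proof (rule sum.mono_neutral_left)
    have "degree (g mod f) < degree f"
      using degree_mod_less[of f g] minimal_rat_poly_degree_pos[OF assms] by fastforce
    then show "{..degree (g mod f)} \<subseteq> {..<degree f}" by auto
  qed (auto simp: coeff_eq_0)
  finally show "a \<in> {\<Sum>i<degree f. of_rat (x i) * z ^ i |x. True}" by blast
next
  fix a assume "a \<in> {\<Sum>i<degree f. of_rat (x i) * z ^ i |x. True}"
  then obtain x where "a = rat_eval (\<Sum>i<degree f. monom (x i) i) z"
    by (auto simp: rat_eval_sum)
  then show "a \<in> adjoin z" by (simp add: adjoinI)
qed

text \<open>The powers of \<theta> below the degree form a basis. Independence is a property of
  sets, so the powers must first be seen to be distinct.\<close>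

lemma field_degree_adjoin:
  assumes "minimal_rat_poly \<theta> f"
  shows "field_degree (adjoin \<theta>) = degree f"
proof -
  let ?B = "(\<lambda>i. \<theta> ^ i) ` {..<degree f}"
  have pos: "degree f > 0" by (rule minimal_rat_poly_degree_pos[OF assms])
  have inj: "inj_on (\<lambda>i. \<theta> ^ i) {..<degree f}"
  proof (rule inj_onI)
    fix i j assume ij: "i \<in> {..<degree f}" "j \<in> {..<degree f}" "\<theta> ^ i = \<theta> ^ j"
    have "monom (1::rat) i - monom 1 j = 0"
      by (rule minimal_rat_poly_le_degree[OF assms])
        (use ij degree_diff_le_max[of "monom (1::rat) i" "monom 1 j"] in \<open>auto simp: degree_monom_eq\<close>)
    then show "i = j" by (metis eq_iff_diff_eq_0 degree_monom_eq one_neq_zero)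
  qed
  have "rat_vs.independent ?B"
    unfolding rat_vs.independent_explicit_module
  proof (intro allI impI)
    fix t u v
    assume t: "finite t" "t \<subseteq> ?B" "(\<Sum>v\<in>t. rat_scale (u v) v) = 0" "v \<in> t"
    define J where "J = {i. i < degree f \<and> \<theta> ^ i \<in> t}"
    have tJ: "t = (\<lambda>i. \<theta> ^ i) ` J" using t(2) by (auto simp: J_def)
    have injJ: "inj_on (\<lambda>i. \<theta> ^ i) J" by (rule inj_on_subset[OF inj]) (auto simp: J_def)
    define g where "g = (\<Sum>i\<in>J. monom (u (\<theta> ^ i)) i)"
    have "rat_eval g \<theta> = (\<Sum>v\<in>t. rat_scale (u v) v)"
      unfolding tJ sum.reindex[OF injJ] by (simp add: g_def rat_eval_sum rat_scale_def)
    moreover have "degree g < degree f" unfolding g_def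
      by (rule degree_sum_monom_less) (use pos in \<open>auto simp: J_def\<close>)
    ultimately have "g = 0" using t(3) by (intro minimal_rat_poly_le_degree[OF assms]) auto
    moreover obtain i where "i \<in> J" "v = \<theta> ^ i" using t(4) tJ by auto
    moreover have "finite J" by (simp add: J_def)
    ultimately show "u v = 0" using coeff_sum_monom[of J "\<lambda>i. u (\<theta> ^ i)" i] by (simp add: g_def)
  qed
  moreover have "adjoin \<theta> \<subseteq> rat_vs.span ?B"
    unfolding adjoin_eq_sums[OF assms]
    by (auto intro!: rat_vs.span_sum rat_vs.span_scale intro: rat_vs.span_base simp flip: rat_scale_def)
  moreover have "?B \<subseteq> adjoin \<theta>"
    using subfield_closed[OF is_subfield_adjoin[OF assms]] self_in_adjoin by auto
  moreover have "card ?B = degree f" using card_image[OF inj] by simp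
  ultimately show ?thesis unfolding field_degree_def by (intro rat_vs.dim_unique)
qed

text \<open>
  The elements of \<open>\<rat>(\<theta>)\<close> that have the same image under the embeddings sending \<open>\<theta>\<close> to the
  conjugates \<open>v\<close> and \<open>w\<close>.
\<close>

definition equalizer :: "complex \<Rightarrow> complex \<Rightarrow> complex \<Rightarrow> complex set" where
  "equalizer \<theta> v w = {rat_eval g \<theta> |g. rat_eval g v = rat_eval g w}"

text \<open>The embeddings are well defined because two polynomials with the same value at \<theta>
  differ by a multiple of \<open>f\<close>; this is the local fact \<open>eq\<close>. The subfield
  is proper since \<theta> itself has the distinct images \<open>v\<close> and
  \<open>w\<close>.\<close>

lemma equalizer:
  assumes "minimal_rat_poly \<theta> f" "rat_eval f v = 0" "rat_eval f w = 0" "v \<noteq> w"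
  shows "is_subfield (equalizer \<theta> v w)" "equalizer \<theta> v w \<subset> adjoin \<theta>"
proof -
  have eq: "rat_eval g u = rat_eval h u"
    if "rat_eval g \<theta> = rat_eval h \<theta>" "rat_eval f u = 0" for g h u
  proof -
    have "rat_eval (g - h) \<theta> = 0" using that by simp
    then have "f dvd g - h" using assms(1) unfolding minimal_rat_poly_def by blast
    then obtain k where "g - h = f * k" by blast
    then have "rat_eval (g - h) u = 0" using that by simp
    then show ?thesis by simp
  qed
  have I: "rat_eval g \<theta> \<in> equalizer \<theta> v w" if "rat_eval g v = rat_eval g w" for g
    using that by (auto simp: equalizer_def)
  have "inverse (rat_eval g \<theta>) \<in> equalizer \<theta> v w" if g: "rat_eval g v = rat_eval g w" for g
  proof (cases "rat_eval g \<theta> = 0")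
    case True
    then show ?thesis using I[of 0] by simp
  next
    case False
    have "inverse (rat_eval g \<theta>) \<in> adjoin \<theta>"
      by (intro subfield_closed[OF is_subfield_adjoin[OF assms(1)]] adjoinI)
    then obtain h where h: "inverse (rat_eval g \<theta>) = rat_eval h \<theta>" by (auto simp: adjoin_def)
    then have "rat_eval (h * g) \<theta> = rat_eval 1 \<theta>" using False by (simp flip: h)
    then have *: "rat_eval (h * g) v = rat_eval 1 v" "rat_eval (h * g) w = rat_eval 1 w"
      using eq assms(2,3) by blast+
    then have "rat_eval g v \<noteq> 0" by auto
    then have "rat_eval h v = rat_eval h w" using * g
      by (metis mult_right_cancel rat_eval_simps(2) rat_eval_simps(5))
    then show ?thesis unfolding h by (rule I)
  qed
  moreover have "rat_eval g \<theta> - rat_eval h \<theta> \<in> equalizer \<theta> v w"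
      "rat_eval g \<theta> * rat_eval h \<theta> \<in> equalizer \<theta> v w"
    if "rat_eval g v = rat_eval g w" "rat_eval h v = rat_eval h w" for g h
    using I[of "g - h"] I[of "g * h"] that by simp_all
  ultimately show "is_subfield (equalizer \<theta> v w)"
    using I[of 0] I[of 1] unfolding is_subfield_def by (auto simp: equalizer_def)
  have "\<theta> \<notin> equalizer \<theta> v w"
  proof
    assume "\<theta> \<in> equalizer \<theta> v w"
    then obtain g where "\<theta> = rat_eval g \<theta>" and g2: "rat_eval g v = rat_eval g w"
      unfolding equalizer_def by blast
    then have g: "rat_eval g \<theta> = rat_eval [:0, 1:] \<theta>" by simp
    have "rat_eval g v = v" "rat_eval g w = w"
      using eq[OF g assms(2)] eq[OF g assms(3)] by simp_all
    then show False using g2 assms(4) by simp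
  qed
  moreover have "equalizer \<theta> v w \<subseteq> adjoin \<theta>" by (auto simp: equalizer_def adjoin_def)
  ultimately show "equalizer \<theta> v w \<subset> adjoin \<theta>" using self_in_adjoin by blast
qed

section \<open>Values of lower degree and rational interpolation\<close>

lemma rat_eval_pcompose: "rat_eval (pcompose p g) z = rat_eval p (rat_eval g z)"
  by (induction p) (auto simp: pcompose_pCons)

lemma rat_eval_of_int: "rat_eval (map_poly of_int t) z = poly (map_poly of_int t) z"
  by (simp add: rat_eval_def map_poly_map_poly o_def)

text \<open>If the images of \<open>a\<close> under all embeddings were distinct, they would be
  \<open>degree f\<close> roots of \<open>t\<close>, more than its degree allows.\<close>

lemma low_degree_in_equalizer:
  assumes "minimal_rat_poly \<theta> f" "a \<in> adjoin \<theta>" "t \<noteq> 0" "degree t < degree f"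
    "poly (map_poly of_int t) a = 0"
  shows "\<exists>v w. rat_eval f v = 0 \<and> rat_eval f w = 0 \<and> v \<noteq> w \<and> a \<in> equalizer \<theta> v w"
proof (rule ccontr)
  assume *: "\<not> ?thesis"
  obtain g where g: "a = rat_eval g \<theta>" using assms(2) by (auto simp: adjoin_def)
  let ?t = "map_poly of_int t :: complex poly"
  have "?t \<noteq> 0" "degree ?t = degree t" using assms(3) by (auto simp: map_poly_eq_0_iff degree_map_poly)
  have "rat_eval (pcompose (map_poly of_int t) g) \<theta> = 0"
    using assms(5) g by (simp add: rat_eval_pcompose rat_eval_of_int)
  then obtain k where k: "pcompose (map_poly of_int t) g = f * k"
    using assms(1) by (auto simp: minimal_rat_poly_def elim!: dvdE)
  have "poly ?t (rat_eval g u) = 0" if "rat_eval f u = 0" for u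
  proof -
    have "rat_eval (pcompose (map_poly of_int t) g) u = 0" unfolding k using that by simp
    then show ?thesis by (simp add: rat_eval_pcompose rat_eval_of_int)
  qed
  then have sub: "(\<lambda>u. rat_eval g u) ` {u. rat_eval f u = 0} \<subseteq> {x. poly ?t x = 0}" by auto
  have inj: "inj_on (\<lambda>u. rat_eval g u) {u. rat_eval f u = 0}"
    using * g by (auto simp: inj_on_def equalizer_def)
  have "degree f = card ((\<lambda>u. rat_eval g u) ` {u. rat_eval f u = 0})"
    using card_image[OF inj] card_conjugates(2)[OF assms(1)] by simp
  also have "\<dots> \<le> card {x. poly ?t x = 0}"
    by (rule card_mono[OF poly_roots_finite[OF \<open>?t \<noteq> 0\<close>] sub])
  also have "\<dots> \<le> degree ?t" by (rule card_poly_roots_bound[OF \<open>?t \<noteq> 0\<close>])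
  finally show False using assms(4) \<open>degree ?t = degree t\<close> by simp
qed

text \<open>Cauchy interpolation: a quotient \<open>S / T\<close> of polynomials over
  \<open>L\<close> of degree at most \<open>d\<close> is matched with \<open>P / Q\<close> at
  \<open>2 * d + 1\<close> points. Then \<open>S * Q - P * T\<close> has more roots than its degree
  permits.\<close>

lemma ratfun_over_interpolation:
  fixes L :: "'a::field set"
  assumes L: "is_subfield L" and "infinite X" "X \<subseteq> L" "Q \<noteq> 0"
    and val: "\<And>x. x \<in> X \<Longrightarrow> poly Q x \<noteq> 0 \<and> poly P x / poly Q x \<in> L"
  shows "ratfun_over L P Q"
proof -
  define d where "d = max (degree P) (degree Q)"
  obtain Y where Y: "finite Y" "card Y = 2 * d + 1" "Y \<subseteq> X"
    using infinite_arbitrarily_large[OF assms(2)] by blast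
  obtain e where e: "bij_betw e {0..<2 * d + 1} Y"
    using ex_bij_betw_nat_finite[OF Y(1)] Y(2) by auto
  \<comment> \<open>Row \<open>j\<close> says that \<open>S - (P / Q) * T\<close> vanishes at
    \<open>e j\<close>. The unknowns \<open>(True, i)\<close> are the coefficients of
    \<open>S\<close>, the unknowns \<open>(False, i)\<close> those of \<open>T\<close>; there are
    \<open>2 * d + 2\<close> of them, one more than the equations.\<close>
  define M where "M j s = (if j < 2 * d + 1 then
      (if fst s then 1 else - (poly P (e j) / poly Q (e j))) * e j ^ snd s else 0)" for j and s :: "bool \<times> nat"
  have eX: "e j \<in> X" if "j < 2 * d + 1" for j using e that Y(3) by (auto simp: bij_betw_def)
  let ?I = "UNIV \<times> {..d} :: (bool \<times> nat) set"
  have "M j s \<in> L" for j s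
  proof (cases "j < 2 * d + 1")
    case True
    then have "e j \<in> L" "poly P (e j) / poly Q (e j) \<in> L" using eX assms(3) val by blast+
    then show ?thesis using True subfield_closed(1,2,4,6,9)[OF L] by (simp add: M_def)
  next
    case False
    then show ?thesis using subfield_closed(1)[OF L] by (simp add: M_def)
  qed
  moreover have "2 * d + 1 < card ?I" by (simp add: card_cartesian_product)
  ultimately obtain x where x: "\<And>i. x i \<in> L" "\<exists>i\<in>?I. x i \<noteq> 0"
      "\<And>j. j < 2 * d + 1 \<Longrightarrow> (\<Sum>i\<in>?I. M j i * x i) = 0"
    using underdetermined_system[OF L, of ?I "2 * d + 1" M] by auto
  define S T where "S = (\<Sum>i\<le>d. monom (x (True, i)) i)" and "T = (\<Sum>i\<le>d. monom (x (False, i)) i)"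
  have coeff: "coeff S i = (if i \<le> d then x (True, i) else 0)"
    "coeff T i = (if i \<le> d then x (False, i) else 0)" for i
    by (simp_all add: S_def T_def coeff_sum_monom)
  have over: "poly_over L S" "poly_over L T"
    using x(1) subfield_closed[OF L] by (auto simp: poly_over_def coeff)
  have deg: "degree S \<le> d" "degree T \<le> d" by (auto intro!: degree_le simp: coeff)
  have zero: "poly (S * Q - P * T) y = 0" if "y \<in> Y" for y
  proof -
    have "y \<in> e ` {0..<2 * d + 1}" using e that by (simp add: bij_betw_def)
    then obtain j where j: "j < 2 * d + 1" "y = e j" by auto
    have "(\<Sum>i\<in>?I. M j i * x i) = (\<Sum>b\<in>UNIV. \<Sum>i\<le>d. M j (b, i) * x (b, i))"
      by (simp add: sum.cartesian_product)
    also have "\<dots> = poly S y - poly P y / poly Q y * poly T y"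
      using j by (simp add: UNIV_bool M_def S_def T_def poly_sum poly_monom sum_distrib_left mult_ac sum_negf)
    finally have "poly S y = poly P y / poly Q y * poly T y" using x(3)[OF j(1)] by simp
    then show ?thesis using val[of y] that Y(3) by (auto simp: field_simps)
  qed
  have "S * Q - P * T = 0"
  proof (rule ccontr)
    assume neq: "S * Q - P * T \<noteq> 0"
    have "degree (S * Q) \<le> 2 * d" "degree (P * T) \<le> 2 * d"
      using degree_mult_le[of S Q] degree_mult_le[of P T] deg by (auto simp: d_def)
    then have "degree (S * Q - P * T) \<le> 2 * d" by (rule degree_diff_le)
    moreover have "card Y \<le> card {y. poly (S * Q - P * T) y = 0}"
      by (rule card_mono[OF poly_roots_finite[OF neq]]) (use zero in auto)
    ultimately show False using card_poly_roots_bound[OF neq] Y(2) by linarith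
  qed
  \<comment> \<open>A vanishing \<open>T\<close> would force \<open>S = 0\<close>, against the
    nontriviality of the solution.\<close>
  moreover have "T \<noteq> 0"
  proof
    assume "T = 0"
    then have "S = 0" using calculation assms(4) by auto
    then show False using x(2) coeff \<open>T = 0\<close> by (metis (full_types) SigmaE atMost_iff coeff_0)
  qed
  moreover have "P * T = S * Q" using calculation(1) by simp
  ultimately show ?thesis using over unfolding ratfun_over_def by blast
qed

text \<open>There are only finitely many pairs of conjugates, so infinitely many such rationals
  would put infinitely many values of \<open>P / Q\<close> into one proper subfield, and
  interpolation would define the function over it.\<close>

lemma finite_low_degree_values:
  assumes f: "minimal_rat_poly \<theta> f" and K: "K = adjoin \<theta>"
    and PQ: "poly_over K P" "poly_over K Q" "Q \<noteq> 0"
    and fod: "\<And>L. is_subfield L \<Longrightarrow> L \<subset> K \<Longrightarrow> \<not> ratfun_over L P Q"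
  shows "finite {r :: rat. poly Q (of_rat r) \<noteq> 0 \<and>
    (\<exists>t. t \<noteq> 0 \<and> degree t < degree f \<and> poly (map_poly of_int t) (poly P (of_rat r) / poly Q (of_rat r)) = 0)}"
    (is "finite ?S")
proof (rule ccontr)
  assume inf: "infinite ?S"
  have K': "is_subfield K" unfolding K by (rule is_subfield_adjoin[OF f])
  let ?F = "\<lambda>r. poly P (of_rat r) / poly Q (of_rat r)"
  let ?R = "{w. rat_eval f w = 0} \<times> {w. rat_eval f w = 0} - Id"
  have "finite ?R" using card_conjugates(1)[OF f] by blast
  have "?S \<subseteq> (\<Union>(v,w)\<in>?R. {r. poly Q (of_rat r) \<noteq> 0 \<and> ?F r \<in> equalizer \<theta> v w})"
  proof
    fix r assume r: "r \<in> ?S"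
    then obtain t where t: "t \<noteq> 0" "degree t < degree f" "poly (map_poly of_int t) (?F r) = 0" by auto
    have "?F r \<in> adjoin \<theta>"
      using PQ(1,2) unfolding K[symmetric]
      by (intro subfield_closed[OF K'] poly_over_eval[OF K'] subfield_of_rat[OF K'])
    from low_degree_in_equalizer[OF f this t] r
    show "r \<in> (\<Union>(v,w)\<in>?R. {r. poly Q (of_rat r) \<noteq> 0 \<and> ?F r \<in> equalizer \<theta> v w})" by blast
  qed
  then have "infinite (\<Union>(v,w)\<in>?R. {r. poly Q (of_rat r) \<noteq> 0 \<and> ?F r \<in> equalizer \<theta> v w})"
    using inf finite_subset by blast
  then obtain v w where vw: "(v, w) \<in> ?R"
      "infinite {r. poly Q (of_rat r) \<noteq> 0 \<and> ?F r \<in> equalizer \<theta> v w}" (is "infinite ?T")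
    using \<open>finite ?R\<close> by auto
  have L: "is_subfield (equalizer \<theta> v w)" "equalizer \<theta> v w \<subset> K"
    using equalizer[OF f, of v w] vw(1) K by auto
  have "ratfun_over (equalizer \<theta> v w) P Q"
  proof (rule ratfun_over_interpolation[OF L(1) _ _ PQ(3)])
    show "infinite ((of_rat :: rat \<Rightarrow> complex) ` ?T)"
      using vw(2) by (subst finite_image_iff) (auto simp: inj_on_def)
  qed (auto intro: subfield_of_rat[OF L(1)])
  then show False using fod L by blast
qed

section \<open>Lattices closed under multiplication\<close>

lemma poly_map_of_int_altdef:
  fixes x :: "'a::field_char_0"
  assumes "degree t \<le> n"
  shows "poly (map_poly of_int t) x = (\<Sum>j\<le>n. of_int (coeff t j) * x ^ j)"
  using assms by (simp add: poly_altdef coeff_map_poly degree_map_poly)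
    (intro sum.mono_neutral_left, auto intro: le_degree)

text \<open>The height of a rational as read off its lowest terms. The lattice estimates need bounds
  on numerator and denominator; \<open>naive_height_le_height\<close> makes the passage to
  \<open>height\<close>.\<close>

definition naive_height :: "rat \<Rightarrow> real" where
  "naive_height r = max \<bar>of_int (fst (quotient_of r))\<bar> (of_int (snd (quotient_of r)))"

lemma naive_height_ge_1: "1 \<le> naive_height r"
proof -
  have "1 \<le> snd (quotient_of r)" using quotient_of_denom_pos'[of r] by simp
  then have "(1::real) \<le> of_int (snd (quotient_of r))" by (metis of_int_1_le_iff)
  then show ?thesis by (simp add: naive_height_def)
qed

text \<open>The coordinates stay existential, since an element may have several representations;
  \<open>X\<close> bounds only one of them.\<close>

definition int_box :: "('i \<Rightarrow> complex) \<Rightarrow> 'i set \<Rightarrow> real \<Rightarrow> complex set" where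
  "int_box e I X = {\<Sum>i\<in>I. of_int (c i) * e i |c. \<forall>i\<in>I. \<bar>real_of_int (c i)\<bar> \<le> X}"

text \<open>The generators \<open>e i\<close> need not be linearly independent.\<close>

locale lattice_ring =
  fixes e :: "'i \<Rightarrow> complex" and I :: "'i set"
  assumes finite_I: "finite I"
    and one_mem: "\<exists>X. 1 \<in> int_box e I X"
    and mult_mem: "\<And>i j. i \<in> I \<Longrightarrow> j \<in> I \<Longrightarrow> \<exists>X. e i * e j \<in> int_box e I X"
begin

abbreviation "box \<equiv> int_box e I"

lemma boxE:
  assumes "a \<in> box X"
  obtains c where "a = (\<Sum>i\<in>I. of_int (c i) * e i)" "\<And>i. i \<in> I \<Longrightarrow> \<bar>real_of_int (c i)\<bar> \<le> X"
  using assms by (auto simp: int_box_def)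

lemma boxI:
  assumes "\<And>i. i \<in> I \<Longrightarrow> \<bar>real_of_int (c i)\<bar> \<le> X"
  shows "(\<Sum>i\<in>I. of_int (c i) * e i) \<in> box X"
  using assms by (auto simp: int_box_def)

lemma box_mono: "a \<in> box X \<Longrightarrow> X \<le> Y \<Longrightarrow> a \<in> box Y"
  unfolding int_box_def by (blast intro: order_trans)

lemma I_nonempty: "I \<noteq> {}"
  using one_mem by (auto simp: int_box_def)

lemma box_nonneg: "a \<in> box X \<Longrightarrow> 0 \<le> X"
  using I_nonempty by (auto elim!: boxE dest: order_trans[OF abs_ge_zero])

lemma box_add:
  assumes "a \<in> box X" "b \<in> box Y" shows "a + b \<in> box (X + Y)"
proof -
  obtain c where c: "a = (\<Sum>i\<in>I. of_int (c i) * e i)" "\<And>i. i \<in> I \<Longrightarrow> \<bar>real_of_int (c i)\<bar> \<le> X"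
    using assms(1) by (elim boxE) blast
  obtain d where d: "b = (\<Sum>i\<in>I. of_int (d i) * e i)" "\<And>i. i \<in> I \<Longrightarrow> \<bar>real_of_int (d i)\<bar> \<le> Y"
    using assms(2) by (elim boxE) blast
  have "a + b = (\<Sum>i\<in>I. of_int (c i + d i) * e i)"
    by (simp add: c d sum.distrib ring_distribs)
  also have "\<dots> \<in> box (X + Y)"
    by (rule boxI) (use c(2) d(2) in \<open>force intro: order_trans[OF abs_triangle_ineq]\<close>)
  finally show ?thesis .
qed

lemma box_zero: "0 \<in> box 0"
  using boxI[of "\<lambda>_. 0" 0] by simp

lemma box_sum:
  assumes "\<And>j. j \<in> J \<Longrightarrow> a j \<in> box (X j)"
  shows "sum a J \<in> box (sum X J)"
  using assms by (induction J rule: infinite_finite_induct) (auto intro: box_add box_zero)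

lemma box_of_int:
  assumes "a \<in> box X" "\<bar>real_of_int n\<bar> \<le> N" shows "of_int n * a \<in> box (N * X)"
proof -
  obtain c where c: "a = (\<Sum>i\<in>I. of_int (c i) * e i)" "\<And>i. i \<in> I \<Longrightarrow> \<bar>real_of_int (c i)\<bar> \<le> X"
    using assms(1) by (elim boxE) blast
  have "of_int n * a = (\<Sum>i\<in>I. of_int (n * c i) * e i)"
    by (simp add: c sum_distrib_left mult_ac)
  also have "\<dots> \<in> box (N * X)"
    by (rule boxI) (use c(2) assms(2) in \<open>auto simp: abs_mult intro!: mult_mono\<close>)
  finally show ?thesis .
qed

text \<open>Expanding a product bilinearly reduces it to products of two generators, whose
  coordinate bounds are added up in \<open>S\<close>.\<close>

lemma box_constant:
  "\<exists>\<kappa>\<ge>1. 1 \<in> box \<kappa> \<and> (\<forall>X Y a b. a \<in> box X \<longrightarrow> b \<in> box Y \<longrightarrow> a * b \<in> box (\<kappa> * X * Y))"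
proof -
  obtain W where W: "\<And>i j. i \<in> I \<Longrightarrow> j \<in> I \<Longrightarrow> e i * e j \<in> box (W i j)"
    using mult_mem by metis
  obtain X1 where X1: "1 \<in> box X1" using one_mem by blast
  define S where "S = (\<Sum>i\<in>I. \<Sum>j\<in>I. W i j)"
  define \<kappa> where "\<kappa> = max 1 (max X1 S)"
  have "a * b \<in> box (\<kappa> * X * Y)" if ab: "a \<in> box X" "b \<in> box Y" for a b X Y
  proof -
    obtain c where c: "a = (\<Sum>i\<in>I. of_int (c i) * e i)" "\<And>i. i \<in> I \<Longrightarrow> \<bar>real_of_int (c i)\<bar> \<le> X"
      using ab(1) by (elim boxE) blast
    obtain d where d: "b = (\<Sum>i\<in>I. of_int (d i) * e i)" "\<And>i. i \<in> I \<Longrightarrow> \<bar>real_of_int (d i)\<bar> \<le> Y"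
      using ab(2) by (elim boxE) blast
    have nn: "0 \<le> X" "0 \<le> Y" using box_nonneg ab by blast+
    have "a * b = (\<Sum>i\<in>I. \<Sum>j\<in>I. of_int (c i * d j) * (e i * e j))"
      by (simp add: c(1) d(1) sum_product mult_ac)
    also have "\<dots> \<in> box (\<Sum>i\<in>I. \<Sum>j\<in>I. (X * Y) * W i j)"
      using c(2) d(2) nn by (intro box_sum box_of_int W) (auto simp: abs_mult intro!: mult_mono)
    finally have "a * b \<in> box (X * Y * S)" by (simp add: S_def sum_distrib_left)
    moreover have "X * Y * S \<le> X * Y * \<kappa>"
      using nn by (intro mult_left_mono) (auto simp: \<kappa>_def)
    then have "X * Y * S \<le> \<kappa> * X * Y" by (simp add: mult_ac)
    ultimately show ?thesis by (rule box_mono)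
  qed
  moreover have "1 \<in> box \<kappa>" using X1 by (rule box_mono) (simp add: \<kappa>_def)
  ultimately show ?thesis by (intro exI[of _ \<kappa>]) (auto simp: \<kappa>_def)
qed

definition mult_const :: real where
  "mult_const = (SOME \<kappa>. \<kappa> \<ge> 1 \<and> 1 \<in> box \<kappa> \<and>
     (\<forall>X Y a b. a \<in> box X \<longrightarrow> b \<in> box Y \<longrightarrow> a * b \<in> box (\<kappa> * X * Y)))"

lemma mult_const:
  "1 \<le> mult_const" "1 \<in> box mult_const"
  "a \<in> box X \<Longrightarrow> b \<in> box Y \<Longrightarrow> a * b \<in> box (mult_const * X * Y)"
  using someI_ex[OF box_constant] unfolding mult_const_def by blast+

lemma box_power:
  assumes "a \<in> box X"
  shows "a ^ n \<in> box ((mult_const * X) ^ n * mult_const)"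
proof (induction n)
  case (Suc n)
  have "a * a ^ n \<in> box (mult_const * X * ((mult_const * X) ^ n * mult_const))"
    by (rule mult_const(3)[OF assms Suc])
  then show ?case by (simp add: mult_ac)
qed (simp add: mult_const)

text \<open>A bound for monomials of total degree \<open>n\<close> that does not depend on
  \<open>j\<close>, as needed when denominators in a polynomial in \<open>a / b\<close> are cleared.
  Two of the three extra factors come from the powers, the third from multiplying them.\<close>

lemma box_power_power:
  assumes "a \<in> box X" "b \<in> box X" "j \<le> n"
  shows "a ^ j * b ^ (n - j) \<in> box (mult_const ^ 3 * (mult_const * X) ^ n)"
proof -
  have "a ^ j * b ^ (n - j) \<in> box (mult_const * ((mult_const * X) ^ j * mult_const)
      * ((mult_const * X) ^ (n - j) * mult_const))"
    by (intro mult_const(3) box_power assms)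
  also have "mult_const * ((mult_const * X) ^ j * mult_const) * ((mult_const * X) ^ (n - j) * mult_const)
      = mult_const ^ 3 * ((mult_const * X) ^ j * (mult_const * X) ^ (n - j))"
    by (simp add: power3_eq_cube mult_ac)
  also have "(mult_const * X) ^ j * (mult_const * X) ^ (n - j) = (mult_const * X) ^ n"
    using assms(3) by (simp flip: power_add)
  finally show ?thesis .
qed

section \<open>Absolute values of lattice elements and Siegel's lemma\<close>

lemma norm_box:
  assumes "a \<in> box X" shows "norm a \<le> X * (\<Sum>i\<in>I. norm (e i))"
proof -
  obtain c where c: "a = (\<Sum>i\<in>I. of_int (c i) * e i)" "\<And>i. i \<in> I \<Longrightarrow> \<bar>real_of_int (c i)\<bar> \<le> X"
    using assms by (elim boxE) blast
  have "norm a \<le> (\<Sum>i\<in>I. norm (of_int (c i) * e i))" unfolding c(1) by (rule norm_sum)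
  also have "\<dots> \<le> (\<Sum>i\<in>I. X * norm (e i))"
    using c(2) by (intro sum_mono) (auto simp: norm_mult intro!: mult_right_mono)
  finally show ?thesis by (simp add: sum_distrib_left)
qed

text \<open>Pigeonhole: among the coefficient vectors with entries from 0 to \<open>T\<close>, two
  give the same coordinates, and their difference is the relation.\<close>

lemma siegel:
  fixes v :: "nat \<Rightarrow> complex"
  assumes v: "\<And>j. j \<le> card I \<Longrightarrow> v j \<in> box X" and X: "1 \<le> X"
  shows "\<exists>t. (\<exists>j\<le>card I. t j \<noteq> 0) \<and>
    (\<forall>j\<le>card I. \<bar>real_of_int (t j)\<bar> \<le> (2 * real (card I + 1) * X) ^ card I) \<and>
    (\<Sum>j\<le>card I. of_int (t j) * v j) = 0"
proof -
  define M N where "M = card I" and "N = card I + 1"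
  \<comment> \<open>Coordinates are integers, so the integer part of \<open>X\<close> bounds them as
    well.\<close>
  define Y where "Y = nat \<lfloor>X\<rfloor>"
  have Y: "1 \<le> Y" "real Y \<le> X" using X by (auto simp: Y_def le_nat_iff)
  have "\<exists>c. v j = (\<Sum>i\<in>I. of_int (c i) * e i) \<and> (\<forall>i\<in>I. \<bar>c i\<bar> \<le> int Y)" if j: "j \<in> {..M}" for j
  proof -
    have "v j \<in> box X" using v j by (simp add: M_def)
    then obtain c where c: "v j = (\<Sum>i\<in>I. of_int (c i) * e i)" "\<And>i. i \<in> I \<Longrightarrow> \<bar>real_of_int (c i)\<bar> \<le> X"
      by (elim boxE) blast
    have "\<bar>c i\<bar> \<le> int Y" if "i \<in> I" for i
      using c(2)[OF that] X by (simp add: Y_def le_floor_iff)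
    then show ?thesis using c(1) by blast
  qed
  then obtain c where c: "\<And>j. j \<in> {..M} \<Longrightarrow> v j = (\<Sum>i\<in>I. of_int (c j i) * e i)"
      "\<And>j i. j \<in> {..M} \<Longrightarrow> i \<in> I \<Longrightarrow> \<bar>c j i\<bar> \<le> int Y"
    by metis
  \<comment> \<open>\<open>A\<close> bounds the coordinates of the combinations, which leaves at
    most \<open>(2 * A + 1) ^ M\<close> images. This \<open>T\<close> makes that number smaller than
    \<open>(T + 1) ^ N\<close>, the number of coefficient vectors, because
    \<open>N = M + 1\<close>.\<close>
  define T where "T = (2 * N * Y) ^ M"
  define A where "A = N * T * Y"
  define D where "D = {..M} \<rightarrow>\<^sub>E {0..int T}"
  define R where "R = I \<rightarrow>\<^sub>E {-int A..int A}"
  define \<phi> where "\<phi> t = (\<lambda>i\<in>I. \<Sum>j\<le>M. t j * c j i)" for t :: "nat \<Rightarrow> int"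
  have "card D = (T + 1) ^ N"
    unfolding D_def N_def M_def by (subst card_PiE) (auto simp: nat_add_distrib)
  have cR: "card R = (2 * A + 1) ^ M"
  proof -
    have "card R = nat (int A + int A + 1) ^ M"
      unfolding R_def M_def using finite_I by (subst card_PiE) auto
    also have "nat (int A + int A + 1) = 2 * A + 1" by linarith
    finally show ?thesis .
  qed
  have "2 * A + 1 \<le> 2 * N * Y * (T + 1)"
    using Y(1) by (auto simp: A_def N_def algebra_simps)
  then have "(2 * A + 1) ^ M \<le> (2 * N * Y * (T + 1)) ^ M" by (rule power_mono) simp
  also have "\<dots> = T * (T + 1) ^ M" unfolding T_def by (rule power_mult_distrib)
  also have "\<dots> < (T + 1) ^ N" by (simp add: N_def M_def)
  finally have "card R < card D" using cR \<open>card D = (T + 1) ^ N\<close> by simp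
  moreover have "\<phi> ` D \<subseteq> R"
  proof (intro image_subsetI)
    fix t assume t: "t \<in> D"
    have "\<bar>\<Sum>j\<le>M. t j * c j i\<bar> \<le> int A" if "i \<in> I" for i
    proof -
      have "\<bar>\<Sum>j\<le>M. t j * c j i\<bar> \<le> (\<Sum>j\<le>M. \<bar>t j * c j i\<bar>)" by (rule sum_abs)
      also have "\<dots> \<le> (\<Sum>j\<le>M. int T * int Y)"
        using t c(2) that by (intro sum_mono) (auto simp: abs_mult D_def PiE_iff intro!: mult_mono)
      finally show ?thesis by (simp add: A_def N_def M_def algebra_simps)
    qed
    then show "\<phi> t \<in> R" unfolding R_def \<phi>_def by (force simp: abs_le_iff)
  qed
  moreover have "finite R" unfolding R_def using finite_I by (intro finite_PiE) auto
  ultimately have "\<not> inj_on \<phi> D" using card_inj_on_le[of \<phi> D R] by linarith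
  then obtain t1 t2 where t: "t1 \<in> D" "t2 \<in> D" "\<phi> t1 = \<phi> t2" "t1 \<noteq> t2" by (auto simp: inj_on_def)
  define t where "t j = t1 j - t2 j" for j
  have "\<exists>j\<le>M. t j \<noteq> 0"
  proof (rule ccontr)
    assume "\<not> ?thesis"
    then have "t1 = t2" using t(1,2) unfolding D_def by (intro PiE_ext) (auto simp: t_def)
    then show False using t(4) by simp
  qed
  moreover have "\<bar>real_of_int (t j)\<bar> \<le> (2 * real (card I + 1) * X) ^ card I" if "j \<le> M" for j
  proof -
    have "t1 j \<in> {0..int T}" "t2 j \<in> {0..int T}" using t(1,2) that by (auto simp: D_def)
    then have "\<bar>t j\<bar> \<le> int T" by (auto simp: t_def)
    then have "\<bar>real_of_int (t j)\<bar> \<le> real T" by linarith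
    also have "real T = (2 * real N * real Y) ^ M" by (simp add: T_def)
    also have "\<dots> \<le> (2 * real N * X) ^ M" using Y(2) by (intro power_mono mult_left_mono) auto
    finally show ?thesis by (simp add: N_def M_def)
  qed
  moreover have "(\<Sum>j\<le>M. of_int (t j) * v j) = 0"
  proof -
    have zero: "(\<Sum>j\<le>M. t j * c j i) = 0" if "i \<in> I" for i
      using fun_cong[OF t(3), of i] that by (simp add: \<phi>_def t_def left_diff_distrib sum_subtractf)
    have "(\<Sum>j\<le>M. of_int (t j) * v j) = (\<Sum>j\<le>M. \<Sum>i\<in>I. of_int (t j * c j i) * e i)"
      by (rule sum.cong) (simp_all add: c(1) sum_distrib_left mult_ac)
    also have "\<dots> = (\<Sum>i\<in>I. of_int (\<Sum>j\<le>M. t j * c j i) * e i)"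
      by (subst sum.swap) (simp add: sum_distrib_right)
    also have "\<dots> = 0" using zero by simp
    finally show ?thesis .
  qed
  ultimately show ?thesis unfolding M_def by blast
qed

text \<open>A Liouville inequality without conjugates: Siegel's lemma gives a relation between
  powers of \<open>a\<close> with bounded integer coefficients. Once the lowest power is cancelled,
  the constant term is a nonzero integer, while for \<open>norm a < 1\<close> every other term is at
  most \<open>T * norm a\<close>.\<close>

lemma box_lower_bound:
  "\<exists>c s. 0 < c \<and> (\<forall>X\<ge>1. \<forall>a\<in>box X. a \<noteq> 0 \<longrightarrow> c \<le> norm a * X ^ s)"
proof -
  define M where "M = card I"
  define \<kappa> where "\<kappa> = mult_const"
  have \<kappa>: "1 \<le> \<kappa>" by (simp add: \<kappa>_def mult_const)
  define Z where "Z = (2 * real (M + 1) * \<kappa> ^ (M + 1)) ^ M"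
  \<comment> \<open>The value 1 covers elements of absolute value at least 1, the other value comes
    from the integer relation.\<close>
  define c where "c = min 1 (1 / (real M * Z))"
  have "0 < M" using finite_I I_nonempty by (simp add: M_def card_gt_0_iff)
  have "0 < Z" using \<kappa> by (simp add: Z_def)
  have "c \<le> norm a * X ^ (M * M)" if X: "1 \<le> X" and a: "a \<in> box X" "a \<noteq> 0" for X a
  proof (cases "norm a \<ge> 1")
    case True
    then have "1 * 1 \<le> norm a * X ^ (M * M)" using X by (intro mult_mono) auto
    then show ?thesis by (simp add: c_def)
  next
    case False
    \<comment> \<open>One bound for all powers up to \<open>M\<close>, so that Siegel's lemma
      applies with a common size.\<close>
    define Y where "Y = (\<kappa> * X) ^ M * \<kappa>"
    have kX: "1 \<le> \<kappa> * X" using mult_mono[OF \<kappa> X] \<kappa> by simp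
    have Y: "1 \<le> Y" unfolding Y_def using mult_mono[OF one_le_power[OF kX, of M] \<kappa>] kX by simp
    have "a ^ j \<in> box Y" if "j \<le> card I" for j
    proof (rule box_mono)
      show "a ^ j \<in> box ((\<kappa> * X) ^ j * \<kappa>)" unfolding \<kappa>_def by (rule box_power[OF a(1)])
      show "(\<kappa> * X) ^ j * \<kappa> \<le> Y" unfolding Y_def
        using \<kappa> that kX by (intro mult_right_mono power_increasing) (auto simp: M_def)
    qed
    then obtain t where t: "\<exists>j\<le>M. t j \<noteq> 0"
        "\<And>j. j \<le> M \<Longrightarrow> \<bar>real_of_int (t j)\<bar> \<le> (2 * real (M + 1) * Y) ^ M"
        "(\<Sum>j\<le>M. of_int (t j) * a ^ j) = 0"
      using siegel[of "\<lambda>j. a ^ j" Y] Y unfolding M_def by blast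
    define T where "T = (2 * real (M + 1) * Y) ^ M"
    have T: "T = Z * X ^ (M * M)"
      by (simp add: T_def Z_def Y_def power_mult_distrib power_mult mult_ac)
    \<comment> \<open>The least index with a nonzero coefficient; dividing by \<open>a ^ k\<close>
      leaves \<open>t k\<close> as the constant term.\<close>
    define k where "k = (LEAST j. t j \<noteq> 0)"
    obtain j0 where j0: "j0 \<le> M" "t j0 \<noteq> 0" using t(1) by blast
    have k: "t k \<noteq> 0" "k \<le> M" and least: "\<And>j. j < k \<Longrightarrow> t j = 0"
      unfolding k_def using j0 LeastI[of "\<lambda>j. t j \<noteq> 0" j0] Least_le[of "\<lambda>j. t j \<noteq> 0" j0]
      by (auto dest: not_less_Least)
    have "(\<Sum>j\<le>M. of_int (t j) * a ^ j) = (\<Sum>j\<in>{k..M}. of_int (t j) * a ^ j)"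
      by (rule sum.mono_neutral_right) (use least in auto)
    also have "\<dots> = (\<Sum>j\<in>{k..M}. a ^ k * (of_int (t j) * a ^ (j - k)))"
      by (rule sum.cong) (auto simp: mult_ac simp flip: power_add)
    also have "\<dots> = a ^ k * (\<Sum>j\<in>{k..M}. of_int (t j) * a ^ (j - k))"
      by (simp add: sum_distrib_left)
    finally have "(\<Sum>j\<in>{k..M}. of_int (t j) * a ^ (j - k)) = 0" using t(3) a(2) by simp
    moreover have "(\<Sum>j\<in>{k..M}. of_int (t j) * a ^ (j - k))
        = of_int (t k) + (\<Sum>j\<in>{k<..M}. of_int (t j) * a ^ (j - k))"
      using k(2) by (subst sum.head) auto
    ultimately have "of_int (t k) = - (\<Sum>j\<in>{k<..M}. of_int (t j) * a ^ (j - k))"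
      by (simp add: eq_neg_iff_add_eq_0)
    then have "norm (of_int (t k) :: complex) = norm (\<Sum>j\<in>{k<..M}. of_int (t j) * a ^ (j - k))"
      by simp
    also have "\<dots> \<le> (\<Sum>j\<in>{k<..M}. norm (of_int (t j) * a ^ (j - k)))" by (rule norm_sum)
    also have "\<dots> \<le> (\<Sum>j\<in>{k<..M}. T * norm a)"
    proof (rule sum_mono)
      fix j assume j: "j \<in> {k<..M}"
      have "norm a ^ (j - k) \<le> norm a ^ 1"
        using j False by (intro power_decreasing) auto
      then show "norm (of_int (t j) * a ^ (j - k)) \<le> T * norm a"
        using t(2)[of j] j unfolding norm_mult norm_power T_def by (intro mult_mono) auto
    qed
    also have "\<dots> = real (M - k) * (T * norm a)" by simp
    also have "\<dots> \<le> real M * (T * norm a)"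
      using Y \<open>0 < Z\<close> X by (intro mult_right_mono) (auto simp: T)
    finally have "\<bar>real_of_int (t k)\<bar> \<le> real M * (T * norm a)" by simp
    then have "1 \<le> real M * (T * norm a)" using k(1) by linarith
    then have "1 / (real M * Z) \<le> norm a * X ^ (M * M)"
      using \<open>0 < M\<close> \<open>0 < Z\<close> unfolding T by (simp add: field_simps)
    then show ?thesis by (simp add: c_def)
  qed
  moreover have "0 < c" using \<open>0 < M\<close> \<open>0 < Z\<close> by (simp add: c_def)
  ultimately show ?thesis by blast
qed

section \<open>Polynomials with lattice coefficients at rational points\<close>

definition lattice_poly :: "complex poly \<Rightarrow> bool" where
  "lattice_poly R \<longleftrightarrow> (\<forall>i. \<exists>X. coeff R i \<in> box X)"

lemma lattice_poly_mult:
  assumes "lattice_poly R" "lattice_poly S" shows "lattice_poly (R * S)"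
  unfolding lattice_poly_def
proof
  fix i
  obtain X Y where XY: "\<And>i. coeff R i \<in> box (X i)" "\<And>i. coeff S i \<in> box (Y i)"
    using assms unfolding lattice_poly_def by metis
  have "coeff (R * S) i \<in> box (\<Sum>j\<le>i. mult_const * X j * Y (i - j))"
    unfolding coeff_mult by (intro box_sum mult_const(3) XY)
  then show "\<exists>X. coeff (R * S) i \<in> box X" by blast
qed

lemma lattice_poly_diff:
  assumes "lattice_poly R" "lattice_poly S" shows "lattice_poly (R - S)"
  unfolding lattice_poly_def
proof
  fix i
  obtain X Y where XY: "coeff R i \<in> box X" "coeff S i \<in> box Y"
    using assms unfolding lattice_poly_def by metis
  have "of_int (- 1) * coeff S i \<in> box (1 * Y)" by (rule box_of_int[OF XY(2)]) simp
  then show "\<exists>X. coeff (R - S) i \<in> box X" using box_add[OF XY(1), of "- coeff S i"] by auto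
qed

lemma lattice_poly_smult:
  assumes "a \<in> box X" "lattice_poly R" shows "lattice_poly (smult a R)"
  using assms(2) mult_const(3)[OF assms(1)] unfolding lattice_poly_def coeff_smult by blast

lemma lattice_poly_linear: "lattice_poly [:of_int a, of_int b:]"
proof -
  have int: "\<exists>X. of_int k \<in> box X" for k
    using box_of_int[OF mult_const(2), of k "\<bar>of_int k\<bar>"] by auto
  have "\<exists>X. coeff [:of_int a, of_int b:] i \<in> box X" for i
    using int[of a] int[of b] int[of 0] by (cases "i = 0"; cases "i = 1") (auto simp: coeff_pCons split: nat.splits)
  then show ?thesis by (simp add: lattice_poly_def)
qed

text \<open>The \<open>d\<close>-th power of the denominator clears all fractions, and each
  \<open>p ^ i * q ^ (d - i)\<close> is at most \<open>H ^ d\<close>. Any \<open>d\<close> not below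
  the degree is allowed, so that numerator and denominator of a rational function can share
  it.\<close>

lemma homogenized_value_in_box:
  assumes "lattice_poly R" "degree R \<le> d"
  shows "\<exists>C\<ge>1. \<forall>r. of_int (snd (quotient_of r)) ^ d * poly R (of_rat r) \<in> box (C * naive_height r ^ d)"
proof -
  obtain X where X: "\<And>i. coeff R i \<in> box (X i)" using assms(1) unfolding lattice_poly_def by metis
  define C where "C = max 1 (\<Sum>i\<le>d. X i)"
  have "of_int (snd (quotient_of r)) ^ d * poly R (of_rat r) \<in> box (C * naive_height r ^ d)" for r
  proof -
    obtain p q where pq: "quotient_of r = (p, q)" by (cases "quotient_of r")
    define H where "H = naive_height r"
    have q: "0 < q" using quotient_of_denom_pos[OF pq] .
    have r: "(of_rat r :: complex) = of_int p / of_int q"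
      using quotient_of_div[OF pq] by (simp add: of_rat_divide)
    have H: "1 \<le> H" "\<bar>real_of_int p\<bar> \<le> H" "\<bar>real_of_int q\<bar> \<le> H"
      using naive_height_ge_1[of r] q by (auto simp: H_def naive_height_def pq)
    have "poly R (of_rat r) = (\<Sum>i\<le>d. coeff R i * of_rat r ^ i)"
      unfolding poly_altdef using assms(2) by (intro sum.mono_neutral_left) (auto simp: coeff_eq_0)
    then have "of_int q ^ d * poly R (of_rat r) = (\<Sum>i\<le>d. of_int q ^ d * (coeff R i * of_rat r ^ i))"
      by (simp add: sum_distrib_left)
    also have "\<dots> = (\<Sum>i\<le>d. of_int (p ^ i * q ^ (d - i)) * coeff R i)"
    proof (rule sum.cong[OF refl])
      fix i assume "i \<in> {..d}"
      then have "(of_int q :: complex) ^ d = of_int q ^ i * of_int q ^ (d - i)" by (simp flip: power_add)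
      then show "of_int q ^ d * (coeff R i * of_rat r ^ i) = of_int (p ^ i * q ^ (d - i)) * coeff R i"
        using q by (simp add: r power_divide)
    qed
    also have "\<dots> \<in> box (\<Sum>i\<le>d. H ^ d * X i)"
    proof (intro box_sum box_of_int X)
      fix i assume i: "i \<in> {..d}"
      have "\<bar>real_of_int (p ^ i * q ^ (d - i))\<bar> = \<bar>real_of_int p\<bar> ^ i * \<bar>real_of_int q\<bar> ^ (d - i)"
        by (simp add: abs_mult power_abs)
      also have "\<dots> \<le> H ^ i * H ^ (d - i)" using H by (intro mult_mono power_mono) auto
      also have "\<dots> = H ^ d" using i by (simp flip: power_add)
      finally show "\<bar>real_of_int (p ^ i * q ^ (d - i))\<bar> \<le> H ^ d" .
    qed
    also have "(\<Sum>i\<le>d. H ^ d * X i) = H ^ d * (\<Sum>i\<le>d. X i)" by (simp add: sum_distrib_left)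
    finally show ?thesis unfolding pq H_def[symmetric] snd_conv
      by (rule box_mono) (use H in \<open>auto simp: C_def mult.commute intro!: mult_right_mono\<close>)
  qed
  then show ?thesis by (intro exI[of _ C]) (auto simp: C_def)
qed

text \<open>The lower bound for lattice elements, applied to the value with fractions cleared; the
  clearing factor costs at most another \<open>H ^ d\<close>. It will show that no such nonzero
  polynomial vanishes at \<xi>.\<close>

lemma poly_value_lower_bound:
  assumes "lattice_poly R"
  shows "\<exists>c s. 0 < c \<and> (\<forall>r. poly R (of_rat r) \<noteq> 0 \<longrightarrow> c \<le> norm (poly R (of_rat r)) * naive_height r ^ s)"
proof -
  define d where "d = degree R"
  obtain C where C: "1 \<le> C"
      "\<And>r. of_int (snd (quotient_of r)) ^ d * poly R (of_rat r) \<in> box (C * naive_height r ^ d)"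
    using homogenized_value_in_box[OF assms, of d] d_def by auto
  obtain c s where cs: "0 < c" "\<And>X a. 1 \<le> X \<Longrightarrow> a \<in> box X \<Longrightarrow> a \<noteq> 0 \<Longrightarrow> c \<le> norm a * X ^ s"
    using box_lower_bound by blast
  have "c / C ^ s \<le> norm (poly R (of_rat r)) * naive_height r ^ (d + d * s)"
    if nz: "poly R (of_rat r) \<noteq> 0" for r
  proof -
    define H where "H = naive_height r"
    define q where "q = snd (quotient_of r)"
    have H: "1 \<le> H" "0 < q" "real_of_int q \<le> H"
      using naive_height_ge_1[of r] quotient_of_denom_pos'[of r] by (auto simp: H_def q_def naive_height_def)
    have "1 \<le> C * H ^ d" using mult_mono[OF C(1) one_le_power[OF H(1), of d]] C(1) by simp
    then have "c \<le> norm (of_int q ^ d * poly R (of_rat r)) * (C * H ^ d) ^ s"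
      using C(2)[of r] nz H(2) unfolding q_def H_def by (intro cs(2)) auto
    also have "\<dots> = real_of_int q ^ d * (norm (poly R (of_rat r)) * (C * H ^ d) ^ s)"
      using H(2) by (simp add: norm_mult norm_power)
    also have "\<dots> \<le> H ^ d * (norm (poly R (of_rat r)) * (C * H ^ d) ^ s)"
      using H C(1) by (intro mult_right_mono power_mono) auto
    finally show ?thesis
      using C(1) unfolding H_def[symmetric]
      by (simp add: field_simps power_mult_distrib power_add flip: power_mult)
  qed
  moreover have "0 < c / C ^ s" using cs(1) C(1) by simp
  ultimately show ?thesis by blast
qed

lemma homogenized_pair:
  assumes "lattice_poly P" "lattice_poly Q"
  shows "\<exists>d C. 1 \<le> C \<and> (\<forall>r. poly Q (of_rat r) \<noteq> 0 \<longrightarrow> (\<exists>a b. b \<noteq> 0 \<and> poly P (of_rat r) / poly Q (of_rat r) = a / b \<and>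
    a \<in> box (C * naive_height r ^ d) \<and> b \<in> box (C * naive_height r ^ d)))"
proof -
  define d where "d = max (degree P) (degree Q)"
  obtain C1 where C1: "1 \<le> C1"
      "\<And>r. of_int (snd (quotient_of r)) ^ d * poly P (of_rat r) \<in> box (C1 * naive_height r ^ d)"
    using homogenized_value_in_box[OF assms(1), of d] d_def by auto
  obtain C2 where C2: "1 \<le> C2"
      "\<And>r. of_int (snd (quotient_of r)) ^ d * poly Q (of_rat r) \<in> box (C2 * naive_height r ^ d)"
    using homogenized_value_in_box[OF assms(2), of d] d_def by auto
  define C where "C = max C1 C2"
  have le: "C1 * naive_height r ^ d \<le> C * naive_height r ^ d" "C2 * naive_height r ^ d \<le> C * naive_height r ^ d" for r
    using naive_height_ge_1[of r] by (auto simp: C_def intro!: mult_right_mono)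
  have "\<exists>a b. b \<noteq> 0 \<and> poly P (of_rat r) / poly Q (of_rat r) = a / b \<and>
    a \<in> box (C * naive_height r ^ d) \<and> b \<in> box (C * naive_height r ^ d)" if "poly Q (of_rat r) \<noteq> 0" for r
  proof (intro exI conjI)
    let ?q = "of_int (snd (quotient_of r)) ^ d :: complex"
    have "snd (quotient_of r) \<noteq> 0" using quotient_of_denom_pos'[of r] by simp
    then show "?q * poly Q (of_rat r) \<noteq> 0" "poly P (of_rat r) / poly Q (of_rat r) = ?q * poly P (of_rat r) / (?q * poly Q (of_rat r))"
      using that by simp_all
    show "?q * poly P (of_rat r) \<in> box (C * naive_height r ^ d)" by (rule box_mono[OF C1(2) le(1)])
    show "?q * poly Q (of_rat r) \<in> box (C * naive_height r ^ d)" by (rule box_mono[OF C2(2) le(2)])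
  qed
  moreover have "1 \<le> C" using C1(1) by (simp add: C_def)
  ultimately show ?thesis by blast
qed

lemma sum_homogeneous:
  fixes a b :: complex
  assumes "b \<noteq> 0"
  shows "(\<Sum>j\<le>n. c j * (a ^ j * b ^ (n - j))) = b ^ n * (\<Sum>j\<le>n. c j * (a / b) ^ j)"
  unfolding sum_distrib_left
proof (rule sum.cong[OF refl])
  fix j assume "j \<in> {..n}"
  then have "b ^ n = b ^ j * b ^ (n - j)" by (simp flip: power_add)
  then show "c j * (a ^ j * b ^ (n - j)) = b ^ n * (c j * (a / b) ^ j)"
    using assms by (simp add: power_divide)
qed

text \<open>With the value written as \<open>a / b\<close>, Siegel's lemma is applied to the
  products \<open>a ^ j * b ^ (M - j)\<close>; dividing by \<open>b ^ M\<close> turns the relation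
  into an integer polynomial that kills \<open>a / b\<close>. Its degree is at most the number of
  generators.\<close>

lemma annihilating_poly:
  assumes "lattice_poly P" "lattice_poly Q"
  shows "\<exists>C s. 0 < C \<and> (\<forall>r. poly Q (of_rat r) \<noteq> 0 \<longrightarrow> (\<exists>t. t \<noteq> 0 \<and> degree t \<le> card I \<and>
    (\<forall>i. \<bar>real_of_int (coeff t i)\<bar> \<le> C * naive_height r ^ s) \<and>
    poly (map_poly of_int t) (poly P (of_rat r) / poly Q (of_rat r)) = 0))"
proof -
  define M where "M = card I"
  obtain d C where C: "1 \<le> C" and ab: "\<And>r. poly Q (of_rat r) \<noteq> 0 \<Longrightarrow> \<exists>a b. b \<noteq> 0 \<and>
      poly P (of_rat r) / poly Q (of_rat r) = a / b \<and>
      a \<in> box (C * naive_height r ^ d) \<and> b \<in> box (C * naive_height r ^ d)"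
    using homogenized_pair[OF assms] by blast
  \<comment> \<open>The constant left in Siegel's bound after the powers of \<open>H\<close> are
    split off.\<close>
  define D where "D = (2 * real (M + 1) * (mult_const ^ 3 * (mult_const * C) ^ M)) ^ M"
  have \<kappa>C: "1 \<le> mult_const * C" using mult_mono[OF mult_const(1) C] mult_const(1) by simp
  have "\<exists>t. t \<noteq> 0 \<and> degree t \<le> M \<and>
    (\<forall>i. \<bar>real_of_int (coeff t i)\<bar> \<le> D * naive_height r ^ (d * M * M)) \<and>
    poly (map_poly of_int t) (poly P (of_rat r) / poly Q (of_rat r)) = 0"
    if nz: "poly Q (of_rat r) \<noteq> 0" for r
  proof -
    define H where "H = naive_height r"
    define F where "F = poly P (of_rat r) / poly Q (of_rat r)"
    obtain a b where b: "b \<noteq> 0" "F = a / b" and box: "a \<in> box (C * H ^ d)" "b \<in> box (C * H ^ d)"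
      using ab[OF nz] by (auto simp: H_def F_def)
    have H: "1 \<le> H" using naive_height_ge_1 by (simp add: H_def)
    define Y where "Y = mult_const ^ 3 * (mult_const * (C * H ^ d)) ^ M"
    have Y': "Y = mult_const ^ 3 * (mult_const * C) ^ M * H ^ (d * M)"
      by (simp add: Y_def power_mult_distrib mult_ac flip: power_mult)
    have "1 * 1 * 1 \<le> Y" unfolding Y'
      using H \<kappa>C mult_const(1) by (intro mult_mono one_le_power) auto
    then obtain t where t: "\<exists>j\<le>M. t j \<noteq> 0"
        "\<And>j. j \<le> M \<Longrightarrow> \<bar>real_of_int (t j)\<bar> \<le> (2 * real (M + 1) * Y) ^ M"
        "(\<Sum>j\<le>M. of_int (t j) * (a ^ j * b ^ (M - j))) = 0"
      using siegel[of "\<lambda>j. a ^ j * b ^ (M - j)" Y] box_power_power[OF box, of _ M]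
      unfolding M_def[symmetric] Y_def[symmetric] by auto
    define T where "T = (\<Sum>j\<le>M. monom (t j) j)"
    have coeff: "coeff T j = (if j \<le> M then t j else 0)" for j by (simp add: T_def coeff_sum_monom)
    have DY: "(2 * real (M + 1) * Y) ^ M = D * H ^ (d * M * M)"
      unfolding D_def Y' by (simp add: power_mult_distrib mult_ac flip: power_mult)
    have "T \<noteq> 0" using t(1) coeff by (metis coeff_0)
    moreover have deg: "degree T \<le> M" by (intro degree_le) (auto simp: coeff)
    moreover have "\<bar>real_of_int (coeff T i)\<bar> \<le> D * H ^ (d * M * M)" for i
      using t(2)[of i] H C mult_const(1) unfolding DY by (auto simp: coeff D_def)
    moreover have "poly (map_poly of_int T) F = (\<Sum>j\<le>M. of_int (t j) * F ^ j)"
      unfolding poly_map_of_int_altdef[OF deg] by (rule sum.cong) (auto simp: coeff)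
    moreover have "\<dots> = 0" using sum_homogeneous[OF b(1), of "\<lambda>j. of_int (t j)" a M] t(3) b by simp
    ultimately show ?thesis unfolding H_def F_def by auto
  qed
  moreover have "0 < D" using C mult_const(1) by (simp add: D_def)
  ultimately show ?thesis unfolding M_def by blast
qed

text \<open>The bound is uniform in \<open>t\<close>, which later runs through minimal polynomials.
  With the value written as \<open>a / b\<close>, the number \<open>b ^ n * t (a / b)\<close> is a
  lattice element of size polynomial in \<open>h\<close> and \<open>H\<close>, and
  \<open>norm b\<close> is at most a constant times \<open>H ^ d\<close>.\<close>

lemma int_poly_value_lower_bound:
  assumes "lattice_poly P" "lattice_poly Q"
  shows "\<exists>c s. 0 < c \<and> (\<forall>r t h. poly Q (of_rat r) \<noteq> 0 \<longrightarrow> degree t \<le> n \<longrightarrow> 1 \<le> h \<longrightarrow>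
    (\<forall>i. \<bar>real_of_int (coeff t i)\<bar> \<le> h) \<longrightarrow>
    poly (map_poly of_int t) (poly P (of_rat r) / poly Q (of_rat r)) \<noteq> 0 \<longrightarrow>
    c \<le> norm (poly (map_poly of_int t) (poly P (of_rat r) / poly Q (of_rat r))) * (h * naive_height r) ^ s)"
proof -
  obtain d C where C: "1 \<le> C" and ab: "\<And>r. poly Q (of_rat r) \<noteq> 0 \<Longrightarrow> \<exists>a b. b \<noteq> 0 \<and>
      poly P (of_rat r) / poly Q (of_rat r) = a / b \<and>
      a \<in> box (C * naive_height r ^ d) \<and> b \<in> box (C * naive_height r ^ d)"
    using homogenized_pair[OF assms] by blast
  obtain c0 s where c0: "0 < c0" "\<And>X a. 1 \<le> X \<Longrightarrow> a \<in> box X \<Longrightarrow> a \<noteq> 0 \<Longrightarrow> c0 \<le> norm a * X ^ s"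
    using box_lower_bound by blast
  have \<kappa>C: "1 \<le> mult_const * C" using mult_mono[OF mult_const(1) C] mult_const(1) by simp
  define E where "E = (\<Sum>i\<in>I. norm (e i)) + 1"
  \<comment> \<open>\<open>D1\<close> accounts for the factor \<open>norm b ^ n\<close>,
    \<open>D2\<close> for the coordinates of the cleared value \<gamma>.\<close>
  define D1 where "D1 = (E * C) ^ n"
  define D2 where "D2 = real (n + 1) * (mult_const ^ 3 * (mult_const * C) ^ n)"
  have "0 < E" by (simp add: E_def add_nonneg_pos sum_nonneg)
  have "c0 / (D1 * D2 ^ s) \<le> norm (poly (map_poly of_int t) (poly P (of_rat r) / poly Q (of_rat r)))
      * (h * naive_height r) ^ (s + d * n + d * n * s)"
    if as: "poly Q (of_rat r) \<noteq> 0" "degree t \<le> n" "1 \<le> h" "\<And>i. \<bar>real_of_int (coeff t i)\<bar> \<le> h"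
      "poly (map_poly of_int t) (poly P (of_rat r) / poly Q (of_rat r)) \<noteq> 0" for r h t
  proof -
    define H where "H = naive_height r"
    define F where "F = poly P (of_rat r) / poly Q (of_rat r)"
    define V where "V = poly (map_poly of_int t) F"
    obtain a b where b: "b \<noteq> 0" "F = a / b" and box: "a \<in> box (C * H ^ d)" "b \<in> box (C * H ^ d)"
      using ab[OF as(1)] by (auto simp: H_def F_def)
    have H: "1 \<le> H" using naive_height_ge_1 by (simp add: H_def)
    define \<gamma> where "\<gamma> = (\<Sum>j\<le>n. of_int (coeff t j) * (a ^ j * b ^ (n - j)))"
    have "V = (\<Sum>j\<le>n. of_int (coeff t j) * F ^ j)"
      unfolding V_def by (rule poly_map_of_int_altdef[OF as(2)])
    then have \<gamma>: "\<gamma> = b ^ n * V"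
      using sum_homogeneous[OF b(1), of "\<lambda>j. of_int (coeff t j)" a n] b by (simp add: \<gamma>_def)
    have "\<gamma> \<noteq> 0" using as(5) b by (simp add: \<gamma> V_def F_def)
    define Z where "Z = D2 * h * H ^ (d * n)"
    have "\<gamma> \<in> box (\<Sum>j\<le>n. h * (mult_const ^ 3 * (mult_const * (C * H ^ d)) ^ n))"
      unfolding \<gamma>_def by (intro box_sum box_of_int box_power_power box as) auto
    also have "(\<Sum>j\<le>n. h * (mult_const ^ 3 * (mult_const * (C * H ^ d)) ^ n)) = Z"
      by (simp add: Z_def D2_def power_mult_distrib power_mult mult_ac)
    finally have \<gamma>box: "\<gamma> \<in> box Z" .
    have "1 * (1 * 1) \<le> D2" unfolding D2_def
      using \<kappa>C mult_const(1) by (intro mult_mono one_le_power) auto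
    then have D2: "1 \<le> D2" by simp
    have "1 * 1 * 1 \<le> Z" unfolding Z_def
      using H D2 as(3) by (intro mult_mono one_le_power) auto
    then have "c0 \<le> norm \<gamma> * Z ^ s" using c0(2)[OF _ \<gamma>box \<open>\<gamma> \<noteq> 0\<close>] by simp
    also have "norm \<gamma> = norm b ^ n * norm V" by (simp add: \<gamma> norm_mult norm_power)
    also have "norm b ^ n * norm V * Z ^ s \<le> (E * C * H ^ d) ^ n * norm V * Z ^ s"
    proof (intro mult_right_mono power_mono)
      have "norm b \<le> C * H ^ d * (\<Sum>i\<in>I. norm (e i))" by (rule norm_box[OF box(2)])
      also have "\<dots> \<le> C * H ^ d * E" using C H by (intro mult_left_mono) (auto simp: E_def)
      finally show "norm b \<le> E * C * H ^ d" by (simp add: mult_ac)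
    qed (use \<open>1 * 1 * 1 \<le> Z\<close> in auto)
    also have "\<dots> = D1 * D2 ^ s * (norm V * (h ^ s * H ^ (d * n + d * n * s)))"
      by (simp add: D1_def Z_def power_mult_distrib power_add mult_ac flip: power_mult)
    \<comment> \<open>Both \<open>h\<close> and \<open>H\<close> are enlarged to
      \<open>h * H\<close>, so that a single exponent serves for both.\<close>
    also have "\<dots> \<le> D1 * D2 ^ s * (norm V * ((h * H) ^ s * (h * H) ^ (d * n + d * n * s)))"
    proof (intro mult_left_mono mult_mono power_mono)
      show "h \<le> h * H" using mult_left_mono[OF H, of h] as(3) by simp
      show "H \<le> h * H" using mult_right_mono[OF as(3), of H] H by simp
    qed (use H as(3) D2 \<open>0 < E\<close> C in \<open>auto simp: D1_def\<close>)
    also have "\<dots> = D1 * D2 ^ s * (norm V * (h * H) ^ (s + d * n + d * n * s))"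
      by (simp add: power_add mult_ac)
    finally show ?thesis unfolding V_def F_def H_def
      using \<open>0 < E\<close> C D2 by (simp add: D1_def field_simps)
  qed
  moreover have "0 < c0 / (D1 * D2 ^ s)" using c0(1) \<open>0 < E\<close> C mult_const(1) by (simp add: D1_def D2_def)
  ultimately show ?thesis by blast
qed

end

section \<open>Minimal polynomials and heights\<close>

lemma map_poly_of_int_smult:
  "map_poly of_int (smult c p) = smult (of_int c :: 'a::field_char_0) (map_poly of_int p)"
  by (rule poly_eqI) (simp add: coeff_map_poly)

lemma map_poly_of_int_diff:
  "map_poly of_int (p - q) = map_poly of_int p - (map_poly of_int q :: 'a::field_char_0 poly)"
  by (rule poly_eqI) (simp add: coeff_map_poly)

lemma poly_map_of_int_of_real:
  "poly (map_poly of_int t) (of_real x :: complex) = of_real (poly (map_poly of_int t) x)"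
  by (induction t) (auto simp: map_poly_pCons)

text \<open>Cross-multiplying by the leading coefficients cancels the top terms, and an annihilator
  of smaller degree than \<open>p\<close> is zero.\<close>

lemma min_int_poly_proportional:
  assumes p: "is_min_int_poly \<alpha> p" and t: "t \<noteq> 0" "poly (map_poly of_int t) \<alpha> = 0" "degree t \<le> degree p"
  shows "smult (lead_coeff p) t = smult (lead_coeff t) p"
proof -
  define d where "d = smult (lead_coeff p) t - smult (lead_coeff t) p"
  have deg: "degree t = degree p" using assms by (force simp: is_min_int_poly_def)
  have "poly (map_poly of_int d) \<alpha> = 0"
    using p t(2) by (simp add: d_def map_poly_of_int_diff map_poly_of_int_smult is_min_int_poly_def)
  then have "d = 0 \<or> degree p \<le> degree d" using p by (auto simp: is_min_int_poly_def)
  moreover have "degree d \<le> degree p" unfolding d_def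
    by (rule degree_diff_le) (use deg degree_smult_le in auto)
  moreover have "coeff d (degree p) = 0" by (simp add: d_def deg)
  ultimately have "d = 0" by (metis le_antisym leading_coeff_0_iff)
  then show ?thesis by (simp add: d_def)
qed

text \<open>Up to sign \<open>t\<close> is \<open>content t\<close> times \<open>p\<close>: compare
  the contents of the two proportional polynomials, where \<open>content p = 1\<close>.\<close>

lemma min_int_poly_content_multiple:
  assumes p: "is_min_int_poly \<alpha> p" and t: "t \<noteq> 0" "poly (map_poly of_int t) \<alpha> = 0" "degree t \<le> degree p"
  shows "\<bar>coeff t i\<bar> = content t * \<bar>coeff p i\<bar>"
proof -
  have eq: "smult (lead_coeff p) t = smult (lead_coeff t) p" by (rule min_int_poly_proportional[OF assms])
  have "content (smult (lead_coeff p) t) = content (smult (lead_coeff t) p)" by (simp only: eq)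
  then have c: "lead_coeff p * content t = \<bar>lead_coeff t\<bar>"
    using p by (simp add: is_min_int_poly_def)
  have "lead_coeff p * coeff t i = lead_coeff t * coeff p i"
    using arg_cong[OF eq, of "\<lambda>q. coeff q i"] by simp
  then have "\<bar>lead_coeff p * coeff t i\<bar> = \<bar>lead_coeff t * coeff p i\<bar>" by simp
  then have "lead_coeff p * \<bar>coeff t i\<bar> = lead_coeff p * (content t * \<bar>coeff p i\<bar>)"
    using p by (simp add: abs_mult is_min_int_poly_def flip: c)
  then show ?thesis using p by (simp add: is_min_int_poly_def)
qed

lemma min_int_poly_unique:
  assumes "is_min_int_poly \<alpha> p" "is_min_int_poly \<alpha> q"
  shows "p = q"
proof -
  have eq: "smult (lead_coeff p) q = smult (lead_coeff q) p"
    by (rule min_int_poly_proportional[OF assms(1)]) (use assms in \<open>auto simp: is_min_int_poly_def\<close>)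
  have "content (smult (lead_coeff p) q) = content (smult (lead_coeff q) p)" by (simp only: eq)
  then have "lead_coeff p = lead_coeff q" using assms by (simp add: is_min_int_poly_def)
  then have "smult (lead_coeff q) (q - p) = 0" using eq by (simp add: smult_diff_right)
  then show ?thesis using assms by (simp add: is_min_int_poly_def)
qed

text \<open>Gives the description behind \<open>THE\<close> its meaning: an annihilator of least
  degree is divided by its content and multiplied by the sign of its leading coefficient.\<close>

lemma is_min_int_poly_min_int_poly:
  fixes \<alpha> :: "'a::field_char_0"
  assumes "t \<noteq> 0" "poly (map_poly of_int t) \<alpha> = 0"
  shows "is_min_int_poly \<alpha> (min_int_poly \<alpha>)"
proof -
  define p where "p = arg_min degree (\<lambda>p. p \<noteq> 0 \<and> poly (map_poly of_int p) \<alpha> = 0)"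
  have p: "p \<noteq> 0 \<and> poly (map_poly of_int p) \<alpha> = 0"
    unfolding p_def by (rule arg_min_natI[of _ t]) (use assms in auto)
  have min: "degree p \<le> degree h" if "h \<noteq> 0" "poly (map_poly of_int h) \<alpha> = 0" for h
    unfolding p_def by (rule arg_min_nat_le) (use that in auto)
  define q where "q = smult (sgn (lead_coeff p)) (primitive_part p)"
  have q1: "smult (content p) (primitive_part p) = p" by (rule content_times_primitive_part)
  have sg: "sgn (lead_coeff p) \<noteq> 0" using p by (simp add: sgn_0_0)
  have c0: "content p > 0" using p normalize_content[of p] by (metis abs_ge_zero content_eq_zero_iff less_le normalize_int_def)
  have "poly (map_poly of_int (smult (content p) (primitive_part p))) \<alpha> = 0" using p q1 by simp
  then have "poly (map_poly of_int (primitive_part p)) \<alpha> = 0"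
    unfolding map_poly_of_int_smult using c0 p by auto
  then have "poly (map_poly of_int q) \<alpha> = 0" by (simp add: q_def map_poly_of_int_smult)
  moreover have "q \<noteq> 0" using sg p by (simp add: q_def)
  moreover have "degree q = degree p" using sg by (simp add: q_def)
  moreover have "content q = 1" using sg p by (simp add: q_def sgn_if)
  moreover have "lead_coeff q > 0"
  proof -
    have "lead_coeff p = content p * lead_coeff (primitive_part p)"
      by (metis q1 lead_coeff_smult)
    then have "sgn (lead_coeff p) = sgn (lead_coeff (primitive_part p))"
      using c0 by (simp add: sgn_mult)
    then have "lead_coeff q = \<bar>lead_coeff (primitive_part p)\<bar>"
      by (simp add: q_def lead_coeff_smult abs_sgn mult.commute)
    then show ?thesis using p by (metis leading_coeff_0_iff primitive_part_eq_0_iff zero_less_abs_iff)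
  qed
  ultimately have "is_min_int_poly \<alpha> q" using min by (simp add: is_min_int_poly_def)
  then show ?thesis unfolding min_int_poly_def
    by (rule theI) (use min_int_poly_unique \<open>is_min_int_poly \<alpha> q\<close> in blast)
qed

section \<open>Bounds for heights and finiteness\<close>

lemma abs_coeff_le_height: "\<bar>coeff (min_int_poly \<alpha>) i\<bar> \<le> height \<alpha>"
proof (cases "i \<le> degree (min_int_poly \<alpha>)")
  case True
  then show ?thesis unfolding height_def by (intro Max_ge) auto
next
  case False
  have "\<bar>coeff (min_int_poly \<alpha>) 0\<bar> \<le> height \<alpha>" unfolding height_def by (intro Max_ge) auto
  then show ?thesis using False by (simp add: coeff_eq_0)
qed

lemma height_leI:
  assumes "\<And>i. \<bar>coeff (min_int_poly \<alpha>) i\<bar> \<le> B"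
  shows "height \<alpha> \<le> B"
  unfolding height_def using assms by (subst Max_le_iff) auto

lemma height_ge_1:
  assumes "is_min_int_poly \<alpha> (min_int_poly \<alpha>)"
  shows "1 \<le> height \<alpha>"
  using abs_coeff_le_height[of \<alpha> "degree (min_int_poly \<alpha>)"] assms by (auto simp: is_min_int_poly_def)

text \<open>The degree hypothesis makes \<open>t\<close>, up to sign, the multiple of the minimal
  polynomial by \<open>content t\<close>. As this is at least 1, the coefficients of the minimal
  polynomial cannot be larger.\<close>

lemma height_le_annihilator:
  assumes t: "t \<noteq> 0" "poly (map_poly of_int t) \<alpha> = 0" "degree t \<le> alg_degree \<alpha>"
    and B: "\<And>i. \<bar>coeff t i\<bar> \<le> B"
  shows "height \<alpha> \<le> B"
proof (rule height_leI)
  fix i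
  have "1 \<le> content t" using t(1) normalize_content[of t]
    by (metis abs_ge_zero content_eq_zero_iff less_le normalize_int_def int_one_le_iff_zero_less)
  then have "1 * \<bar>coeff (min_int_poly \<alpha>) i\<bar> \<le> content t * \<bar>coeff (min_int_poly \<alpha>) i\<bar>"
    by (intro mult_right_mono) auto
  also have "\<dots> = \<bar>coeff t i\<bar>"
    using min_int_poly_content_multiple[OF is_min_int_poly_min_int_poly[OF t(1,2)] t(1,2)] t(3)
    by (simp add: alg_degree_def)
  finally show "\<bar>coeff (min_int_poly \<alpha>) i\<bar> \<le> B" using B[of i] by simp
qed

lemma alg_degree_eqI:
  assumes "t \<noteq> 0" "poly (map_poly of_int t) \<alpha> = 0" "degree t \<le> m"
    and "\<And>t. t \<noteq> 0 \<Longrightarrow> degree t < m \<Longrightarrow> poly (map_poly of_int t) \<alpha> \<noteq> 0"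
  shows "alg_degree \<alpha> = m"
proof -
  have "is_min_int_poly \<alpha> (min_int_poly \<alpha>)" by (rule is_min_int_poly_min_int_poly[OF assms(1,2)])
  then show ?thesis using assms unfolding alg_degree_def is_min_int_poly_def
    by (metis leD linorder_neqE_nat order_trans)
qed

lemma algebraic_iff_int_poly:
  fixes \<alpha> :: "'a::field_char_0"
  shows "algebraic \<alpha> \<longleftrightarrow> (\<exists>t. t \<noteq> 0 \<and> poly (map_poly of_int t) \<alpha> = 0)"
proof
  assume "algebraic \<alpha>"
  then show "\<exists>t. t \<noteq> 0 \<and> poly (map_poly of_int t) \<alpha> = 0"
    by (elim algebraicE') blast
next
  assume "\<exists>t. t \<noteq> 0 \<and> poly (map_poly of_int t) \<alpha> = 0"
  then obtain t where t: "t \<noteq> 0" "poly (map_poly of_int t) \<alpha> = 0" by blast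
  show "algebraic \<alpha>"
    by (rule algebraicI[of "map_poly of_int t"]) (use t in \<open>auto simp: coeff_map_poly map_poly_eq_0_iff\<close>)
qed

text \<open>For \<open>a / b\<close> in lowest terms the polynomial \<open>b x - a\<close> has
  content 1, so its coefficients agree in absolute value with those of the minimal
  polynomial.\<close>

lemma naive_height_le_height: "naive_height r \<le> real_of_int (height r)"
proof -
  obtain a b where ab: "quotient_of r = (a, b)" by (cases "quotient_of r")
  have b: "0 < b" and cop: "coprime a b" using quotient_of_denom_pos[OF ab] quotient_of_coprime[OF ab] .
  have r: "r = of_int a / of_int b" by (rule quotient_of_div[OF ab])
  define t where "t = [:-a, b:]"
  have t: "t \<noteq> 0" "poly (map_poly of_int t) r = 0" "degree t = 1"
    using b by (auto simp: t_def map_poly_pCons r)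
  have M: "is_min_int_poly r (min_int_poly r)" by (rule is_min_int_poly_min_int_poly[OF t(1,2)])
  have "degree (min_int_poly r) \<noteq> 0"
  proof
    assume "degree (min_int_poly r) = 0"
    then obtain c where "min_int_poly r = [:c:]" by (auto elim: degree_eq_zeroE)
    then show False using M by (auto simp: is_min_int_poly_def map_poly_pCons)
  qed
  then have eq: "\<bar>coeff t i\<bar> = content t * \<bar>coeff (min_int_poly r) i\<bar>" for i
    using min_int_poly_content_multiple[OF M t(1,2)] t(3) by simp
  have "content t dvd a" "content t dvd b"
    using content_dvd_coeff[of t 0] content_dvd_coeff[of t 1] by (auto simp: t_def)
  then have "is_unit (content t)" using cop by (rule coprime_common_divisor[rotated])
  then have "content t = 1" by (metis is_unit_normalize normalize_content)
  then have "\<bar>a\<bar> \<le> height r" "\<bar>b\<bar> \<le> height r"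
    using eq[of 0] eq[of 1] abs_coeff_le_height[of r 0] abs_coeff_le_height[of r 1] by (auto simp: t_def)
  then show ?thesis using b by (simp add: naive_height_def ab)
qed

lemma finite_naive_height_le: "finite {r. naive_height r \<le> B}"
proof (rule finite_subset)
  let ?S = "{-\<lceil>B\<rceil>..\<lceil>B\<rceil>}"
  show "{r. naive_height r \<le> B} \<subseteq> (\<lambda>(a, b). of_int a / of_int b) ` (?S \<times> ?S)"
  proof
    fix r assume r: "r \<in> {r. naive_height r \<le> B}"
    obtain a b where ab: "quotient_of r = (a, b)" by (cases "quotient_of r")
    then have "\<bar>real_of_int a\<bar> \<le> B" "real_of_int b \<le> B" "0 < b"
      using r quotient_of_denom_pos[OF ab] by (auto simp: naive_height_def)
    then have "a \<in> ?S" "b \<in> ?S" by (auto; linarith)+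
    then show "r \<in> (\<lambda>(a, b). of_int a / of_int b) ` (?S \<times> ?S)"
      using quotient_of_div[OF ab] by (intro image_eqI[of _ _ "(a, b)"]) auto
  qed
qed auto

text \<open>Northcott's finiteness: there are finitely many integer polynomials of bounded degree
  and coefficients, each with finitely many roots.\<close>

lemma finite_bounded_degree_height:
  "finite {\<beta> :: real. algebraic \<beta> \<and> alg_degree \<beta> = n \<and> real_of_int (height \<beta>) \<le> B}"
proof (rule finite_subset)
  define C where "C = {-\<lceil>B\<rceil>..\<lceil>B\<rceil>}"
  define T where "T = {t :: int poly. t \<noteq> 0 \<and> degree t \<le> n \<and> (\<forall>i. coeff t i \<in> C)}"
  have "finite {xs. set xs \<subseteq> C \<and> length xs \<le> Suc n}"
    by (rule finite_lists_length_le) (simp add: C_def)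
  moreover have "T \<subseteq> Poly ` {xs. set xs \<subseteq> C \<and> length xs \<le> Suc n}"
  proof
    fix t assume t: "t \<in> T"
    then have "set (coeffs t) \<subseteq> C" by (auto simp: T_def coeffs_def)
    moreover have "length (coeffs t) \<le> Suc n" using t by (auto simp: T_def length_coeffs_degree)
    ultimately show "t \<in> Poly ` {xs. set xs \<subseteq> C \<and> length xs \<le> Suc n}"
      by (intro image_eqI[of _ _ "coeffs t"]) auto
  qed
  ultimately have "finite T" using finite_surj by blast
  then show "finite (\<Union>t\<in>T. {\<beta> :: real. poly (map_poly of_int t) \<beta> = 0})"
    by (intro finite_UN_I poly_roots_finite) (auto simp: T_def map_poly_eq_0_iff)
  show "{\<beta> :: real. algebraic \<beta> \<and> alg_degree \<beta> = n \<and> real_of_int (height \<beta>) \<le> B}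
      \<subseteq> (\<Union>t\<in>T. {\<beta> :: real. poly (map_poly of_int t) \<beta> = 0})"
  proof
    fix \<beta> :: real assume \<beta>: "\<beta> \<in> {\<beta> :: real. algebraic \<beta> \<and> alg_degree \<beta> = n \<and> real_of_int (height \<beta>) \<le> B}"
    then obtain t where "t \<noteq> 0" "poly (map_poly of_int t) \<beta> = 0" by (auto simp: algebraic_iff_int_poly)
    then have M: "is_min_int_poly \<beta> (min_int_poly \<beta>)" by (rule is_min_int_poly_min_int_poly)
    have "coeff (min_int_poly \<beta>) i \<in> C" for i
    proof -
      have "\<bar>coeff (min_int_poly \<beta>) i\<bar> \<le> \<lceil>B\<rceil>"
        using abs_coeff_le_height[of \<beta> i] \<beta> by simp linarith
      then show ?thesis by (auto simp: C_def)
    qed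
    then have "min_int_poly \<beta> \<in> T" using M \<beta> by (auto simp: T_def is_min_int_poly_def alg_degree_def)
    then show "\<beta> \<in> (\<Union>t\<in>T. {\<beta> :: real. poly (map_poly of_int t) \<beta> = 0})"
      using M by (auto simp: is_min_int_poly_def)
  qed
qed

section \<open>Powers of an integral generator\<close>

lemma norm_power_diff_le:
  fixes x y :: complex
  assumes "norm x \<le> A" "norm y \<le> A" "1 \<le> A"
  shows "norm (x ^ i - y ^ i) \<le> real i * A ^ i * norm (x - y)"
proof (induction i)
  case (Suc i)
  have "x ^ Suc i - y ^ Suc i = x * (x ^ i - y ^ i) + (x - y) * y ^ i" by (simp add: algebra_simps)
  then have "norm (x ^ Suc i - y ^ Suc i) \<le> norm x * norm (x ^ i - y ^ i) + norm (x - y) * norm y ^ i"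
    by (metis norm_triangle_ineq norm_mult norm_power)
  also have "\<dots> \<le> A * (real i * A ^ i * norm (x - y)) + norm (x - y) * A ^ i"
    using assms Suc by (intro add_mono mult_mono power_mono) auto
  also have "norm (x - y) * A ^ i \<le> A * (A ^ i * norm (x - y))"
    using mult_right_mono[OF assms(3), of "A ^ i * norm (x - y)"] assms(3) by (simp add: mult_ac)
  finally show ?case by (simp add: algebra_simps)
qed simp

text \<open>The constant is explicit and linear in the coefficient bound \<open>h\<close>, because
  the estimate will be applied to minimal polynomials of varying height.\<close>

lemma poly_lipschitz:
  fixes x y :: complex
  assumes "norm x \<le> A" "norm y \<le> A" "1 \<le> A" "degree R \<le> n" "\<And>i. norm (coeff R i) \<le> h"
  shows "norm (poly R x - poly R y) \<le> h * (real (n + 1) * (real n * A ^ n)) * norm (x - y)"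
proof -
  have eq: "poly R z = (\<Sum>i\<le>n. coeff R i * z ^ i)" for z
    unfolding poly_altdef using assms(4) by (intro sum.mono_neutral_left) (auto simp: coeff_eq_0)
  have "0 \<le> h" using order_trans[OF norm_ge_zero assms(5)] .
  have "norm (poly R x - poly R y) = norm (\<Sum>i\<le>n. coeff R i * (x ^ i - y ^ i))"
    by (simp add: eq sum_subtractf right_diff_distrib)
  also have "\<dots> \<le> (\<Sum>i\<le>n. norm (coeff R i * (x ^ i - y ^ i)))" by (rule norm_sum)
  also have "\<dots> \<le> (\<Sum>i\<le>n. h * (real n * A ^ n * norm (x - y)))"
  proof (rule sum_mono)
    fix i assume i: "i \<in> {..n}"
    have "norm (x ^ i - y ^ i) \<le> real i * A ^ i * norm (x - y)"
      by (rule norm_power_diff_le[OF assms(1-3)])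
    also have "\<dots> \<le> real n * A ^ n * norm (x - y)"
      using i assms(3) by (intro mult_right_mono mult_mono power_increasing) auto
    finally show "norm (coeff R i * (x ^ i - y ^ i)) \<le> h * (real n * A ^ n * norm (x - y))"
      unfolding norm_mult using assms(5) \<open>0 \<le> h\<close> by (intro mult_mono) auto
  qed
  finally show ?thesis by (simp add: mult_ac)
qed

lemma poly_lipschitz_fixed:
  fixes R :: "complex poly"
  shows "\<exists>L>0. \<forall>x y. norm x \<le> A \<longrightarrow> norm y \<le> A \<longrightarrow> norm (poly R x - poly R y) \<le> L * norm (x - y)"
proof -
  define n h where "n = degree R" and "h = (\<Sum>i\<le>degree R. norm (coeff R i))"
  \<comment> \<open>The summand 1 keeps \<open>L\<close> positive even for constant
    \<open>R\<close>.\<close>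
  define L where "L = h * (real (n + 1) * (real n * max 1 A ^ n)) + 1"
  have "0 \<le> h" by (simp add: h_def sum_nonneg)
  have h: "norm (coeff R i) \<le> h" for i
  proof (cases "i \<le> degree R")
    case True
    then show ?thesis unfolding h_def by (intro member_le_sum) auto
  next
    case False
    then show ?thesis using \<open>0 \<le> h\<close> by (simp add: coeff_eq_0)
  qed
  have "norm (poly R x - poly R y) \<le> L * norm (x - y)" if "norm x \<le> A" "norm y \<le> A" for x y
  proof -
    have "norm (poly R x - poly R y) \<le> h * (real (n + 1) * (real n * max 1 A ^ n)) * norm (x - y)"
      using that h by (intro poly_lipschitz) (auto simp: n_def)
    then show ?thesis by (simp add: L_def distrib_right add_increasing2)
  qed
  moreover have "0 < L" unfolding L_def using \<open>0 \<le> h\<close> by (intro add_nonneg_pos) auto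
  ultimately show ?thesis by blast
qed

section \<open>Integer combinations of powers of a generator\<close>

lemma common_denominator:
  assumes "finite S"
  shows "\<exists>D>0. \<forall>x\<in>S. \<exists>k. of_int D * (x::rat) = of_int k"
  using assms
proof (induction S rule: finite_induct)
  case empty
  show ?case by (rule exI[of _ 1]) simp
next
  case (insert x S)
  then obtain D where D: "D > 0" "\<forall>x\<in>S. \<exists>k. of_int D * x = of_int k" by blast
  obtain a b where ab: "quotient_of x = (a, b)" by (cases "quotient_of x")
  have b: "0 < b" "x = of_int a / of_int b" using quotient_of_denom_pos[OF ab] quotient_of_div[OF ab] .
  have "\<exists>k. of_int (D * b) * y = of_int k" if y: "y \<in> insert x S" for y
  proof (cases "y = x")
    case True
    then have "of_int (D * b) * y = of_int (D * a)" using b by simp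
    then show ?thesis by blast
  next
    case False
    then obtain k where "of_int D * y = of_int k" using D y by blast
    then have "of_int (D * b) * y = of_int (b * k)" by simp
    then show ?thesis by blast
  qed
  then show ?case using D(1) b(1) by (intro exI[of _ "D * b"]) auto
qed

definition int_combination :: "complex \<Rightarrow> nat \<Rightarrow> complex \<Rightarrow> bool" where
  "int_combination \<theta> n a \<longleftrightarrow> (\<exists>c. a = (\<Sum>i<n. of_int (c i) * \<theta> ^ i))"

lemma int_combinationI: "a = (\<Sum>i<n. of_int (c i) * \<theta> ^ i) \<Longrightarrow> int_combination \<theta> n a"
  by (auto simp: int_combination_def)

lemma int_combination_of_int:
  assumes "int_combination \<theta> n a" shows "int_combination \<theta> n (of_int k * a)"
proof -
  obtain c where "a = (\<Sum>i<n. of_int (c i) * \<theta> ^ i)" using assms by (auto simp: int_combination_def)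
  then have "of_int k * a = (\<Sum>i<n. of_int (k * c i) * \<theta> ^ i)" by (simp add: sum_distrib_left mult_ac)
  then show ?thesis by (rule int_combinationI)
qed

text \<open>The hypothesis \<open>top\<close> says that \<theta> is a root of a monic integer
  polynomial of degree \<open>n\<close>. Multiplying a combination by \<theta> shifts its
  coefficients, and the overflow \<open>\<theta> ^ n\<close> is reduced by this relation.\<close>

lemma int_combination_power:
  assumes top: "int_combination \<theta> n (\<theta> ^ n)" and "0 < n"
  shows "int_combination \<theta> n (\<theta> ^ k)"
proof (induction k)
  case 0
  have "(\<Sum>i<n. of_int (if i = 0 then 1 else 0) * \<theta> ^ i) = (\<Sum>i<n. if i = 0 then 1 else 0)"
    by (intro sum.cong) auto
  then have "\<theta> ^ 0 = (\<Sum>i<n. of_int (if i = 0 then 1 else 0) * \<theta> ^ i)"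
    using assms(2) by simp
  then show ?case by (rule int_combinationI)
next
  case (Suc k)
  obtain d where d: "\<theta> ^ n = (\<Sum>i<n. of_int (d i) * \<theta> ^ i)" using top by (auto simp: int_combination_def)
  obtain c where c: "\<theta> ^ k = (\<Sum>i<n. of_int (c i) * \<theta> ^ i)" using Suc by (auto simp: int_combination_def)
  obtain n' where n': "n = Suc n'" using assms(2) by (cases n) auto
  define b where "b i = (if i = 0 then 0 else c (i - 1)) + c n' * d i" for i
  have "\<theta> ^ Suc k = (\<Sum>i<n. of_int (c i) * \<theta> ^ Suc i)"
    by (simp add: c sum_distrib_left mult_ac)
  also have "\<dots> = (\<Sum>i<n'. of_int (c i) * \<theta> ^ Suc i) + of_int (c n') * \<theta> ^ n"
    by (simp add: n')
  also have "(\<Sum>i<n'. of_int (c i) * \<theta> ^ Suc i) = (\<Sum>i<n. of_int (if i = 0 then 0 else c (i - 1)) * \<theta> ^ i)"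
    unfolding n' by (subst sum.lessThan_Suc_shift) simp
  also have "of_int (c n') * \<theta> ^ n = (\<Sum>i<n. of_int (c n' * d i) * \<theta> ^ i)"
    by (simp add: d sum_distrib_left mult_ac)
  finally have "\<theta> ^ Suc k = (\<Sum>i<n. of_int (b i) * \<theta> ^ i)"
    by (simp only: b_def of_int_add distrib_right sum.distrib)
  then show ?case unfolding int_combination_def by blast
qed

text \<open>If \<open>D\<close> is a common denominator of the coordinates of \<open>z ^ n\<close>,
  then \<open>D * z\<close> is an algebraic integer generating the same field.\<close>

lemma adjoin_integral_generator:
  assumes "minimal_rat_poly z f"
  shows "\<exists>\<theta> g. adjoin \<theta> = adjoin z \<and> minimal_rat_poly \<theta> g \<and> degree g = degree f \<and>
    int_combination \<theta> (degree g) (\<theta> ^ degree g)"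
proof -
  define n where "n = degree f"
  note sz = is_subfield_adjoin[OF assms]
  have "z ^ n \<in> adjoin z" by (intro subfield_closed(9)[OF sz] self_in_adjoin)
  then obtain x where x: "z ^ n = (\<Sum>i<n. of_rat (x i) * z ^ i)"
    unfolding adjoin_eq_sums[OF assms] n_def[symmetric] by blast
  obtain D where D: "0 < D" "\<forall>y\<in>x ` {..<n}. \<exists>k. of_int D * y = of_int k"
    using common_denominator[of "x ` {..<n}"] by auto
  then have "\<forall>i. \<exists>k. i < n \<longrightarrow> of_int D * x i = of_int k" by blast
  then obtain k where k: "\<And>i. i < n \<Longrightarrow> of_int D * x i = of_int (k i)"
    unfolding choice_iff by blast
  define \<theta> where "\<theta> = of_int D * z"
  have z: "z = \<theta> / of_int D" using D(1) by (simp add: \<theta>_def)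
  have D_in: "of_int D \<in> L" if "is_subfield L" for L :: "complex set"
    using subfield_of_rat[OF that, of "of_int D"] by simp
  have "\<theta> \<in> adjoin z" unfolding \<theta>_def by (intro subfield_closed[OF sz] D_in sz self_in_adjoin)
  \<comment> \<open>\<open>f (x / D)\<close> annihilates \<theta>; it only serves to obtain some
    minimal polynomial, whose degree follows from the equality of the fields.\<close>
  define h where "h = pcompose f [:0, 1 / of_int D:]"
  have "rat_eval h \<theta> = rat_eval f z"
    by (simp add: h_def rat_eval_pcompose z of_rat_divide mult.commute)
  moreover have "degree h = degree f" using D(1) by (simp add: h_def degree_pcompose)
  moreover have "degree f > 0" by (rule minimal_rat_poly_degree_pos[OF assms])
  ultimately have "h \<noteq> 0" "rat_eval h \<theta> = 0" using assms by (auto simp: minimal_rat_poly_def)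
  then obtain g where g: "minimal_rat_poly \<theta> g" using minimal_rat_poly_exists by blast
  note s\<theta> = is_subfield_adjoin[OF g]
  have "z \<in> adjoin \<theta>" unfolding z by (intro subfield_closed[OF s\<theta>] D_in s\<theta> self_in_adjoin)
  then have eq: "adjoin \<theta> = adjoin z"
    using adjoin_subset[OF s\<theta>] adjoin_subset[OF sz \<open>\<theta> \<in> adjoin z\<close>] by blast
  then have deg: "degree g = degree f"
    using field_degree_adjoin[OF g] field_degree_adjoin[OF assms] by simp
  have "\<theta> ^ n = of_int D ^ n * (\<Sum>i<n. of_rat (x i) * z ^ i)"
    by (simp add: \<theta>_def power_mult_distrib flip: x)
  also have "\<dots> = (\<Sum>i<n. of_int D ^ n * (of_rat (x i) * z ^ i))"
    by (rule sum_distrib_left)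
  \<comment> \<open>For \<open>i < n\<close> the factor \<open>D ^ n\<close> splits into
    \<open>D ^ i\<close>, which turns \<open>z ^ i\<close> into \<open>\<theta> ^ i\<close>, one
    factor \<open>D\<close> that clears the denominator of \<open>x i\<close>, and the rest.\<close>
  also have "\<dots> = (\<Sum>i<n. of_int (D ^ (n - i - 1) * k i) * \<theta> ^ i)"
  proof (rule sum.cong[OF refl])
    fix i assume i: "i \<in> {..<n}"
    then have "n = (n - i - 1) + 1 + i" by simp
    then have "of_int D ^ n = of_int D ^ (n - i - 1) * of_int D * (of_int D ^ i :: complex)"
      by (metis power_add power_one_right)
    moreover have "of_int D * of_rat (x i) = (of_int (k i) :: complex)"
      using arg_cong[OF k[of i], of "of_rat :: rat \<Rightarrow> complex"] i by (simp add: of_rat_mult)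
    ultimately show "of_int D ^ n * (of_rat (x i) * z ^ i) = of_int (D ^ (n - i - 1) * k i) * \<theta> ^ i"
      by (simp add: \<theta>_def power_mult_distrib mult_ac)
  qed
  finally have "int_combination \<theta> n (\<theta> ^ n)" by (rule int_combinationI)
  then show ?thesis using eq deg g by (metis n_def)
qed

lemma int_boxI:
  assumes "finite I" "a = (\<Sum>i\<in>I. of_int (c i) * e i)"
  shows "\<exists>X. a \<in> int_box e I X"
proof -
  have "\<bar>real_of_int (c i)\<bar> \<le> (\<Sum>i\<in>I. \<bar>real_of_int (c i)\<bar>)" if "i \<in> I" for i
    using assms(1) that by (intro member_le_sum) auto
  then show ?thesis using assms(2) unfolding int_box_def by blast
qed

lemma lattice_ring_powers:
  assumes "int_combination \<theta> n (\<theta> ^ n)" "0 < n"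
  shows "lattice_ring (\<lambda>i. \<theta> ^ i) {..<n}"
proof
  have box: "\<exists>X. \<theta> ^ k \<in> int_box (\<lambda>i. \<theta> ^ i) {..<n} X" for k
    using int_combination_power[OF assms, of k] by (auto simp: int_combination_def intro: int_boxI)
  show "\<exists>X. 1 \<in> int_box (\<lambda>i. \<theta> ^ i) {..<n} X" using box[of 0] by simp
  show "\<exists>X. \<theta> ^ i * \<theta> ^ j \<in> int_box (\<lambda>i. \<theta> ^ i) {..<n} X" for i j
    using box[of "i + j"] by (simp add: power_add)
qed auto

text \<open>The ring \<open>\<int>[\<theta>, cnj \<theta>]\<close> is used because the field need
  not be closed under complex conjugation. Its \<open>n * n\<close> generators may be linearly
  dependent.\<close>

lemma lattice_ring_conjugate_powers:
  assumes "int_combination \<theta> n (\<theta> ^ n)" "0 < n"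
  shows "lattice_ring (\<lambda>(i, j). \<theta> ^ i * cnj \<theta> ^ j) ({..<n} \<times> {..<n})"
proof
  let ?e = "\<lambda>(i, j). \<theta> ^ i * cnj \<theta> ^ j" and ?I = "{..<n} \<times> {..<n}"
  have box: "\<exists>X. \<theta> ^ k * cnj \<theta> ^ l \<in> int_box ?e ?I X" for k l
  proof -
    obtain c where c: "\<theta> ^ k = (\<Sum>i<n. of_int (c i) * \<theta> ^ i)"
      using int_combination_power[OF assms, of k] by (auto simp: int_combination_def)
    obtain d where d: "\<theta> ^ l = (\<Sum>i<n. of_int (d i) * \<theta> ^ i)"
      using int_combination_power[OF assms, of l] by (auto simp: int_combination_def)
    have "cnj \<theta> ^ l = cnj (\<theta> ^ l)" by simp
    then have d': "cnj \<theta> ^ l = (\<Sum>j<n. of_int (d j) * cnj \<theta> ^ j)" by (simp only: d) simp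
    have "\<theta> ^ k * cnj \<theta> ^ l = (\<Sum>i<n. \<Sum>j<n. (of_int (c i) * \<theta> ^ i) * (of_int (d j) * cnj \<theta> ^ j))"
      unfolding c d' by (rule sum_product)
    also have "\<dots> = (\<Sum>p\<in>?I. of_int (c (fst p) * d (snd p)) * ?e p)"
      by (simp add: sum.cartesian_product case_prod_unfold mult_ac)
    finally show ?thesis by (rule int_boxI[rotated]) simp
  qed
  show "\<exists>X. 1 \<in> int_box ?e ?I X" using box[of 0 0] by simp
  show "\<exists>X. ?e p * ?e q \<in> int_box ?e ?I X" for p q
    using box[of "fst p + fst q" "snd p + snd q"] by (simp add: case_prod_unfold power_add mult_ac)
qed auto

lemma poly_over_adjoin_denominator:
  assumes "minimal_rat_poly \<theta> g" "poly_over (adjoin \<theta>) R"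
  shows "\<exists>D>0. \<forall>i. int_combination \<theta> (degree g) (of_int D * coeff R i)"
proof -
  define n where "n = degree g"
  have "\<exists>x. coeff R i = (\<Sum>j<n. of_rat (x j) * \<theta> ^ j)" for i
    using assms(2) unfolding poly_over_def adjoin_eq_sums[OF assms(1)] n_def[symmetric] by blast
  then obtain x where x: "\<And>i. coeff R i = (\<Sum>j<n. of_rat (x i j) * \<theta> ^ j)" by metis
  obtain D where D: "0 < D" "\<forall>y\<in>case_prod x ` ({..degree R} \<times> {..<n}). \<exists>k. of_int D * y = of_int k"
    using common_denominator[of "case_prod x ` ({..degree R} \<times> {..<n})"] by auto
  then have "\<forall>i j. \<exists>k. i \<le> degree R \<longrightarrow> j < n \<longrightarrow> of_int D * x i j = of_int k" by force
  then obtain k where k: "\<And>i j. i \<le> degree R \<Longrightarrow> j < n \<Longrightarrow> of_int D * x i j = of_int (k i j)"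
    unfolding choice_iff by blast
  have "int_combination \<theta> n (of_int D * coeff R i)" for i
  proof (cases "i \<le> degree R")
    case True
    have "of_int D * coeff R i = (\<Sum>j<n. of_int (k i j) * \<theta> ^ j)"
      unfolding x sum_distrib_left
    proof (rule sum.cong[OF refl])
      fix j assume "j \<in> {..<n}"
      then have "of_int D * of_rat (x i j) = (of_int (k i j) :: complex)"
        using arg_cong[OF k[OF True, of j], of "of_rat :: rat \<Rightarrow> complex"] by (simp add: of_rat_mult)
      then show "of_int D * (of_rat (x i j) * \<theta> ^ j) = of_int (k i j) * \<theta> ^ j"
        by (simp flip: mult.assoc)
    qed
    then show ?thesis unfolding int_combination_def by blast
  next
    case False
    then have "of_int D * coeff R i = (\<Sum>j<n. of_int 0 * \<theta> ^ j)" by (simp add: coeff_eq_0)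
    then show ?thesis by (rule int_combinationI)
  qed
  then show ?thesis using D(1) n_def by blast
qed

lemma lattice_poly_powers:
  assumes "lattice_ring (\<lambda>i. \<theta> ^ i) {..<n}" "\<And>i. int_combination \<theta> n (coeff R i)"
  shows "lattice_ring.lattice_poly (\<lambda>i. \<theta> ^ i) {..<n} R"
  unfolding lattice_ring.lattice_poly_def[OF assms(1)]
  using assms(2) by (auto simp: int_combination_def intro: int_boxI)

text \<open>Elements of \<open>\<int>[\<theta>]\<close> and their conjugates are the combinations in
  which one of the two exponents is always zero.\<close>

lemma lattice_poly_conjugate_powers:
  fixes \<theta> :: complex
  defines "e \<equiv> \<lambda>(i, j). \<theta> ^ i * cnj \<theta> ^ j"
  assumes L: "lattice_ring e ({..<n} \<times> {..<n})" and R: "\<And>i. int_combination \<theta> n (coeff R i)" and "0 < n"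
  shows "lattice_ring.lattice_poly e ({..<n} \<times> {..<n}) R"
    "lattice_ring.lattice_poly e ({..<n} \<times> {..<n}) (map_poly cnj R)"
proof -
  let ?I = "{..<n} \<times> {..<n}"
  obtain c where c: "\<And>k. coeff R k = (\<Sum>i<n. of_int (c k i) * \<theta> ^ i)"
    using R unfolding int_combination_def by metis
  have sub1: "(\<Sum>i<n. of_int (c k i) * \<theta> ^ i) = (\<Sum>p\<in>?I. of_int (if snd p = 0 then c k (fst p) else 0) * e p)" for k
  proof -
    have "(\<Sum>p\<in>?I. of_int (if snd p = 0 then c k (fst p) else 0) * e p)
      = (\<Sum>i<n. \<Sum>j<n. of_int (if j = 0 then c k i else 0) * (\<theta> ^ i * cnj \<theta> ^ j))"
      by (simp add: sum.cartesian_product case_prod_unfold e_def)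
    also have "\<dots> = (\<Sum>i<n. \<Sum>j<n. if j = 0 then of_int (c k i) * \<theta> ^ i else 0)"
      by (intro sum.cong) auto
    also have "\<dots> = (\<Sum>i<n. of_int (c k i) * \<theta> ^ i)" using \<open>0 < n\<close> by simp
    finally show ?thesis by simp
  qed
  have sub2: "(\<Sum>i<n. of_int (c k i) * cnj \<theta> ^ i) = (\<Sum>p\<in>?I. of_int (if fst p = 0 then c k (snd p) else 0) * e p)" for k
  proof -
    have "(\<Sum>p\<in>?I. of_int (if fst p = 0 then c k (snd p) else 0) * e p)
      = (\<Sum>i<n. \<Sum>j<n. of_int (if i = 0 then c k j else 0) * (\<theta> ^ i * cnj \<theta> ^ j))"
      by (simp add: sum.cartesian_product case_prod_unfold e_def)
    also have "\<dots> = (\<Sum>j<n. \<Sum>i<n. of_int (if i = 0 then c k j else 0) * (\<theta> ^ i * cnj \<theta> ^ j))"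
      by (rule sum.swap)
    also have "\<dots> = (\<Sum>j<n. \<Sum>i<n. if i = 0 then of_int (c k j) * cnj \<theta> ^ j else 0)"
      by (intro sum.cong) auto
    also have "\<dots> = (\<Sum>i<n. of_int (c k i) * cnj \<theta> ^ i)" using \<open>0 < n\<close> by simp
    finally show ?thesis by simp
  qed
  show "lattice_ring.lattice_poly e ?I R"
    unfolding lattice_ring.lattice_poly_def[OF L] c sub1 by (auto intro: int_boxI)
  have "coeff (map_poly cnj R) k = (\<Sum>i<n. of_int (c k i) * cnj \<theta> ^ i)" for k
    by (simp add: coeff_map_poly c)
  then show "lattice_ring.lattice_poly e ?I (map_poly cnj R)"
    unfolding lattice_ring.lattice_poly_def[OF L] sub2 by (auto intro: int_boxI)
qed

section \<open>Approximation by a Liouville sequence\<close>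

lemma height_ge_1_algebraic:
  assumes "algebraic \<alpha>" shows "1 \<le> real_of_int (height \<alpha>)"
  using height_ge_1[of \<alpha>] is_min_int_poly_min_int_poly[of _ \<alpha>] assms
  by (auto simp: algebraic_iff_int_poly)

lemma complex_of_rat: "(of_rat q :: complex) = of_real (of_rat q)"
  by (cases q) (simp add: of_rat_rat)

text \<open>Shows that a nonconstant quotient in lowest terms is not identically
  \<open>a / b\<close>: proportional polynomials divide each other, unless \<open>a = 0\<close> and
  then \<open>P = 0\<close>, and coprimality makes them units.\<close>

lemma coprime_proportional_degree_0:
  fixes P Q :: "'a::field poly"
  assumes "coprime P Q" "Q \<noteq> 0" "smult b P = smult a Q" "b \<noteq> 0"
  shows "degree P = 0 \<and> degree Q = 0"
proof -
  have "Q dvd smult b P" unfolding assms(3) by (simp add: dvd_smult)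
  then have "Q dvd P" using assms(4) by (simp add: dvd_smult_iff)
  then have "is_unit Q" using assms(1) by (meson coprime_common_divisor dvd_refl)
  then have "degree Q = 0" using assms(2) by (simp add: is_unit_iff_degree)
  moreover have "degree P = 0"
  proof (cases "a = 0")
    case True
    then show ?thesis using assms(3,4) by simp
  next
    case False
    have "P dvd smult a Q" unfolding assms(3)[symmetric] by (simp add: dvd_smult)
    then have "P dvd Q" using False by (simp add: dvd_smult_iff)
    then have "is_unit P" using assms(1) by (meson coprime_common_divisor dvd_refl)
    then show ?thesis by (metis is_unit_iff_degree degree_0)
  qed
  ultimately show ?thesis by simp
qed

text \<open>An exponent \<open>w\<close> larger than \<open>W\<close> would bound the heights of all
  its approximations by \<open>1 / c\<close>, leaving only finitely many of them.\<close>

lemma omega_star_finiteI: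
  assumes "0 < c" "\<And>\<beta>. algebraic \<beta> \<Longrightarrow> alg_degree \<beta> = d \<Longrightarrow> c \<le> \<bar>\<zeta> - \<beta>\<bar> * real_of_int (height \<beta>) ^ W"
  shows "omega_star d (of_real \<zeta>) < \<infinity>"
proof -
  have "w \<le> real W" if "0 < w" and inf: "infinite {\<beta> :: real. algebraic \<beta> \<and> alg_degree \<beta> = d \<and>
       0 < cmod (of_real \<zeta> - of_real \<beta>) \<and>
       cmod (of_real \<zeta> - of_real \<beta>) < real_of_int (height \<beta>) powr (- w - 1)}" (is "infinite ?A") for w
  proof (rule ccontr)
    assume w: "\<not> w \<le> real W"
    have "?A \<subseteq> {\<beta>. algebraic \<beta> \<and> alg_degree \<beta> = d \<and> real_of_int (height \<beta>) \<le> 1 / c}"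
    proof
      fix \<beta> assume "\<beta> \<in> ?A"
      then have \<beta>: "algebraic \<beta>" "alg_degree \<beta> = d" "\<bar>\<zeta> - \<beta>\<bar> < real_of_int (height \<beta>) powr (- w - 1)"
        by (auto simp flip: of_real_diff)
      define h where "h = real_of_int (height \<beta>)"
      have h: "1 \<le> h" unfolding h_def by (rule height_ge_1_algebraic[OF \<beta>(1)])
      have "c \<le> \<bar>\<zeta> - \<beta>\<bar> * h ^ W" using assms(2)[OF \<beta>(1,2)] by (simp add: h_def)
      also have "\<dots> \<le> h powr (- w - 1) * h powr W"
        using \<beta>(3) h by (simp add: h_def powr_realpow)
      also have "\<dots> = h powr (real W - w - 1)" by (simp add: algebra_simps flip: powr_add)
      also have "\<dots> \<le> h powr (- 1)" using w h by (intro powr_mono) auto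
      also have "\<dots> = 1 / h" using h by (simp add: powr_minus_divide)
      finally have "h \<le> 1 / c" using h assms(1) by (simp add: field_simps)
      then show "\<beta> \<in> {\<beta>. algebraic \<beta> \<and> alg_degree \<beta> = d \<and> real_of_int (height \<beta>) \<le> 1 / c}"
        using \<beta> by (simp add: h_def)
    qed
    then show False using inf finite_subset[OF _ finite_bounded_degree_height] by blast
  qed
  then have "omega_star d (of_real \<zeta>) \<le> ennreal (real W)"
    unfolding omega_star_def by (intro Sup_least) (auto intro: ennreal_leI)
  then show ?thesis using le_less_trans ennreal_less_top by (metis infinity_ennreal_def)
qed

locale liouville_sequence =
  fixes \<omega> :: "nat \<Rightarrow> real" and r :: "nat \<Rightarrow> rat" and \<xi> C :: real
  assumes lim: "filterlim \<omega> at_top sequentially"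
    and inf: "infinite (r ` {1..})"
    and approx: "\<And>n. n \<ge> 1 \<Longrightarrow> \<bar>\<xi> - of_rat (r n)\<bar> < real_of_int (height (r n)) powr (- \<omega> n)"
    and C_pos: "C > 0"
    and growth: "\<And>n. n \<ge> 1 \<Longrightarrow>
      real_of_int (height (r (n + 1))) \<le> real_of_int (height (r n)) powr (C * \<omega> n)"
begin

section \<open>Heights and errors along the sequence\<close>

definition H :: "nat \<Rightarrow> real" where "H n = real_of_int (height (r n))"

lemma naive_height_le_H: "naive_height (r n) \<le> H n"
  unfolding H_def by (rule naive_height_le_height)

lemma H_ge_1: "1 \<le> H n"
  using naive_height_ge_1 naive_height_le_H by (rule order_trans)

text \<open>If some \<open>H n\<close> were 1, the growth condition would keep all later heights
  equal to 1, and the sequence would take only finitely many values.\<close>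

lemma H_ge_2:
  assumes "1 \<le> n" shows "2 \<le> H n"
proof (rule ccontr)
  assume "\<not> 2 \<le> H n"
  then have "height (r n) < 2" "1 \<le> height (r n)" using H_ge_1[of n] by (simp_all add: H_def)
  then have n: "H n = 1" by (simp add: H_def)
  have one: "H (n + k) = 1" for k
  proof (induction k)
    case (Suc k)
    have "H (n + k + 1) \<le> H (n + k) powr (C * \<omega> (n + k))"
      unfolding H_def using assms by (intro growth) simp
    then show ?case using Suc H_ge_1[of "n + Suc k"] by simp
  qed (simp add: n)
  have "r ` {1..} \<subseteq> r ` {1..n} \<union> {q. naive_height q \<le> 1}"
  proof
    fix q assume "q \<in> r ` {1..}"
    then obtain k where k: "1 \<le> k" "q = r k" by auto
    show "q \<in> r ` {1..n} \<union> {q. naive_height q \<le> 1}"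
    proof (cases "k \<le> n")
      case False
      then have "H k = 1" using one[of "k - n"] by simp
      then show ?thesis using naive_height_le_H[of k] k by simp
    qed (use k in auto)
  qed
  then show False using inf finite_naive_height_le finite_subset by blast
qed

text \<open>The decay comes from the exponents: the base is at least 2, and \<omega> tends to
  infinity.\<close>

lemma eventually_error_small:
  assumes "0 < \<epsilon>"
  shows "eventually (\<lambda>n. H n powr (- \<omega> n) * H n ^ s < \<epsilon>) sequentially"
proof -
  \<comment> \<open>Chosen so that \<open>2 powr (- k) < \<epsilon>\<close>, and nonnegative so that
    the base \<open>H n\<close> may be replaced by 2.\<close>
  define k where "k = max 0 (1 - log 2 \<epsilon>)"
  have "eventually (\<lambda>n. real s + k \<le> \<omega> n) sequentially"
    using lim by (simp add: filterlim_at_top)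
  then show ?thesis using eventually_ge_at_top[of 1]
  proof eventually_elim
    case (elim n)
    have "H n powr (- \<omega> n) * H n ^ s = H n powr (real s - \<omega> n)"
      using H_ge_1[of n] by (simp add: powr_diff powr_minus_divide powr_realpow)
    also have "\<dots> \<le> H n powr (- k)" using H_ge_1[of n] elim by (intro powr_mono) auto
    also have "\<dots> \<le> 2 powr (- k)"
      using H_ge_2[of n] elim by (intro powr_mono2') (auto simp: k_def)
    also have "\<dots> < 2 powr (log 2 \<epsilon>)" by (intro powr_less_mono) (auto simp: k_def)
    also have "\<dots> = \<epsilon>" using assms by simp
    finally show ?case .
  qed
qed

lemma eventually_close:
  assumes "0 < \<epsilon>" shows "eventually (\<lambda>n. \<bar>\<xi> - of_rat (r n)\<bar> < \<epsilon>) sequentially"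
  using eventually_error_small[OF assms, of 0] eventually_ge_at_top[of 1]
proof eventually_elim
  case (elim n)
  then show ?case using approx[of n] by (simp add: H_def)
qed

text \<open>Every positive \<open>w\<close> is admissible, since the error beats any fixed power of
  the height of \<open>\<alpha> n\<close>. There are infinitely many approximations because a finite
  set of numbers different from \<zeta> stays away from \<zeta>, while \<open>\<alpha> n\<close>
  converges to it.\<close>

lemma omega_star_infiniteI:
  assumes alg: "eventually (\<lambda>n. algebraic (\<alpha> n) \<and> alg_degree (\<alpha> n) = m \<and> \<alpha> n \<noteq> \<zeta>) sequentially"
    and err: "eventually (\<lambda>n. \<bar>\<zeta> - \<alpha> n\<bar> \<le> c1 * H n powr (- \<omega> n)) sequentially" "0 < c1"
    and ht: "eventually (\<lambda>n. real_of_int (height (\<alpha> n)) \<le> c2 * H n ^ s) sequentially" "0 < c2"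
  shows "omega_star m (of_real \<zeta>) = \<infinity>"
proof -
  have "ennreal w \<le> omega_star m (of_real \<zeta>)" if w: "0 < w" for w :: real
  proof -
    define A where "A = {\<alpha> :: real. algebraic \<alpha> \<and> alg_degree \<alpha> = m \<and>
       0 < cmod (of_real \<zeta> - of_real \<alpha>) \<and>
       cmod (of_real \<zeta> - of_real \<alpha>) < real_of_int (height \<alpha>) powr (- w - 1)}"
    define k where "k = nat \<lceil>w + 1\<rceil>"
    have k: "w + 1 \<le> real k" unfolding k_def by linarith
    have "0 < 1 / (c1 * c2 ^ k)" using err(2) ht(2) by simp
    note small = eventually_error_small[OF this, of "s * k"]
    have in_A: "eventually (\<lambda>n. \<alpha> n \<in> A) sequentially"
      using alg err(1) ht(1) small
    proof eventually_elim
      case (elim n)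
      define h where "h = real_of_int (height (\<alpha> n))"
      have h: "1 \<le> h" unfolding h_def using elim by (intro height_ge_1_algebraic) auto
      have hk: "h ^ k \<le> c2 ^ k * H n ^ (s * k)"
        using power_mono[of h "c2 * H n ^ s" k] elim h by (simp add: h_def power_mult_distrib power_mult)
      have "\<bar>\<zeta> - \<alpha> n\<bar> * h ^ k \<le> (c1 * H n powr (- \<omega> n)) * (c2 ^ k * H n ^ (s * k))"
        using elim hk h err(2) by (intro mult_mono) auto
      also have "\<dots> = (c1 * c2 ^ k) * (H n powr (- \<omega> n) * H n ^ (s * k))" by simp
      also have "\<dots> < 1" using elim err(2) ht(2) by (simp add: field_simps)
      finally have "\<bar>\<zeta> - \<alpha> n\<bar> < 1 / h ^ k" using h by (simp add: field_simps)
      also have "\<dots> = h powr (- real k)" using h by (simp add: powr_minus_divide powr_realpow)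
      also have "\<dots> \<le> h powr (- w - 1)" using h k by (intro powr_mono) auto
      finally show ?case using elim by (auto simp: A_def h_def simp flip: of_real_diff)
    qed
    have "infinite A"
    proof
      assume fin: "finite A"
      obtain n0 where "\<alpha> n0 \<in> A" using eventually_happens[OF in_A] by auto
      define \<delta> where "\<delta> = Min ((\<lambda>a. \<bar>\<zeta> - a\<bar>) ` A)"
      have "0 < \<delta>" unfolding \<delta>_def using fin \<open>\<alpha> n0 \<in> A\<close>
        by (subst Min_gr_iff) (auto simp: A_def simp flip: of_real_diff)
      then have "0 < \<delta> / c1" using err(2) by simp
      from eventually_error_small[OF this, of 0]
      have "eventually (\<lambda>n. False) sequentially" using in_A err(1)
      proof eventually_elim
        case (elim n)
        have "\<delta> \<le> \<bar>\<zeta> - \<alpha> n\<bar>" unfolding \<delta>_def using fin elim by (intro Min_le) auto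
        moreover have "c1 * H n powr (- \<omega> n) < \<delta>" using elim err(2) by (simp add: field_simps)
        ultimately show ?case using elim by simp
      qed
      then show False by simp
    qed
    then show ?thesis unfolding omega_star_def using w by (intro Sup_upper) (auto simp: A_def)
  qed
  note ge = this
  show ?thesis
  proof (cases "omega_star m (of_real \<zeta>)" rule: ennreal_cases)
    \<comment> \<open>A finite supremum \<open>y\<close> would be exceeded by the admissible
      exponent \<open>y + 1\<close>.\<close>
    case (real y)
    then have "ennreal (y + 1) \<le> ennreal y" using ge[of "y + 1"] by simp
    then show ?thesis using real by (simp add: ennreal_le_iff)
  qed simp
qed

text \<open>The distance from \<zeta> to \<beta> is controlled through the first \<open>n\<close>
  for which the error of \<open>\<alpha> n\<close> is at most half of its guaranteed separation from
  \<beta>. As the preceding index fails this test, the growth condition bounds \<open>H n\<close> by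
  a power of \<open>h\<close>, which stands for the height of \<beta>.\<close>

lemma lower_boundI:
  assumes err: "eventually (\<lambda>n. \<bar>\<zeta> - \<alpha> n\<bar> \<le> c1 * H n powr (- \<omega> n)) sequentially" "0 < c1"
    and sep: "eventually (\<lambda>n. \<forall>(\<beta>, h)\<in>B. c \<le> \<bar>\<alpha> n - \<beta>\<bar> * (h * H n) ^ s) sequentially" "0 < c"
    and B: "\<And>\<beta> h. (\<beta>, h) \<in> B \<Longrightarrow> 1 \<le> h"
  shows "\<exists>c'>0. \<exists>W. \<forall>(\<beta>, h)\<in>B. c' \<le> \<bar>\<zeta> - \<beta>\<bar> * h ^ W"
proof -
  have "eventually (\<lambda>n. 2 * real s \<le> \<omega> n \<and> 0 \<le> \<omega> n) sequentially"
    using lim by (simp add: filterlim_at_top eventually_conj_iff)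
  from eventually_conj[OF this eventually_conj[OF err(1) eventually_conj[OF sep(1) eventually_ge_at_top[of 1]]]]
  obtain N where N: "\<And>n. N \<le> n \<Longrightarrow> 2 * real s \<le> \<omega> n \<and> 0 \<le> \<omega> n" "\<And>n. N \<le> n \<Longrightarrow> \<bar>\<zeta> - \<alpha> n\<bar> \<le> c1 * H n powr (- \<omega> n)"
      "\<And>n \<beta> h. N \<le> n \<Longrightarrow> (\<beta>, h) \<in> B \<Longrightarrow> c \<le> \<bar>\<alpha> n - \<beta>\<bar> * (h * H n) ^ s" "\<And>n. N \<le> n \<Longrightarrow> 1 \<le> n"
    unfolding eventually_sequentially by (auto; blast)
  \<comment> \<open>\<open>A\<close> bounds the constant that arises when the index before
    \<open>n\<close> fails the test; \<open>A'\<close> also covers \<open>n = N\<close>, which has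
    no earlier index in range.\<close>
  define A where "A = max 1 (2 * c1 / c)"
  define k where "k = nat \<lceil>C\<rceil>"
  define A' where "A' = max (H N) (A ^ (2 * k))"
  define s' where "s' = 2 * s * k"
  have A: "1 \<le> A" "1 \<le> A'" "2 * c1 / c \<le> A" using H_ge_1[of N] by (auto simp: A_def A'_def)
  have k: "C \<le> real k" unfolding k_def by linarith
  have "c / (2 * A' ^ s) \<le> \<bar>\<zeta> - \<beta>\<bar> * h ^ (s + s' * s)" if \<beta>: "(\<beta>, h) \<in> B" for \<beta> h
  proof -
    have h: "1 \<le> h" by (rule B[OF \<beta>])
    define good where "good n \<longleftrightarrow> N \<le> n \<and> c1 * H n powr (- \<omega> n) * (h * H n) ^ s \<le> c / 2" for n
    have "0 < c / (2 * c1 * h ^ s)" using sep(2) err(2) h by simp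
    from eventually_conj[OF eventually_error_small[OF this, of s] eventually_ge_at_top[of N]]
    obtain n0 where "H n0 powr (- \<omega> n0) * H n0 ^ s < c / (2 * c1 * h ^ s)" "N \<le> n0"
      using eventually_happens by fastforce
    then have "good n0" using err(2) h by (simp add: good_def field_simps power_mult_distrib)
    define n where "n = (LEAST n. good n)"
    have n: "good n" unfolding n_def using \<open>good n0\<close> by (rule LeastI)
    have Hn: "H n \<le> A' * h ^ s'"
    proof (cases "n = N")
      case True
      have "H n * 1 \<le> A' * h ^ s'"
        using True h A by (intro mult_mono one_le_power) (auto simp: A'_def)
      then show ?thesis by simp
    next
      case False
      then obtain l where l: "n = Suc l" "N \<le> l" using n by (cases n) (auto simp: good_def)
      then have "\<not> good l" unfolding n_def by (metis lessI not_less_Least)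
      then have bad: "c / 2 < c1 * H l powr (- \<omega> l) * (h * H l) ^ s" using l by (simp add: good_def)
      define x where "x = H l powr \<omega> l"
      have Hl: "1 \<le> H l" by (rule H_ge_1)
      then have x: "1 \<le> x" using N(1)[OF l(2)] by (simp add: x_def ge_one_powr_ge_zero)
      \<comment> \<open>As \<open>\<omega> l\<close> is at least \<open>2 * s\<close>, the factor
        \<open>H l ^ s\<close> is at most the square root of \<open>x\<close>. Together with the
        failed test, which gives \<open>x \<le> A * h ^ s * H l ^ s\<close>, this bounds
        \<open>x\<close> by \<open>h\<close> alone.\<close>
      have "(H l ^ s) ^ 2 = H l ^ (2 * s)" by (simp add: mult.commute flip: power_mult)
      also have "\<dots> = H l powr real (2 * s)" using Hl by (intro powr_realpow[symmetric]) auto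
      also have "\<dots> \<le> x" unfolding x_def using Hl N(1)[OF l(2)] by (intro powr_mono) auto
      finally have sq: "(H l ^ s) ^ 2 \<le> x" .
      have "x * c < x * (2 * (c1 * H l powr (- \<omega> l) * (h * H l) ^ s))"
        using bad x by (intro mult_strict_left_mono) auto
      also have "\<dots> = 2 * c1 * h ^ s * H l ^ s"
        using Hl by (simp add: x_def powr_minus power_mult_distrib)
      finally have "x \<le> (2 * c1 / c) * h ^ s * H l ^ s" using sep(2) by (simp add: field_simps)
      also have "\<dots> \<le> A * h ^ s * H l ^ s" using A(3) h Hl by (intro mult_right_mono) auto
      finally have "x ^ 2 \<le> (A * h ^ s * H l ^ s) ^ 2" using x by (intro power_mono) auto
      also have "\<dots> = (A * h ^ s) ^ 2 * (H l ^ s) ^ 2" by (simp add: power_mult_distrib)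
      also have "\<dots> \<le> (A * h ^ s) ^ 2 * x" using sq by (intro mult_left_mono) auto
      finally have xle: "x \<le> (A * h ^ s) ^ 2" using x by (simp add: power2_eq_square)
      \<comment> \<open>The growth condition turns the bound on \<open>x\<close> into one on
        \<open>H n\<close>, with \<open>C\<close> rounded up to the natural number
        \<open>k\<close>.\<close>
      have "H n \<le> H l powr (C * \<omega> l)"
        using growth[OF N(4)[OF l(2)]] by (simp add: H_def l(1))
      also have "\<dots> = x powr C" by (simp add: x_def powr_powr mult.commute)
      also have "\<dots> \<le> x powr real k" using x k by (intro powr_mono) auto
      also have "\<dots> = x ^ k" using x by (simp add: powr_realpow)
      also have "\<dots> \<le> ((A * h ^ s) ^ 2) ^ k" using xle x by (intro power_mono) auto
      also have "\<dots> = A ^ (2 * k) * h ^ s'"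
        by (simp add: s'_def power_mult_distrib mult_ac flip: power_mult)
      also have "\<dots> \<le> A' * h ^ s'" using h by (intro mult_right_mono) (auto simp: A'_def)
      finally show ?thesis .
    qed
    have H1: "1 \<le> H n" by (rule H_ge_1)
    have nN: "N \<le> n" using n by (simp add: good_def)
    \<comment> \<open>By the triangle inequality, where the error uses up at most half of
      \<open>c\<close>.\<close>
    have "c \<le> \<bar>\<alpha> n - \<beta>\<bar> * (h * H n) ^ s" by (rule N(3)[OF nN \<beta>])
    also have "\<dots> \<le> (\<bar>\<zeta> - \<beta>\<bar> + \<bar>\<zeta> - \<alpha> n\<bar>) * (h * H n) ^ s"
      using h H1 by (intro mult_right_mono) auto
    also have "\<dots> \<le> \<bar>\<zeta> - \<beta>\<bar> * (h * H n) ^ s + c1 * H n powr (- \<omega> n) * (h * H n) ^ s"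
      unfolding distrib_right using N(2)[OF nN] h H1 by (intro add_left_mono mult_right_mono) auto
    also have "\<dots> \<le> \<bar>\<zeta> - \<beta>\<bar> * (h * H n) ^ s + c / 2" using n by (simp add: good_def)
    finally have "c / 2 \<le> \<bar>\<zeta> - \<beta>\<bar> * (h * H n) ^ s" by simp
    also have "\<dots> \<le> \<bar>\<zeta> - \<beta>\<bar> * (h * (A' * h ^ s')) ^ s"
      using Hn h H1 by (intro mult_left_mono power_mono) auto
    also have "\<dots> = A' ^ s * (\<bar>\<zeta> - \<beta>\<bar> * h ^ (s + s' * s))"
      by (simp add: power_mult_distrib power_add mult_ac flip: power_mult)
    finally show ?thesis using A(2) by (simp add: field_simps)
  qed
  moreover have "0 < c / (2 * A' ^ s)" using sep(2) A(2) by simp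
  ultimately show ?thesis by blast
qed

text \<open>A zero at \<xi> makes the value of \<open>R\<close> at \<open>r n\<close> at most a
  constant times \<open>H n powr (- \<omega> n)\<close>, which eventually falls below the bound for
  nonzero values. So \<open>R\<close> vanishes at all \<open>r n\<close> from some index on, which
  are infinitely many numbers. This is the transcendence of \<xi> in the form used below.\<close>

lemma lattice_poly_no_root:
  assumes L: "lattice_ring e I" and R: "lattice_ring.lattice_poly e I R" and root: "poly R (of_real \<xi>) = 0"
  shows "R = 0"
proof (rule ccontr)
  assume "R \<noteq> 0"
  obtain c s where c: "0 < c" "\<And>q. poly R (of_rat q) \<noteq> 0 \<Longrightarrow> c \<le> norm (poly R (of_rat q)) * naive_height q ^ s"
    using lattice_ring.poly_value_lower_bound[OF L R] by blast
  obtain K where K: "0 < K" "\<And>x y. norm x \<le> \<bar>\<xi>\<bar> + 1 \<Longrightarrow> norm y \<le> \<bar>\<xi>\<bar> + 1 \<Longrightarrow> norm (poly R x - poly R y) \<le> K * norm (x - y)"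
    using poly_lipschitz_fixed by blast
  have "0 < c / K" using c(1) K(1) by simp
  from eventually_conj[OF eventually_error_small[OF this, of s] eventually_conj[OF eventually_close[of 1] eventually_ge_at_top[of 1]]]
  obtain N where N: "\<And>n. N \<le> n \<Longrightarrow> H n powr (- \<omega> n) * H n ^ s < c / K"
      "\<And>n. N \<le> n \<Longrightarrow> \<bar>\<xi> - of_rat (r n)\<bar> < 1" "\<And>n. N \<le> n \<Longrightarrow> 1 \<le> n"
    unfolding eventually_sequentially by (auto; blast)
  have "poly R (of_rat (r n)) = 0" if n: "N \<le> n" for n
  proof (rule ccontr)
    assume nz: "poly R (of_rat (r n)) \<noteq> 0"
    have d: "norm (of_rat (r n) - of_real \<xi> :: complex) = \<bar>\<xi> - of_rat (r n)\<bar>"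
      by (simp add: complex_of_rat abs_minus_commute flip: of_real_diff)
    have "norm (poly R (of_rat (r n)) - poly R (of_real \<xi>)) \<le> K * norm (of_rat (r n) - of_real \<xi> :: complex)"
    proof (rule K(2))
      have "\<bar>of_rat (r n)\<bar> \<le> \<bar>\<xi>\<bar> + 1" using N(2)[OF n] by linarith
      then show "norm (of_rat (r n) :: complex) \<le> \<bar>\<xi>\<bar> + 1" unfolding complex_of_rat norm_of_real .
    qed simp
    then have "norm (poly R (of_rat (r n))) \<le> K * \<bar>\<xi> - of_rat (r n)\<bar>" by (simp add: root d)
    also have "\<dots> \<le> K * H n powr (- \<omega> n)"
      using approx[OF N(3)[OF n]] K(1) by (simp add: H_def)
    finally have b: "norm (poly R (of_rat (r n))) \<le> K * H n powr (- \<omega> n)" .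
    have "c \<le> norm (poly R (of_rat (r n))) * naive_height (r n) ^ s" by (rule c(2)[OF nz])
    also have "\<dots> \<le> (K * H n powr (- \<omega> n)) * H n ^ s"
      using b naive_height_le_H[of n] naive_height_ge_1[of "r n"] K(1)
      by (intro mult_mono power_mono) auto
    also have "\<dots> < c" using N(1)[OF n] K(1) by (simp add: field_simps)
    finally show False by simp
  qed
  then have "r n \<in> r ` {1..N} \<union> {q. poly R (of_rat q) = 0}" if "1 \<le> n" for n
    using that by (cases "n \<le> N") auto
  then have "r ` {1..} \<subseteq> r ` {1..N} \<union> {q. poly R (of_rat q) = 0}" by blast
  moreover have "finite {q. poly R (of_rat q :: complex) = 0}"
    using finite_vimageI[OF poly_roots_finite[OF \<open>R \<noteq> 0\<close>], of of_rat]
    by (simp add: vimage_def inj_on_def)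
  ultimately show False using inf finite_subset by blast
qed

lemma irrational:
  assumes L: "lattice_ring e I"
  shows "\<xi> \<noteq> of_rat q"
proof
  assume q: "\<xi> = of_rat q"
  obtain a b where ab: "quotient_of q = (a, b)" by (cases "quotient_of q")
  have b: "0 < b" "q = of_int a / of_int b" using quotient_of_denom_pos[OF ab] quotient_of_div[OF ab] .
  have "[:of_int (- a), of_int b:] = (0 :: complex poly)"
    by (rule lattice_poly_no_root[OF L lattice_ring.lattice_poly_linear[OF L]])
      (use b in \<open>simp add: q of_rat_divide\<close>)
  then show False using b by simp
qed

text \<open>An irrational \<xi> has positive distance from a finite set of rationals, and
  \<open>r n\<close> converges to \<xi>.\<close>

lemma eventually_notin:
  assumes "\<And>q. \<xi> \<noteq> of_rat q" "finite S"
  shows "eventually (\<lambda>n. r n \<notin> S) sequentially"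
proof (cases "S = {}")
  case False
  define \<delta> where "\<delta> = Min ((\<lambda>q. \<bar>\<xi> - of_rat q\<bar>) ` S)"
  have "0 < \<delta>" unfolding \<delta>_def using assms False by (subst Min_gr_iff) auto
  from eventually_close[OF this] show ?thesis
  proof eventually_elim
    case (elim n)
    show ?case
    proof
      assume "r n \<in> S"
      then have "\<delta> \<le> \<bar>\<xi> - of_rat (r n)\<bar>" unfolding \<delta>_def using assms(2) by (intro Min_le) auto
      then show False using elim by simp
    qed
  qed
qed simp

lemma eventually_value_error:
  fixes P Q :: "complex poly"
  assumes "poly Q (of_real \<xi>) \<noteq> 0"
  shows "\<exists>c>0. eventually (\<lambda>n. poly Q (of_rat (r n)) \<noteq> 0 \<and>
    norm (poly P (of_real \<xi>) / poly Q (of_real \<xi>) - poly P (of_rat (r n)) / poly Q (of_rat (r n)))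
      \<le> c * H n powr (- \<omega> n)) sequentially"
proof -
  define p q where "p = poly P (of_real \<xi>)" and "q = poly Q (of_real \<xi>)"
  \<comment> \<open>Reduces the quotient to polynomials: \<open>G\<close> vanishes at \<xi>, and the
    difference of the values of \<open>P / Q\<close> at \<xi> and \<open>x\<close> is
    \<open>G x / (q * Q x)\<close>.\<close>
  define G where "G = smult p Q - smult q P"
  have G0: "poly G (of_real \<xi>) = 0" by (simp add: G_def p_def q_def)
  have q: "0 < norm q" using assms by (simp add: q_def)
  obtain K1 where K1: "0 < K1" "\<And>x y. norm x \<le> \<bar>\<xi>\<bar> + 1 \<Longrightarrow> norm y \<le> \<bar>\<xi>\<bar> + 1 \<Longrightarrow> norm (poly G x - poly G y) \<le> K1 * norm (x - y)"
    using poly_lipschitz_fixed by blast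
  obtain K2 where K2: "0 < K2" "\<And>x y. norm x \<le> \<bar>\<xi>\<bar> + 1 \<Longrightarrow> norm y \<le> \<bar>\<xi>\<bar> + 1 \<Longrightarrow> norm (poly Q x - poly Q y) \<le> K2 * norm (x - y)"
    using poly_lipschitz_fixed by blast
  \<comment> \<open>Within this distance of \<xi> the value of \<open>Q\<close> changes by at most
    \<open>norm q / 2\<close> and so keeps half its size; the bound 1 stays inside the disc of the
    Lipschitz estimates.\<close>
  define \<delta> where "\<delta> = min 1 (norm q / (2 * K2))"
  have "0 < \<delta>" using q K2(1) by (simp add: \<delta>_def)
  define c where "c = 2 * K1 / (norm q) ^ 2"
  have "eventually (\<lambda>n. poly Q (of_rat (r n)) \<noteq> 0 \<and>
    norm (p / q - poly P (of_rat (r n)) / poly Q (of_rat (r n))) \<le> c * H n powr (- \<omega> n)) sequentially"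
    using eventually_close[OF \<open>0 < \<delta>\<close>] eventually_ge_at_top[of 1]
  proof eventually_elim
    case (elim n)
    define x where "x = (of_rat (r n) :: complex)"
    have x: "norm x \<le> \<bar>\<xi>\<bar> + 1"
    proof -
      have "\<bar>\<xi> - of_rat (r n)\<bar> < 1" using elim by (simp add: \<delta>_def)
      then have "\<bar>of_rat (r n)\<bar> \<le> \<bar>\<xi>\<bar> + 1" by linarith
      then show ?thesis unfolding x_def complex_of_rat norm_of_real .
    qed
    have \<xi>: "norm (of_real \<xi> :: complex) \<le> \<bar>\<xi>\<bar> + 1" by simp
    have d: "norm (x - of_real \<xi>) = \<bar>\<xi> - of_rat (r n)\<bar>"
      by (simp add: x_def complex_of_rat abs_minus_commute flip: of_real_diff)
    have "norm q \<le> norm (poly Q x) + norm (poly Q x - q)"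
      using norm_triangle_ineq4[of "poly Q x" "poly Q x - q"] by simp
    also have "norm (poly Q x - q) \<le> K2 * \<bar>\<xi> - of_rat (r n)\<bar>"
      using K2(2)[OF x \<xi>] by (simp add: q_def d)
    also have "\<dots> \<le> K2 * (norm q / (2 * K2))"
      using elim K2(1) by (intro mult_left_mono) (auto simp: \<delta>_def)
    finally have Qx: "norm q / 2 \<le> norm (poly Q x)" using K2(1) by simp
    then have nz: "poly Q x \<noteq> 0" using q by auto
    have "p / q - poly P x / poly Q x = poly G x / (q * poly Q x)"
      using nz q by (simp add: G_def field_simps)
    then have "norm (p / q - poly P x / poly Q x) = norm (poly G x) / (norm q * norm (poly Q x))"
      by (simp add: norm_divide norm_mult)
    also have "\<dots> \<le> (K1 * H n powr (- \<omega> n)) / (norm q * (norm q / 2))"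
    proof (intro frac_le mult_left_mono Qx)
      have "norm (poly G x) \<le> K1 * \<bar>\<xi> - of_rat (r n)\<bar>" using K1(2)[OF x \<xi>] by (simp add: G0 d)
      also have "\<dots> \<le> K1 * H n powr (- \<omega> n)"
        using approx[of n] elim K1(1) by (simp add: H_def)
      finally show "norm (poly G x) \<le> K1 * H n powr (- \<omega> n)" .
    qed (use q K1(1) in auto)
    also have "\<dots> = c * H n powr (- \<omega> n)" by (simp add: c_def power2_eq_square)
    finally show ?case using nz by (simp add: x_def)
  qed
  moreover have "0 < c" using K1(1) q by (simp add: c_def)
  ultimately show ?thesis unfolding p_def q_def by blast
qed

end

text \<open>\<open>field_of_definition\<close> says that no smaller field inside \<open>K\<close>
  carries \<open>P / Q\<close>, without which the degree of its values could drop;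
  \<open>real_value\<close> is there because \<open>omega_star\<close> approximates by real numbers
  only.\<close>

theorem theorem1:
  fixes \<omega> :: "nat \<Rightarrow> real" and \<xi> :: real and r :: "nat \<Rightarrow> rat" and C :: real
    and K :: "complex set" and m :: nat and P Q :: "complex poly"
  assumes "\<And>n. n \<ge> 1 \<Longrightarrow> \<omega> n > 0"
    and "filterlim \<omega> at_top sequentially"
    and "infinite (r ` {1..})"
    and "\<And>n. n \<ge> 1 \<Longrightarrow> \<bar>\<xi> - of_rat (r n)\<bar> < real_of_int (height (r n)) powr (- \<omega> n)"
    and "C > 0"
    and "\<And>n. n \<ge> 1 \<Longrightarrow>
      real_of_int (height (r (n + 1))) \<le> real_of_int (height (r n)) powr (C * \<omega> n)"
    and "number_field K" and "field_degree K = m"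
    and "poly_over K P" and "poly_over K Q" and "Q \<noteq> 0" and "coprime P Q"
    and nonconstant: "degree P > 0 \<or> degree Q > 0"
    and field_of_definition: "\<And>L. is_subfield L \<Longrightarrow> L \<subset> K \<Longrightarrow> \<not> ratfun_over L P Q"
    and real_value: "poly P (of_real \<xi>) / poly Q (of_real \<xi>) \<in> \<real>"
  shows "U_number m (poly P (of_real \<xi>) / poly Q (of_real \<xi>))"
proof -
  interpret liouville_sequence \<omega> r \<xi> C
    by unfold_locales (use assms in auto)
  obtain \<theta>0 where \<theta>0: "adjoin \<theta>0 = K" using primitive_element[OF assms(7)] by blast
  then obtain f0 where "minimal_rat_poly \<theta>0 f0"
    using number_field_algebraic[OF assms(7)] self_in_adjoin by blast
  \<comment> \<open>With an integral generator, \<open>\<int>[\<theta>]\<close> and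
    \<open>\<int>[\<theta>, cnj \<theta>]\<close> are finitely generated as groups.\<close>
  from adjoin_integral_generator[OF this] \<theta>0
  obtain \<theta> g where K: "adjoin \<theta> = K" and g: "minimal_rat_poly \<theta> g"
    and top: "int_combination \<theta> (degree g) (\<theta> ^ degree g)" by auto
  have m: "degree g = m" using field_degree_adjoin[OF g] assms(8) K by simp
  have "0 < m" using minimal_rat_poly_degree_pos[OF g] m by simp
  note L1 = lattice_ring_powers[OF top[unfolded m] \<open>0 < m\<close>]
  note L2 = lattice_ring_conjugate_powers[OF top[unfolded m] \<open>0 < m\<close>]
  interpret lattice_ring "\<lambda>i. \<theta> ^ i" "{..<m}" by (rule L1)
  obtain D1 where D1: "0 < D1" "\<And>i. int_combination \<theta> m (of_int D1 * coeff P i)"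
    using poly_over_adjoin_denominator[OF g] assms(9) K m by blast
  obtain D2 where D2: "0 < D2" "\<And>i. int_combination \<theta> m (of_int D2 * coeff Q i)"
    using poly_over_adjoin_denominator[OF g] assms(10) K m by blast
  \<comment> \<open>Clears all denominators: \<open>P'\<close> and \<open>Q'\<close> have
    coefficients in \<open>\<int>[\<theta>]\<close> and the same quotient.\<close>
  define D :: complex where "D = of_int (D1 * D2)"
  have "D \<noteq> 0" using D1(1) D2(1) by (simp add: D_def)
  define P' Q' where "P' = smult D P" and "Q' = smult D Q"
  have int: "int_combination \<theta> m (coeff P' i)" "int_combination \<theta> m (coeff Q' i)" for i
    using int_combination_of_int[OF D1(2), of D2 i] int_combination_of_int[OF D2(2), of D1 i]
    by (simp_all add: P'_def Q'_def D_def mult_ac)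
  note lat = lattice_poly_powers[OF L1 int(1)] lattice_poly_powers[OF L1 int(2)]
  note lat2 = lattice_poly_conjugate_powers[OF L2 int(1) \<open>0 < m\<close>]
    lattice_poly_conjugate_powers[OF L2 int(2) \<open>0 < m\<close>]
  have "Q' \<noteq> 0" using assms(11) \<open>D \<noteq> 0\<close> by (simp add: Q'_def)
  define F where "F x = poly P' x / poly Q' x" for x
  have F: "F x = poly P x / poly Q x" "poly Q' x \<noteq> 0 \<longleftrightarrow> poly Q x \<noteq> 0" for x
    using \<open>D \<noteq> 0\<close> by (simp_all add: F_def P'_def Q'_def)
  \<comment> \<open>Excludes a zero denominator, where division would have the default value
    0.\<close>
  have Q\<xi>: "poly Q' (of_real \<xi>) \<noteq> 0" using lattice_poly_no_root[OF L1 lat(2)] \<open>Q' \<noteq> 0\<close> by blast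
  obtain \<zeta> where \<zeta>: "F (of_real \<xi>) = of_real \<zeta>" using real_value F by (auto elim: Reals_cases)
  then have P\<xi>: "poly P' (of_real \<xi>) = of_real \<zeta> * poly Q' (of_real \<xi>)"
    using Q\<xi> by (simp add: F_def field_simps)

  \<comment> \<open>Reality of the values at rational points\<close>
  have cnj: "poly (map_poly cnj p) (of_real x) = cnj (poly p (of_real x))" for p x
    using poly_cnj[of p "of_real x"] by simp
  \<comment> \<open>As \<open>F \<xi>\<close> is real, this polynomial vanishes at \<xi>; its
    coefficients lie in \<open>\<int>[\<theta>, cnj \<theta>]\<close>, so it is zero. Hence
    \<open>F\<close> equals its conjugate at all real points where \<open>Q'\<close> does not
    vanish.\<close>
  have conj: "P' * map_poly cnj Q' - map_poly cnj P' * Q' = 0"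
    by (rule lattice_poly_no_root[OF L2])
      (intro lattice_ring.lattice_poly_diff[OF L2] lattice_ring.lattice_poly_mult[OF L2] lat2,
       simp add: cnj P\<xi>)
  have F_real: "F (of_rat q) = of_real (Re (F (of_rat q)))" if "poly Q' (of_rat q) \<noteq> 0" for q
  proof -
    have "poly (P' * map_poly cnj Q' - map_poly cnj P' * Q') (of_rat q) = 0" by (simp add: conj)
    then have "F (of_rat q) = cnj (F (of_rat q))"
      using that unfolding complex_of_rat by (simp add: cnj F_def field_simps)
    then show ?thesis by (metis Reals_cnj_iff of_real_Re)
  qed
  define \<alpha> where "\<alpha> n = Re (F (of_rat (r n)))" for n

  \<comment> \<open>Degree and accuracy of the approximants\<close>
  define bad where "bad = {r :: rat. poly Q (of_rat r) \<noteq> 0 \<and> (\<exists>t. t \<noteq> 0 \<and> degree t < m \<and>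
    poly (map_poly of_int t) (poly P (of_rat r) / poly Q (of_rat r)) = 0)}"
  \<comment> \<open>By the minimality of \<open>K\<close> only finitely many rationals give values
    of degree below \<open>m\<close>, and \<open>r n\<close> eventually avoids them because \<xi> is
    irrational.\<close>
  have "finite bad" unfolding bad_def m[symmetric]
    by (rule finite_low_degree_values[OF g K[symmetric] assms(9-11) field_of_definition])
  note not_bad = eventually_notin[OF irrational[OF L1] this]
  obtain c1 where c1: "0 < c1" and val: "eventually (\<lambda>n. poly Q' (of_rat (r n)) \<noteq> 0 \<and>
      norm (F (of_real \<xi>) - F (of_rat (r n))) \<le> c1 * H n powr (- \<omega> n)) sequentially"
    using eventually_value_error[OF Q\<xi>, of P'] unfolding F_def by blast
  have good: "eventually (\<lambda>n. poly Q' (of_rat (r n)) \<noteq> 0 \<and> F (of_rat (r n)) = of_real (\<alpha> n) \<and>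
      \<bar>\<zeta> - \<alpha> n\<bar> \<le> c1 * H n powr (- \<omega> n) \<and>
      (\<forall>t. t \<noteq> 0 \<longrightarrow> degree t < m \<longrightarrow> poly (map_poly of_int t) (F (of_rat (r n))) \<noteq> 0)) sequentially"
    using val not_bad
  proof eventually_elim
    case (elim n)
    have eq: "F (of_rat (r n)) = of_real (\<alpha> n)" unfolding \<alpha>_def using F_real elim by blast
    have "norm (F (of_real \<xi>) - F (of_rat (r n))) = \<bar>\<zeta> - \<alpha> n\<bar>"
      unfolding eq \<zeta> by (simp flip: of_real_diff)
    then show ?case using elim eq F by (auto simp: bad_def)
  qed
  have err: "eventually (\<lambda>n. \<bar>\<zeta> - \<alpha> n\<bar> \<le> c1 * H n powr (- \<omega> n)) sequentially"
    using good by eventually_elim blast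

  \<comment> \<open>Heights of the approximants\<close>
  obtain c2 s where c2: "0 < c2" and ann: "\<And>q. poly Q' (of_rat q) \<noteq> 0 \<Longrightarrow> \<exists>t. t \<noteq> 0 \<and> degree t \<le> m \<and>
      (\<forall>i. \<bar>real_of_int (coeff t i)\<bar> \<le> c2 * naive_height q ^ s) \<and> poly (map_poly of_int t) (F (of_rat q)) = 0"
    using annihilating_poly[OF lat] unfolding F_def by auto
  \<comment> \<open>Equality would make \<open>F \<xi>\<close> a quotient \<open>a / b\<close> of
    lattice elements; then \<open>b * P' - a * Q'\<close> vanishes at \<xi>, hence identically, and
    \<open>F\<close> would be constant.\<close>
  have value_neq: "F (of_rat q) \<noteq> F (of_real \<xi>)" if q: "poly Q' (of_rat q) \<noteq> 0" for q
  proof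
    assume eq: "F (of_rat q) = F (of_real \<xi>)"
    obtain d C where "\<And>r. poly Q' (of_rat r) \<noteq> 0 \<Longrightarrow> \<exists>a b. b \<noteq> 0 \<and> poly P' (of_rat r) / poly Q' (of_rat r) = a / b \<and>
      a \<in> box (C * naive_height r ^ d) \<and> b \<in> box (C * naive_height r ^ d)"
      using homogenized_pair[OF lat] by blast
    then obtain a b where ab: "b \<noteq> 0" "F (of_rat q) = a / b"
      "a \<in> box (C * naive_height q ^ d)" "b \<in> box (C * naive_height q ^ d)"
      using q unfolding F_def by blast
    have "smult b P' - smult a Q' = 0"
    proof (rule lattice_poly_no_root[OF L1])
      show "lattice_poly (smult b P' - smult a Q')"
        by (intro lattice_poly_diff lattice_poly_smult[OF ab(3)] lattice_poly_smult[OF ab(4)] lat)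
      have "of_real \<zeta> = a / b" using eq ab \<zeta> by simp
      then show "poly (smult b P' - smult a Q') (of_real \<xi>) = 0"
        using ab(1) by (simp add: P\<xi>)
    qed
    then have "smult (b * D) P = smult (a * D) Q" by (simp add: P'_def Q'_def)
    then show False
      using coprime_proportional_degree_0[OF assms(12,11)] ab(1) \<open>D \<noteq> 0\<close> nonconstant by auto
  qed
  have alg: "eventually (\<lambda>n. (algebraic (\<alpha> n) \<and> alg_degree (\<alpha> n) = m \<and> \<alpha> n \<noteq> \<zeta>) \<and>
      real_of_int (height (\<alpha> n)) \<le> c2 * H n ^ s) sequentially"
    using good
  proof eventually_elim
    case (elim n)
    then have eval: "poly (map_poly of_int t) (F (of_rat (r n))) = of_real (poly (map_poly of_int t) (\<alpha> n))" for t
      by (simp add: poly_map_of_int_of_real)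
    obtain t where t: "t \<noteq> 0" "degree t \<le> m" "\<And>i. \<bar>real_of_int (coeff t i)\<bar> \<le> c2 * naive_height (r n) ^ s"
      "poly (map_poly of_int t) (F (of_rat (r n))) = 0"
      using ann elim by blast
    have root: "poly (map_poly of_int t) (\<alpha> n) = 0" using t(4) by (simp add: eval)
    have deg: "alg_degree (\<alpha> n) = m"
      by (rule alg_degree_eqI[OF t(1) root t(2)]) (use elim eval in auto)
    \<comment> \<open>Heights are integers, so the real bound is passed through its floor.\<close>
    have "\<bar>coeff t i\<bar> \<le> \<lfloor>c2 * naive_height (r n) ^ s\<rfloor>" for i
      using t(3)[of i] by (simp add: le_floor_iff)
    then have "height (\<alpha> n) \<le> \<lfloor>c2 * naive_height (r n) ^ s\<rfloor>"
      by (intro height_le_annihilator[OF t(1) root]) (use t(2) deg in auto)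
    then have "real_of_int (height (\<alpha> n)) \<le> c2 * naive_height (r n) ^ s" by (simp add: le_floor_iff)
    also have "\<dots> \<le> c2 * H n ^ s"
      using c2 naive_height_le_H naive_height_ge_1[of "r n"] by (intro mult_left_mono power_mono) auto
    finally have "real_of_int (height (\<alpha> n)) \<le> c2 * H n ^ s" .
    moreover have "algebraic (\<alpha> n)" using t(1) root by (auto simp: algebraic_iff_int_poly)
    moreover have "\<alpha> n \<noteq> \<zeta>" using value_neq[of "r n"] elim \<zeta> by auto
    ultimately show ?case using deg by blast
  qed
  have top: "omega_star m (of_real \<zeta>) = \<infinity>"
    by (rule omega_star_infiniteI[OF _ err c1 _ c2]) (use alg in eventually_elim, blast)+

  \<comment> \<open>Finite exponents in degrees below \<open>m\<close>\<close>
  have "omega_star d (of_real \<zeta>) < \<infinity>" if d: "d < m" for d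
  proof -
    \<comment> \<open>Keeping \<beta> within distance 1 of \<zeta> provides a common disc for the
      Lipschitz estimate; for all other \<beta> the lower bound 1 is immediate.\<close>
    define B where "B = {(\<beta>, h). algebraic \<beta> \<and> alg_degree \<beta> = d \<and> h = real_of_int (height \<beta>) \<and> \<bar>\<zeta> - \<beta>\<bar> \<le> 1}"
    obtain c s where c: "0 < c" and low: "\<And>q t h. poly Q' (of_rat q) \<noteq> 0 \<Longrightarrow> degree t \<le> d \<Longrightarrow> 1 \<le> h \<Longrightarrow>
        (\<And>i. \<bar>real_of_int (coeff t i)\<bar> \<le> h) \<Longrightarrow> poly (map_poly of_int t) (F (of_rat q)) \<noteq> 0 \<Longrightarrow>
        c \<le> norm (poly (map_poly of_int t) (F (of_rat q))) * (h * naive_height q) ^ s"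
      using int_poly_value_lower_bound[OF lat, of d] unfolding F_def by blast
    define A where "A = \<bar>\<zeta>\<bar> + 1"
    \<comment> \<open>The summand 1 keeps \<open>M\<close> positive for
      \<open>d = 0\<close>.\<close>
    define M where "M = real (d + 1) * (real d * A ^ d) + 1"
    have M: "0 < M" unfolding M_def by (intro add_nonneg_pos) (auto simp: A_def)
    have "0 < 1 / c1" using c1 by simp
    from eventually_error_small[OF this, of 0]
    \<comment> \<open>The minimal polynomial \<open>t\<close> of \<beta> does not vanish at
      \<open>\<alpha> n\<close>, whose degree \<open>m\<close> exceeds \<open>d\<close>, so its
      value there is bounded below. As \<open>t\<close> vanishes at \<beta>, the Lipschitz estimate
      bounds the same value above by a multiple of
      \<open>h * \<bar>\<alpha> n - \<beta>\<bar>\<close>; the exponent \<open>s + 1\<close> absorbs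
      this factor \<open>h\<close>.\<close>
    have sep: "eventually (\<lambda>n. \<forall>(\<beta>, h)\<in>B. c / M \<le> \<bar>\<alpha> n - \<beta>\<bar> * (h * H n) ^ (s + 1)) sequentially"
      using good
    proof eventually_elim
      case (elim n)
      have "c1 * H n powr (- \<omega> n) < 1" using elim c1 by (simp add: field_simps)
      then have \<alpha>A: "\<bar>\<alpha> n\<bar> \<le> A" using elim by (simp add: A_def) linarith
      have "c / M \<le> \<bar>\<alpha> n - \<beta>\<bar> * (h * H n) ^ (s + 1)" if \<beta>: "(\<beta>, h) \<in> B" for \<beta> h
      proof -
        define t where "t = min_int_poly \<beta>"
        have \<beta>': "algebraic \<beta>" "alg_degree \<beta> = d" "h = real_of_int (height \<beta>)" "\<bar>\<zeta> - \<beta>\<bar> \<le> 1"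
          using \<beta> by (auto simp: B_def)
        have "is_min_int_poly \<beta> t"
          unfolding t_def using \<beta>'(1) is_min_int_poly_min_int_poly by (auto simp: algebraic_iff_int_poly)
        then have t: "t \<noteq> 0" "poly (map_poly of_int t) \<beta> = 0" "degree t = d"
          using \<beta>'(2) by (auto simp: is_min_int_poly_def t_def alg_degree_def)
        have coeff: "\<bar>real_of_int (coeff t i)\<bar> \<le> h" for i
          using abs_coeff_le_height[of \<beta> i] unfolding \<beta>'(3) t_def by linarith
        have h: "1 \<le> h" unfolding \<beta>'(3) by (rule height_ge_1_algebraic[OF \<beta>'(1)])
        have Hn: "1 \<le> H n" "naive_height (r n) \<le> H n" by (rule H_ge_1, rule naive_height_le_H)
        have "c \<le> norm (poly (map_poly of_int t) (F (of_rat (r n)))) * (h * naive_height (r n)) ^ s"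
          using elim t d coeff h by (intro low) auto
        also have "\<dots> \<le> norm (poly (map_poly of_int t) (F (of_rat (r n)))) * (h * H n) ^ s"
          using h Hn naive_height_ge_1[of "r n"] by (intro mult_left_mono power_mono) auto
        also have "norm (poly (map_poly of_int t) (F (of_rat (r n)))) =
            norm (poly (map_poly of_int t) (of_real (\<alpha> n)) - poly (map_poly of_int t) (of_real \<beta>) :: complex)"
          using elim t(2) by (simp add: poly_map_of_int_of_real)
        also have "\<dots> \<le> h * (real (d + 1) * (real d * A ^ d)) * norm (of_real (\<alpha> n) - of_real \<beta> :: complex)"
        proof (rule poly_lipschitz)
          show "norm (of_real (\<alpha> n) :: complex) \<le> A" using \<alpha>A by simp
          show "norm (of_real \<beta> :: complex) \<le> A" using \<beta>'(4) by (simp add: A_def)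
          show "degree (map_poly of_int t :: complex poly) \<le> d" using t(3) by (simp add: degree_map_poly)
        qed (use coeff in \<open>auto simp: A_def coeff_map_poly\<close>)
        also have "norm (of_real (\<alpha> n) - of_real \<beta> :: complex) = \<bar>\<alpha> n - \<beta>\<bar>" by (simp flip: of_real_diff)
        also have "h * (real (d + 1) * (real d * A ^ d)) * \<bar>\<alpha> n - \<beta>\<bar> \<le> (h * H n) * M * \<bar>\<alpha> n - \<beta>\<bar>"
        proof (intro mult_right_mono mult_mono)
          show "h \<le> h * H n" using mult_left_mono[OF Hn(1), of h] h by simp
        qed (use h Hn in \<open>auto simp: M_def A_def\<close>)
        finally have "c \<le> M * (\<bar>\<alpha> n - \<beta>\<bar> * (h * H n) ^ (s + 1))"
          using h Hn by (simp add: mult_ac)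
        then show ?thesis using M by (simp add: field_simps)
      qed
      then show ?case by blast
    qed
    have "\<exists>c'>0. \<exists>W. \<forall>(\<beta>, h)\<in>B. c' \<le> \<bar>\<zeta> - \<beta>\<bar> * h ^ W"
    proof (rule lower_boundI[OF err c1 sep])
      show "0 < c / M" using c M by simp
      show "1 \<le> h" if "(\<beta>, h) \<in> B" for \<beta> h
        using that height_ge_1_algebraic by (auto simp: B_def)
    qed
    then obtain c' W where "0 < c'" "\<forall>(\<beta>, h)\<in>B. c' \<le> \<bar>\<zeta> - \<beta>\<bar> * h ^ W" by blast
    then have c': "0 < c'" "\<And>\<beta> h. (\<beta>, h) \<in> B \<Longrightarrow> c' \<le> \<bar>\<zeta> - \<beta>\<bar> * h ^ W" by blast+
    show ?thesis
    proof (rule omega_star_finiteI)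
      show "0 < min 1 c'" using c'(1) by simp
      fix \<beta> :: real assume \<beta>: "algebraic \<beta>" "alg_degree \<beta> = d"
      show "min 1 c' \<le> \<bar>\<zeta> - \<beta>\<bar> * real_of_int (height \<beta>) ^ W"
      proof (cases "\<bar>\<zeta> - \<beta>\<bar> \<le> 1")
        case True
        then show ?thesis using c'(2)[of \<beta> "real_of_int (height \<beta>)"] \<beta> by (auto simp: B_def)
      next
        case False
        then have "1 * 1 \<le> \<bar>\<zeta> - \<beta>\<bar> * real_of_int (height \<beta>) ^ W"
          using height_ge_1_algebraic[OF \<beta>(1)] by (intro mult_mono one_le_power) auto
        then show ?thesis by simp
      qed
    qed
  qed
  then have "U_number m (of_real \<zeta>)" using top by (simp add: U_number_def)
  then show ?thesis using \<zeta> F(1) by simp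
qed

end
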